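(* Let $k$ be a field. The forgetful functor $F: k\text{-HopfAlg} \rightarrow k\text{-Alg}$ from the category of Hopf algebras over $k$ to the category of associative unital $k$-algebras has a right adjoint; i.e. there exists a cofree Hopf algebra on every $k$-algebra.
   Context: $k$-HopfAlg denotes the category of Hopf algebras over the field $k$ (with Hopf algebra maps as morphisms), and $k$-Alg denotes the category of associative unital $k$-algebras (with unital algebra maps as morphisms). The functor $F$ sends a Hopf algebra to its underlying algebra. A cofree Hopf algebra on an algebra $A$ is the value at $A$ of a right adjoint of $F$, together with the counit of the adjunction at $A$: that is, a Hopf algebra $H(A)$ with an algebra map $p: H(A) \to A$ such that for every Hopf algebra $K$ and every algebra map $f: K \to A$ there is a unique Hopf algebra map $\bar f: K \to H(A)$ with $p \circ \bar f = f$. *)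

theory Defs
  imports "HOL-Algebra.Module" "HOL-Algebra.AbelCoset"
begin

section \<open>Linear maps and associative unital algebras\<close>

definition linear_maps ::
  "('k, 'r) ring_scheme \<Rightarrow> ('k, 'a, 'm) module_scheme \<Rightarrow> ('k, 'b, 'n) module_scheme \<Rightarrow> ('a \<Rightarrow> 'b) set"
  where "linear_maps R M N = {h \<in> carrier M \<rightarrow> carrier N.
    (\<forall>x\<in>carrier M. \<forall>y\<in>carrier M. h (x \<oplus>\<^bsub>M\<^esub> y) = h x \<oplus>\<^bsub>N\<^esub> h y) \<and>
    (\<forall>r\<in>carrier R. \<forall>x\<in>carrier M. h (r \<odot>\<^bsub>M\<^esub> x) = r \<odot>\<^bsub>N\<^esub> h x)}"

text \<open>The library locale \<^locale>\<open>algebra\<close> demands a commutative multiplication, so it is not usable here.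
  As \<^locale>\<open>ring\<close> does, this one admits the zero algebra.\<close>

locale k_algebra = R?: field R + module R A + A?: ring A
  for R (structure) and A (structure) +
  assumes smult_mult_left:
      "\<lbrakk>r \<in> carrier R; x \<in> carrier A; y \<in> carrier A\<rbrakk> \<Longrightarrow>
        (r \<odot>\<^bsub>A\<^esub> x) \<otimes>\<^bsub>A\<^esub> y = r \<odot>\<^bsub>A\<^esub> (x \<otimes>\<^bsub>A\<^esub> y)"
    and smult_mult_right:
      "\<lbrakk>r \<in> carrier R; x \<in> carrier A; y \<in> carrier A\<rbrakk> \<Longrightarrow>
        x \<otimes>\<^bsub>A\<^esub> (r \<odot>\<^bsub>A\<^esub> y) = r \<odot>\<^bsub>A\<^esub> (x \<otimes>\<^bsub>A\<^esub> y)"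

definition alg_hom ::
  "('k, 'r) ring_scheme \<Rightarrow> ('k, 'a, 'm) module_scheme \<Rightarrow> ('k, 'b, 'n) module_scheme \<Rightarrow> ('a \<Rightarrow> 'b) set"
  where "alg_hom R A B = ring_hom A B \<inter> linear_maps R A B"

definition scalar_algebra :: "('k, 'r) ring_scheme \<Rightarrow> ('k, 'k) module"
  where "scalar_algebra R =
    \<lparr>carrier = carrier R, mult = mult R, one = \<one>\<^bsub>R\<^esub>, zero = \<zero>\<^bsub>R\<^esub>, add = add R, smult = mult R\<rparr>"


section \<open>Tensor products\<close>

text \<open>The tensor product is the free module on the cartesian product of the carriers, modulo the
  submodule generated by the bilinearity relations; its elements are cosets. Only the module
  fields of \<open>free_module\<close> and \<open>tensor_space\<close> are meaningful.\<close>

definition free_module :: "('k, 'r) ring_scheme \<Rightarrow> 's set \<Rightarrow> ('k, 's \<Rightarrow> 'k) module"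
  where "free_module R S =
    \<lparr>carrier = {t. range t \<subseteq> carrier R \<and> finite {z. t z \<noteq> \<zero>\<^bsub>R\<^esub>} \<and> {z. t z \<noteq> \<zero>\<^bsub>R\<^esub>} \<subseteq> S},
     mult = undefined, one = undefined,
     zero = (\<lambda>z. \<zero>\<^bsub>R\<^esub>), add = (\<lambda>s t z. s z \<oplus>\<^bsub>R\<^esub> t z), smult = (\<lambda>r t z. r \<otimes>\<^bsub>R\<^esub> t z)\<rparr>"

definition free_gen :: "('k, 'r) ring_scheme \<Rightarrow> 's \<Rightarrow> 's \<Rightarrow> 'k"
  where "free_gen R z = (\<lambda>w. if w = z then \<one>\<^bsub>R\<^esub> else \<zero>\<^bsub>R\<^esub>)"

abbreviation tensor_free ::
  "('k, 'r) ring_scheme \<Rightarrow> ('k, 'a, 'm) module_scheme \<Rightarrow> ('k, 'b, 'n) module_scheme \<Rightarrow> ('k, 'a \<times> 'b \<Rightarrow> 'k) module"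
  where "tensor_free R M N \<equiv> free_module R (carrier M \<times> carrier N)"

definition bilinear_relations ::
  "('k, 'r) ring_scheme \<Rightarrow> ('k, 'a, 'm) module_scheme \<Rightarrow> ('k, 'b, 'n) module_scheme \<Rightarrow> ('a \<times> 'b \<Rightarrow> 'k) set"
  where "bilinear_relations R M N = (let F = tensor_free R M N; e = free_gen R in
      {e (x \<oplus>\<^bsub>M\<^esub> x', y) \<ominus>\<^bsub>F\<^esub> (e (x, y) \<oplus>\<^bsub>F\<^esub> e (x', y)) | x x' y.
          x \<in> carrier M \<and> x' \<in> carrier M \<and> y \<in> carrier N} \<union>
      {e (x, y \<oplus>\<^bsub>N\<^esub> y') \<ominus>\<^bsub>F\<^esub> (e (x, y) \<oplus>\<^bsub>F\<^esub> e (x, y')) | x y y'.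
          x \<in> carrier M \<and> y \<in> carrier N \<and> y' \<in> carrier N} \<union>
      {e (r \<odot>\<^bsub>M\<^esub> x, y) \<ominus>\<^bsub>F\<^esub> r \<odot>\<^bsub>F\<^esub> e (x, y) | r x y.
          r \<in> carrier R \<and> x \<in> carrier M \<and> y \<in> carrier N} \<union>
      {e (x, r \<odot>\<^bsub>N\<^esub> y) \<ominus>\<^bsub>F\<^esub> r \<odot>\<^bsub>F\<^esub> e (x, y) | r x y.
          r \<in> carrier R \<and> x \<in> carrier M \<and> y \<in> carrier N})"

definition tensor_null ::
  "('k, 'r) ring_scheme \<Rightarrow> ('k, 'a, 'm) module_scheme \<Rightarrow> ('k, 'b, 'n) module_scheme \<Rightarrow> ('a \<times> 'b \<Rightarrow> 'k) set"
  where "tensor_null R M N =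
    \<Inter> {S. submodule S R (tensor_free R M N) \<and> bilinear_relations R M N \<subseteq> S}"

definition tensor_space ::
  "('k, 'r) ring_scheme \<Rightarrow> ('k, 'a, 'm) module_scheme \<Rightarrow> ('k, 'b, 'n) module_scheme
    \<Rightarrow> ('k, ('a \<times> 'b \<Rightarrow> 'k) set) module"
  where "tensor_space R M N = (let F = tensor_free R M N; I = tensor_null R M N in
    \<lparr>carrier = a_rcosets\<^bsub>F\<^esub> I, mult = undefined, one = undefined,
     zero = I, add = set_add F, smult = (\<lambda>r X. \<Union>t\<in>X. I +>\<^bsub>F\<^esub> (r \<odot>\<^bsub>F\<^esub> t))\<rparr>)"

definition pure_tensor ::
  "('k, 'r) ring_scheme \<Rightarrow> ('k, 'a, 'm) module_scheme \<Rightarrow> ('k, 'b, 'n) module_scheme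
    \<Rightarrow> 'a \<Rightarrow> 'b \<Rightarrow> ('a \<times> 'b \<Rightarrow> 'k) set"
  where "pure_tensor R M N x y = tensor_null R M N +>\<^bsub>tensor_free R M N\<^esub> free_gen R (x, y)"

text \<open>\<open>tensor_lift R M N P b\<close> is the linear map on the tensor product of \<open>M\<close> and \<open>N\<close> induced by a
  bilinear map \<open>b\<close>. It is used for bilinear \<open>b\<close> only; restricting to extensional functions makes it
  unique.\<close>

definition tensor_lift ::
  "('k, 'r) ring_scheme \<Rightarrow> ('k, 'a, 'm) module_scheme \<Rightarrow> ('k, 'b, 'n) module_scheme
    \<Rightarrow> ('k, 'c, 'p) module_scheme \<Rightarrow> ('a \<Rightarrow> 'b \<Rightarrow> 'c) \<Rightarrow> ('a \<times> 'b \<Rightarrow> 'k) set \<Rightarrow> 'c"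
  where "tensor_lift R M N P b = (THE h.
    h \<in> linear_maps R (tensor_space R M N) P \<and>
    h \<in> extensional (carrier (tensor_space R M N)) \<and>
    (\<forall>x\<in>carrier M. \<forall>y\<in>carrier N. h (pure_tensor R M N x y) = b x y))"

definition tensor_map ::
  "('k, 'r) ring_scheme \<Rightarrow> ('k, 'a, 'm) module_scheme \<Rightarrow> ('k, 'b, 'n) module_scheme
    \<Rightarrow> ('k, 'c, 'p) module_scheme \<Rightarrow> ('k, 'd, 'q) module_scheme
    \<Rightarrow> ('a \<Rightarrow> 'c) \<Rightarrow> ('b \<Rightarrow> 'd) \<Rightarrow> ('a \<times> 'b \<Rightarrow> 'k) set \<Rightarrow> ('c \<times> 'd \<Rightarrow> 'k) set"
  where "tensor_map R M N M' N' f g =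
    tensor_lift R M N (tensor_space R M' N') (\<lambda>x y. pure_tensor R M' N' (f x) (g y))"

definition tensor_assoc ::
  "('k, 'r) ring_scheme \<Rightarrow> ('k, 'a, 'm) module_scheme \<Rightarrow> ('k, 'b, 'n) module_scheme
    \<Rightarrow> ('k, 'c, 'p) module_scheme
    \<Rightarrow> (('a \<times> 'b \<Rightarrow> 'k) set \<times> 'c \<Rightarrow> 'k) set \<Rightarrow> ('a \<times> ('b \<times> 'c \<Rightarrow> 'k) set \<Rightarrow> 'k) set"
  where "tensor_assoc R L M N =
    (let P = tensor_space R L (tensor_space R M N) in
     tensor_lift R (tensor_space R L M) N P
       (\<lambda>u z. tensor_lift R L M P
         (\<lambda>x y. pure_tensor R L (tensor_space R M N) x (pure_tensor R M N y z)) u))"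

definition tensor_algebra ::
  "('k, 'r) ring_scheme \<Rightarrow> ('k, 'a, 'm) module_scheme \<Rightarrow> ('k, 'b, 'n) module_scheme
    \<Rightarrow> ('k, ('a \<times> 'b \<Rightarrow> 'k) set) module"
  where "tensor_algebra R A B = (let T = tensor_space R A B in T
    \<lparr>mult := (\<lambda>X Y. tensor_lift R A B T
        (\<lambda>x y. tensor_lift R A B T
          (\<lambda>x' y'. pure_tensor R A B (x \<otimes>\<^bsub>A\<^esub> x') (y \<otimes>\<^bsub>B\<^esub> y')) Y) X),
     one := pure_tensor R A B \<one>\<^bsub>A\<^esub> \<one>\<^bsub>B\<^esub>\<rparr>)"


section \<open>Hopf algebras\<close>

text \<open>The underlying algebra of a Hopf algebra is obtained by record subtyping.\<close>

record ('k, 'a) hopf = "('k, 'a) module" +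
  comult :: "'a \<Rightarrow> ('a \<times> 'a \<Rightarrow> 'k) set"
  counit :: "'a \<Rightarrow> 'k"
  antipode :: "'a \<Rightarrow> 'a"

locale coalgebra = R?: field R + module R C
  for R (structure) and C :: "('k, 'a, 'm) hopf_scheme" (structure) +
  assumes comult_linear: "comult C \<in> linear_maps R C (tensor_space R C C)"
    and counit_linear: "counit C \<in> linear_maps R C (scalar_algebra R)"
    and coassoc: "c \<in> carrier C \<Longrightarrow>
      tensor_assoc R C C C (tensor_map R C C (tensor_space R C C) C (comult C) id (comult C c)) =
      tensor_map R C C C (tensor_space R C C) id (comult C) (comult C c)"
    and counit_left: "c \<in> carrier C \<Longrightarrow>
      tensor_lift R C C C (\<lambda>x y. counit C x \<odot>\<^bsub>C\<^esub> y) (comult C c) = c"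
    and counit_right: "c \<in> carrier C \<Longrightarrow>
      tensor_lift R C C C (\<lambda>x y. counit C y \<odot>\<^bsub>C\<^esub> x) (comult C c) = c"

locale bialgebra = k_algebra R H + coalgebra R H
  for R (structure) and H (structure) +
  assumes comult_hom: "comult H \<in> alg_hom R H (tensor_algebra R H H)"
    and counit_hom: "counit H \<in> alg_hom R H (scalar_algebra R)"

locale hopf_algebra = bialgebra R H
  for R (structure) and H (structure) +
  assumes antipode_linear: "antipode H \<in> linear_maps R H H"
    and antipode_left: "c \<in> carrier H \<Longrightarrow>
      tensor_lift R H H H (mult H) (tensor_map R H H H H (antipode H) id (comult H c)) =
      counit H c \<odot>\<^bsub>H\<^esub> \<one>\<^bsub>H\<^esub>"
    and antipode_right: "c \<in> carrier H \<Longrightarrow>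
      tensor_lift R H H H (mult H) (tensor_map R H H H H id (antipode H) (comult H c)) =
      counit H c \<odot>\<^bsub>H\<^esub> \<one>\<^bsub>H\<^esub>"

text \<open>The last clause is automatic for bialgebra maps between Hopf algebras.\<close>

definition hopf_hom ::
  "('k, 'r) ring_scheme \<Rightarrow> ('k, 'a, 'm) hopf_scheme \<Rightarrow> ('k, 'b, 'n) hopf_scheme \<Rightarrow> ('a \<Rightarrow> 'b) set"
  where "hopf_hom R K H = {f \<in> alg_hom R K H. \<forall>x\<in>carrier K.
      comult H (f x) = tensor_map R K K H H f f (comult K x) \<and>
      counit H (f x) = counit K x \<and>
      antipode H (f x) = f (antipode K x)}"


section \<open>Cofree Hopf algebras\<close>

text \<open>A formula cannot quantify over types, so the carrier type \<open>'c\<close> of the test Hopf algebras \<open>K\<close> is a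
  parameter. Maps out of \<open>K\<close> matter on the carrier of \<open>K\<close> only; extensionality picks one
  representative.\<close>

definition cofree_hopf_algebra ::
  "'c itself \<Rightarrow> ('k, 'r) ring_scheme \<Rightarrow> ('k, 'a, 'm) module_scheme \<Rightarrow> ('k, 'h) hopf \<Rightarrow> ('h \<Rightarrow> 'a) \<Rightarrow> bool"
  where "cofree_hopf_algebra (_ :: 'c itself) R A H p \<longleftrightarrow>
    hopf_algebra R H \<and> p \<in> alg_hom R H A \<and>
    (\<forall>(K :: ('k, 'c) hopf) f. hopf_algebra R K \<and> f \<in> alg_hom R K A \<longrightarrow>
      (\<exists>!g. g \<in> hopf_hom R K H \<and> g \<in> extensional (carrier K) \<and>
        (\<forall>x\<in>carrier K. p (g x) = f x)))"

text \<open>A type with room for the carrier of the cofree Hopf algebra on \<open>A\<close>: every element of a Hopf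
  algebra lies in a Hopf subalgebra of countable dimension, so an element of the cofree Hopf algebra
  is determined by the structure constants of such a subalgebra \<open>K\<close>, the values in \<open>A\<close> of an
  algebra map on a basis of \<open>K\<close>, and the coordinates of an element of \<open>K\<close>. Having the universal property for test objects on this type
  pins down the pair \<open>(H, p)\<close> up to isomorphism without reference to any further type; the universal
  property for test objects on an arbitrary type \<open>'c\<close> is then a statement about that same pair.\<close>

type_synonym ('k, 'a) cofree_carrier = "nat \<Rightarrow> 'k \<times> 'a"

end

theory Submission
  imports Defs "HOL-Library.Nat_Bijection"
begin

text \<open>Let \<open>f\<close> be an algebra map from a Hopf algebra \<open>K\<close> with antipode \<open>S\<close> to \<open>A\<close>. The composites of \<open>f\<close> with the
  powers of \<open>S\<close> are algebra maps for even exponents and anti-homomorphisms for odd ones, and a Hopf algebra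
  map over \<open>A\<close> out of \<open>K\<close> can only depend on them and on the iterated comultiplication. So \<open>x\<close> in \<open>K\<close> is
  recorded as the function sending a word with letters \<open>(n\<^sub>i, \<lambda>\<^sub>i)\<close>, the \<open>\<lambda>\<^sub>i\<close> being linear functionals on
  \<open>A\<close>, to the Sweedler sum of the products of the scalars \<open>\<lambda>\<^sub>i (f (S\<^sup>n\<^sup>i x\<^sub>i))\<close>. For fixed \<open>n\<^sub>1, \<dots>, n\<^sub>m\<close> this is
  an element of the \<open>m\<close>-th tensor power of \<open>A\<close>, read as a multilinear form. Functions of this shape multiply
  letterwise, with the opposite multiplication of \<open>A\<close> at odd letters; comultiplication is deconcatenation of
  words, and the antipode reverses a word and increases all \<open>n\<^sub>i\<close> by one. The largest set of such functions
  that is stable under these operations and satisfies the antipode axioms is the cofree Hopf algebra.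

  Tensor identities are checked on functionals: over a field, products of functionals from two
  separating families separate the points of a tensor product. Finally, a function of the above shape is
  given by a finite list of elements of \<open>k\<close> and \<open>A\<close> for every \<open>n\<^sub>1, \<dots>, n\<^sub>m\<close>, so it can be encoded as a map from
  \<open>nat\<close> to \<open>k \<times> A\<close>.\<close>


section \<open>Sums over lists and linear functionals\<close>

text \<open>A type cannot depend on the length of a word, so the tensor powers of \<open>A\<close>
  have no common carrier; values on linear functionals put all of them into one function space.
  Coassociativity then is associativity of concatenation. The obstacle is finiteness: after
  deconcatenation, (u, v) \<mapsto> \<phi> (u @ v) need not be a finite sum of products, as with the
  finite dual of an algebra, and the antipode axioms are a further condition. Stability collects
  what is missing as a condition on single functions, so that it passes to unions; closure under
  sums and products is not imposed but deduced, because the subalgebra generated by the largest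
  stable set is again stable. Universality then follows: the image of any test Hopf algebra is a
  stable set, whatever its size or type, so it lies in the largest one. The same object serves all
  test types, and an arbitrary cofree object on the coded carrier type is compared with it through
  an isomorphism over \<open>A\<close>. The coding is possible because index lists are countable and
  functionals are not recorded: finitely many rows determine the values on all words with given
  indices.\<close>

primrec lsum :: "('b, 'n) ring_scheme \<Rightarrow> ('a \<Rightarrow> 'b) \<Rightarrow> 'a list \<Rightarrow> 'b" where
  "lsum P f [] = \<zero>\<^bsub>P\<^esub>"
| "lsum P f (x # xs) = f x \<oplus>\<^bsub>P\<^esub> lsum P f xs"

lemma lsum_map: "lsum P f (map h xs) = lsum P (\<lambda>x. f (h x)) xs"
  by (induction xs) auto

lemma lsum_cong [fundef_cong]:
  "xs = ys \<Longrightarrow> (\<And>x. x \<in> set ys \<Longrightarrow> f x = g x) \<Longrightarrow> lsum P f xs = lsum P g ys"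
  by (induction xs arbitrary: ys) auto

context abelian_group
begin

lemma minus_eq_zeroD: "x \<ominus> y = \<zero> \<Longrightarrow> x \<in> carrier G \<Longrightarrow> y \<in> carrier G \<Longrightarrow> x = y"
  using minus_equality[of x "\<ominus> y"] by (simp add: a_minus_def)

lemma lsum_closed [simp, intro]: "(\<And>x. x \<in> set xs \<Longrightarrow> f x \<in> carrier G) \<Longrightarrow> lsum G f xs \<in> carrier G"
  by (induction xs) auto

lemma lsum_append:
  assumes "\<And>x. x \<in> set xs \<union> set ys \<Longrightarrow> f x \<in> carrier G"
  shows "lsum G f (xs @ ys) = lsum G f xs \<oplus> lsum G f ys"
  using assms by (induction xs) (auto simp: a_assoc)

lemma lsum_concat:
  assumes "\<And>x y. x \<in> set xs \<Longrightarrow> y \<in> set (h x) \<Longrightarrow> f y \<in> carrier G"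
  shows "lsum G f (concat (map h xs)) = lsum G (\<lambda>x. lsum G f (h x)) xs"
  using assms
proof (induction xs)
  case (Cons x xs)
  have "lsum G f (h x @ concat (map h xs)) = lsum G f (h x) \<oplus> lsum G f (concat (map h xs))"
    by (rule lsum_append) (use Cons.prems in fastforce)
  moreover have "lsum G f (concat (map h xs)) = lsum G (\<lambda>x. lsum G f (h x)) xs"
    by (rule Cons.IH) (use Cons.prems in auto)
  ultimately show ?case by simp
qed auto

lemma lsum_zero: "(\<And>x. x \<in> set xs \<Longrightarrow> f x = \<zero>) \<Longrightarrow> lsum G f xs = \<zero>"
  by (induction xs) auto

lemma lsum_add:
  assumes "\<And>x. x \<in> set xs \<Longrightarrow> f x \<in> carrier G" "\<And>x. x \<in> set xs \<Longrightarrow> g x \<in> carrier G"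
  shows "lsum G (\<lambda>x. f x \<oplus> g x) xs = lsum G f xs \<oplus> lsum G g xs"
  using assms
proof (induction xs)
  case (Cons x xs)
  then have "f x \<in> carrier G" "g x \<in> carrier G" "lsum G f xs \<in> carrier G" "lsum G g xs \<in> carrier G"
    by auto
  then show ?case using Cons by (auto simp: a_ac)
qed auto

lemma lsum_swap:
  assumes "\<And>x y. x \<in> set xs \<Longrightarrow> y \<in> set ys \<Longrightarrow> f x y \<in> carrier G"
  shows "lsum G (\<lambda>x. lsum G (f x) ys) xs = lsum G (\<lambda>y. lsum G (\<lambda>x. f x y) xs) ys"
  using assms
proof (induction xs)
  case Nil
  show ?case by (simp add: lsum_zero)
next
  case (Cons x xs)
  then show ?case by (simp add: lsum_add)
qed

end

lemma (in ring) lsum_ldistr: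
  "(\<And>x. x \<in> set xs \<Longrightarrow> f x \<in> carrier R) \<Longrightarrow> r \<in> carrier R \<Longrightarrow>
    r \<otimes> lsum R f xs = lsum R (\<lambda>x. r \<otimes> f x) xs"
  by (induction xs) (auto simp: r_distr)

lemma (in ring) lsum_rdistr:
  "(\<And>x. x \<in> set xs \<Longrightarrow> f x \<in> carrier R) \<Longrightarrow> r \<in> carrier R \<Longrightarrow>
    lsum R f xs \<otimes> r = lsum R (\<lambda>x. f x \<otimes> r) xs"
  by (induction xs) (auto simp: l_distr)

lemma (in module) lsum_smult:
  "(\<And>x. x \<in> set xs \<Longrightarrow> f x \<in> carrier M) \<Longrightarrow> r \<in> carrier R \<Longrightarrow>
    r \<odot>\<^bsub>M\<^esub> lsum M f xs = lsum M (\<lambda>x. r \<odot>\<^bsub>M\<^esub> f x) xs"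
  by (induction xs) (auto simp: smult_r_distr)

lemma (in module) lsum_smult_left:
  "(\<And>x. x \<in> set xs \<Longrightarrow> f x \<in> carrier R) \<Longrightarrow> m \<in> carrier M \<Longrightarrow>
    lsum R f xs \<odot>\<^bsub>M\<^esub> m = lsum M (\<lambda>x. f x \<odot>\<^bsub>M\<^esub> m) xs"
  by (induction xs) (auto simp: smult_l_distr)

section \<open>Linear maps between modules\<close>

lemma linear_mapsI:
  assumes "\<And>x. x \<in> carrier M \<Longrightarrow> h x \<in> carrier N"
    and "\<And>x y. x \<in> carrier M \<Longrightarrow> y \<in> carrier M \<Longrightarrow> h (x \<oplus>\<^bsub>M\<^esub> y) = h x \<oplus>\<^bsub>N\<^esub> h y"
    and "\<And>r x. r \<in> carrier R \<Longrightarrow> x \<in> carrier M \<Longrightarrow> h (r \<odot>\<^bsub>M\<^esub> x) = r \<odot>\<^bsub>N\<^esub> h x"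
  shows "h \<in> linear_maps R M N"
  using assms by (auto simp: linear_maps_def)

lemma linear_closed: "h \<in> linear_maps R M N \<Longrightarrow> x \<in> carrier M \<Longrightarrow> h x \<in> carrier N"
  by (auto simp: linear_maps_def)

lemma linear_add: "h \<in> linear_maps R M N \<Longrightarrow> x \<in> carrier M \<Longrightarrow> y \<in> carrier M \<Longrightarrow>
    h (x \<oplus>\<^bsub>M\<^esub> y) = h x \<oplus>\<^bsub>N\<^esub> h y"
  by (auto simp: linear_maps_def)

lemma linear_smult: "h \<in> linear_maps R M N \<Longrightarrow> r \<in> carrier R \<Longrightarrow> x \<in> carrier M \<Longrightarrow>
    h (r \<odot>\<^bsub>M\<^esub> x) = r \<odot>\<^bsub>N\<^esub> h x"
  by (auto simp: linear_maps_def)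

lemma linear_zero:
  assumes "module R M" "module R N" "h \<in> linear_maps R M N"
  shows "h \<zero>\<^bsub>M\<^esub> = \<zero>\<^bsub>N\<^esub>"
proof -
  interpret M: module R M by fact
  interpret N: module R N by fact
  have "h (\<zero>\<^bsub>R\<^esub> \<odot>\<^bsub>M\<^esub> \<zero>\<^bsub>M\<^esub>) = \<zero>\<^bsub>R\<^esub> \<odot>\<^bsub>N\<^esub> h \<zero>\<^bsub>M\<^esub>"
    by (rule linear_smult[OF assms(3)]) auto
  then show ?thesis using linear_closed[OF assms(3)] by simp
qed

lemma linear_lsum:
  assumes "module R M" "module R N" "h \<in> linear_maps R M N"
    and "\<And>x. x \<in> set xs \<Longrightarrow> f x \<in> carrier M"
  shows "h (lsum M f xs) = lsum N (\<lambda>x. h (f x)) xs"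
proof -
  interpret M: module R M by fact
  interpret N: module R N by fact
  show ?thesis using assms(4)
    by (induction xs) (auto simp: linear_zero[OF assms(1-3)] linear_add[OF assms(3)])
qed

lemma linear_minus:
  assumes "module R M" "module R N" "h \<in> linear_maps R M N" "x \<in> carrier M"
  shows "h (\<ominus>\<^bsub>M\<^esub> x) = \<ominus>\<^bsub>N\<^esub> h x"
proof -
  interpret M: module R M by fact
  interpret N: module R N by fact
  have "h (\<ominus>\<^bsub>M\<^esub> x) \<oplus>\<^bsub>N\<^esub> h x = \<zero>\<^bsub>N\<^esub>"
    using assms(4) by (simp add: linear_add[OF assms(3), symmetric] M.l_neg linear_zero[OF assms(1-3)])
  then show ?thesis
    using linear_closed[OF assms(3)] assms(4) by (metis M.a_inv_closed N.minus_equality)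
qed

lemma linear_id: "(\<lambda>x. x) \<in> linear_maps R M M" and linear_id': "id \<in> linear_maps R M M"
  by (auto simp: linear_maps_def)

lemma linear_comp: "h \<in> linear_maps R N P \<Longrightarrow> g \<in> linear_maps R M N \<Longrightarrow> (\<lambda>x. h (g x)) \<in> linear_maps R M P"
  by (auto simp: linear_maps_def Pi_iff)

lemma linear_const_zero: "module R N \<Longrightarrow> (\<lambda>x. \<zero>\<^bsub>N\<^esub>) \<in> linear_maps R M N"
proof -
  assume "module R N"
  then interpret N: module R N .
  show ?thesis by (rule linear_mapsI) auto
qed

lemma linear_plus:
  assumes "module R N" "f \<in> linear_maps R M N" "g \<in> linear_maps R M N"
  shows "(\<lambda>x. f x \<oplus>\<^bsub>N\<^esub> g x) \<in> linear_maps R M N"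
proof -
  interpret N: module R N by fact
  show ?thesis
    by (rule linear_mapsI)
      (use assms in \<open>auto simp: linear_closed linear_add linear_smult N.smult_r_distr N.a_ac\<close>)
qed

lemma linear_sum:
  assumes "module R N" "\<And>p. p \<in> set ds \<Longrightarrow> f p \<in> linear_maps R M N"
  shows "(\<lambda>x. lsum N (\<lambda>p. f p x) ds) \<in> linear_maps R M N"
  using assms(2) by (induction ds) (auto intro: linear_const_zero linear_plus assms(1))

lemma linear_smult_const:
  assumes "module R N" "f \<in> linear_maps R M N" "r \<in> carrier R"
  shows "(\<lambda>x. r \<odot>\<^bsub>N\<^esub> f x) \<in> linear_maps R M N"
proof -
  interpret N: module R N by fact
  show ?thesis
    by (rule linear_mapsI) (use assms in \<open>auto simp: linear_closed linear_add linear_smult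
      N.smult_r_distr N.smult_assoc1[symmetric] N.R.m_comm\<close>)
qed

lemma linear_cong:
  "module R M \<Longrightarrow> f \<in> linear_maps R M N \<Longrightarrow> (\<And>x. x \<in> carrier M \<Longrightarrow> g x = f x) \<Longrightarrow> g \<in> linear_maps R M N"
proof -
  assume "module R M" and *: "f \<in> linear_maps R M N" "\<And>x. x \<in> carrier M \<Longrightarrow> g x = f x"
  then interpret module R M by simp
  show ?thesis by (rule linear_mapsI) (use * in \<open>auto simp: linear_closed linear_add linear_smult\<close>)
qed

lemma scalar_algebra_simps [simp]:
  "carrier (scalar_algebra R) = carrier R" "mult (scalar_algebra R) = mult R"
  "one (scalar_algebra R) = one R" "zero (scalar_algebra R) = zero R"
  "add (scalar_algebra R) = add R" "smult (scalar_algebra R) = mult R"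
  by (auto simp: scalar_algebra_def)

lemma lsum_scalar_algebra [simp]: "lsum (scalar_algebra R) f xs = lsum R f xs"
  by (induction xs) auto

lemma (in cring) scalar_algebra_module: "module R (scalar_algebra R)"
proof (rule moduleI)
  show "cring R" by (rule is_cring)
  show "abelian_group (scalar_algebra R)"
    by (rule abelian_groupI) (auto simp: a_ac intro: bexI[of _ "\<ominus> _"] l_neg)
qed (auto simp: l_distr r_distr m_assoc)

section \<open>Functionals and separating families\<close>

abbreviation dual :: "('k, 'r) ring_scheme \<Rightarrow> ('k, 'a, 'm) module_scheme \<Rightarrow> ('a \<Rightarrow> 'k) set" where
  "dual R M \<equiv> linear_maps R M (scalar_algebra R)"

lemma linear_smult_left:
  fixes R (structure)
  assumes "module R N" "f \<in> dual R M" "m \<in> carrier N"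
  shows "(\<lambda>x. f x \<odot>\<^bsub>N\<^esub> m) \<in> linear_maps R M N"
proof -
  interpret N: module R N by fact
  show ?thesis
    by (rule linear_mapsI) (use assms linear_closed[OF assms(2)] in
      \<open>auto simp: linear_add[OF assms(2)] linear_smult[OF assms(2)] N.smult_l_distr N.smult_assoc1\<close>)
qed

text \<open>Takes the place of bases: identities are proved by applying enough functionals. The
  evaluations at words form such a family for the cofree Hopf algebra, and the whole dual does for
  any vector space.\<close>

definition separating :: "('k, 'r) ring_scheme \<Rightarrow> ('k, 'a, 'm) module_scheme \<Rightarrow> ('a \<Rightarrow> 'k) set \<Rightarrow> bool" where
  "separating R M F \<longleftrightarrow> F \<subseteq> dual R M \<and>
    (\<forall>x\<in>carrier M. (\<forall>\<alpha>\<in>F. \<alpha> x = \<zero>\<^bsub>R\<^esub>) \<longrightarrow> x = \<zero>\<^bsub>M\<^esub>)"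

lemma separatingD:
  assumes "module R M" "separating R M F" "x \<in> carrier M" "y \<in> carrier M"
    "\<And>\<alpha>. \<alpha> \<in> F \<Longrightarrow> \<alpha> x = \<alpha> y"
  shows "x = y"
proof -
  interpret module R M by fact
  have "x \<ominus>\<^bsub>M\<^esub> y = \<zero>\<^bsub>M\<^esub>"
  proof -
    have "\<alpha> (x \<ominus>\<^bsub>M\<^esub> y) = \<zero>\<^bsub>R\<^esub>" if "\<alpha> \<in> F" for \<alpha>
    proof -
      have l: "\<alpha> \<in> dual R M" using that assms(2) by (auto simp: separating_def)
      show ?thesis
        using assms(3,4) linear_add[OF l, of x "\<ominus>\<^bsub>M\<^esub> y"]
          linear_smult[OF l, of "\<ominus>\<^bsub>R\<^esub> \<one>\<^bsub>R\<^esub>" y] linear_closed[OF l] assms(5)[OF that]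
        by (simp add: a_minus_def smult_l_minus R.l_minus R.r_neg )
    qed
    then show ?thesis using assms by (auto simp: separating_def)
  qed
  then show ?thesis using assms(3,4) by (rule M.minus_eq_zeroD)
qed

text \<open>A submodule maximal among those containing \<open>U\<close> but not \<open>x\<close> is a complement of the line through \<open>x\<close>.\<close>

lemma dual_extension:
  fixes R (structure)
  assumes "field R" "module R M" "submodule U R M" "x \<in> carrier M" "x \<notin> U"
  obtains \<alpha> where "\<alpha> \<in> dual R M" "\<alpha> x = \<one>" "\<And>u. u \<in> U \<Longrightarrow> \<alpha> u = \<zero>"
proof -
  interpret field R by fact
  interpret M: module R M by fact
  define \<W> where "\<W> = {W. submodule W R M \<and> U \<subseteq> W \<and> x \<notin> W}"
  have "\<exists>W\<in>\<W>. \<forall>X\<in>\<W>. W \<subseteq> X \<longrightarrow> X = W"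
  proof (rule subset_Zorn_nonempty)
    show "\<W> \<noteq> {}" using assms(3,5) by (auto simp: \<W>_def)
    fix \<C> assume \<C>: "\<C> \<noteq> {}" "subset.chain \<W> \<C>"
    then have sub: "\<And>W. W \<in> \<C> \<Longrightarrow> submodule W R M" and *: "\<And>W. W \<in> \<C> \<Longrightarrow> U \<subseteq> W \<and> x \<notin> W"
      by (auto simp: subset.chain_def \<W>_def)
    have "submodule (\<Union>\<C>) R M"
    proof (rule M.submoduleI)
      fix a b assume "a \<in> \<Union>\<C>" "b \<in> \<Union>\<C>"
      then obtain V W where VW: "V \<in> \<C>" "W \<in> \<C>" "a \<in> V" "b \<in> W" by blast
      moreover have "V \<subseteq> W \<or> W \<subseteq> V"
        using \<C>(2) VW by (auto simp: subset_chain_def)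
      ultimately show "a \<oplus>\<^bsub>M\<^esub> b \<in> \<Union>\<C>"
        by (meson M.submoduleE(5)[OF sub] UnionI subsetD)
    next
      obtain W where "W \<in> \<C>" using \<C>(1) by blast
      moreover have "\<zero>\<^bsub>M\<^esub> \<in> W" using subgroup.one_closed[OF submodule.axioms(1)[OF sub[OF \<open>W \<in> \<C>\<close>]]]
        by simp
      ultimately show "\<zero>\<^bsub>M\<^esub> \<in> \<Union>\<C>" by blast
    next
      show "\<Union>\<C> \<subseteq> carrier M" using M.submoduleE(1)[OF sub] by (intro Union_least)
    next
      fix a assume "a \<in> \<Union>\<C>"
      then show "\<ominus>\<^bsub>M\<^esub> a \<in> \<Union>\<C>" using M.submoduleE(3)[OF sub] by (meson UnionE UnionI)
    next
      fix r a assume "r \<in> carrier R" "a \<in> \<Union>\<C>"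
      then show "r \<odot>\<^bsub>M\<^esub> a \<in> \<Union>\<C>" using M.submoduleE(4)[OF sub] by (meson UnionE UnionI)
    qed
    then show "\<Union>\<C> \<in> \<W>" using * \<C>(1) by (auto simp: \<W>_def)
  qed
  then obtain W where "W \<in> \<W>" and W': "\<And>X. X \<in> \<W> \<Longrightarrow> W \<subseteq> X \<Longrightarrow> X = W"
    by (elim bexE) simp
  then have W: "submodule W R M" "U \<subseteq> W" "x \<notin> W"
    by (auto simp: \<W>_def)
  have max: "X = W" if "submodule X R M" "W \<subseteq> X" "x \<notin> X" for X
    using W'[of X] W(2) that by (simp add: \<W>_def)
  note WE = M.submoduleE[OF W(1)]
  have W0: "\<zero>\<^bsub>M\<^esub> \<in> W" using subgroup.one_closed[OF submodule.axioms(1)[OF W(1)]] by simp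
  have Wc: "w \<in> carrier M" if "w \<in> W" for w using that WE(1) by blast
  \<comment> \<open>The coefficient of \<open>x\<close> is unique: otherwise the difference of two
    coefficients is invertible, and dividing by it puts \<open>x\<close> into
    \<open>W\<close>.\<close>
  have cancel: "r = s" if "r \<in> carrier R" "s \<in> carrier R" "w \<in> W" "v \<in> W"
    "w \<oplus>\<^bsub>M\<^esub> r \<odot>\<^bsub>M\<^esub> x = v \<oplus>\<^bsub>M\<^esub> s \<odot>\<^bsub>M\<^esub> x" for r s w v
  proof (rule ccontr)
    assume "r \<noteq> s"
    then have nz: "r \<ominus> s \<in> Units R" using that
      by (auto simp: field_Units dest: minus_eq_zeroD)
    have "(r \<ominus> s) \<odot>\<^bsub>M\<^esub> x = r \<odot>\<^bsub>M\<^esub> x \<oplus>\<^bsub>M\<^esub> \<ominus>\<^bsub>M\<^esub> (s \<odot>\<^bsub>M\<^esub> x)"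
      using that assms(4) by (simp add: a_minus_def M.smult_l_distr M.smult_l_minus)
    also have "\<dots> = (\<ominus>\<^bsub>M\<^esub> w \<oplus>\<^bsub>M\<^esub> (w \<oplus>\<^bsub>M\<^esub> r \<odot>\<^bsub>M\<^esub> x)) \<oplus>\<^bsub>M\<^esub> \<ominus>\<^bsub>M\<^esub> (s \<odot>\<^bsub>M\<^esub> x)"
      using that(1-4) assms(4) by (simp add: Wc M.a_assoc[symmetric] M.l_neg)
    also have "\<dots> = \<ominus>\<^bsub>M\<^esub> w \<oplus>\<^bsub>M\<^esub> v"
      using that assms(4) by (simp add: Wc M.a_assoc M.r_neg)
    finally have "(r \<ominus> s) \<odot>\<^bsub>M\<^esub> x \<in> W" using that WE by auto
    then have "inv (r \<ominus> s) \<odot>\<^bsub>M\<^esub> ((r \<ominus> s) \<odot>\<^bsub>M\<^esub> x) \<in> W"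
      using WE(4) nz by blast
    then show False
      using nz assms(4) W(3) that by (simp add: M.smult_assoc1[symmetric])
  qed
  \<comment> \<open>If \<open>y\<close> is outside \<open>W\<close>, the submodule \<open>X\<close>
    spanned by \<open>W\<close> and \<open>y\<close> must contain \<open>x\<close> by maximality.
    The coefficient \<open>s\<close> of \<open>y\<close> in \<open>x\<close> is nonzero because
    \<open>x\<close> is outside \<open>W\<close>, so the relation can be solved for
    \<open>y\<close>.\<close>
  have ex: "\<exists>r\<in>carrier R. \<exists>w\<in>W. y = w \<oplus>\<^bsub>M\<^esub> r \<odot>\<^bsub>M\<^esub> x" if y: "y \<in> carrier M" for y
  proof (cases "y \<in> W")
    case True
    then show ?thesis using y assms(4) by (intro bexI[of _ "\<zero>"] bexI[of _ y]) auto
  next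
    case False
    define X where "X = {w \<oplus>\<^bsub>M\<^esub> r \<odot>\<^bsub>M\<^esub> y | w r. w \<in> W \<and> r \<in> carrier R}"
    have XI: "w \<oplus>\<^bsub>M\<^esub> r \<odot>\<^bsub>M\<^esub> y \<in> X" if "w \<in> W" "r \<in> carrier R" for w r
      using that by (auto simp: X_def)
    have "submodule X R M"
    proof (rule M.submoduleI)
      show "X \<subseteq> carrier M" using y by (auto simp: X_def Wc)
      show "\<zero>\<^bsub>M\<^esub> \<in> X" using XI[OF W0, of \<zero>] y by simp
    next
      fix a assume "a \<in> X"
      then obtain w r where a: "a = w \<oplus>\<^bsub>M\<^esub> r \<odot>\<^bsub>M\<^esub> y" "w \<in> W" "r \<in> carrier R" by (auto simp: X_def)
      then have "\<ominus>\<^bsub>M\<^esub> a = \<ominus>\<^bsub>M\<^esub> w \<oplus>\<^bsub>M\<^esub> (\<ominus> r) \<odot>\<^bsub>M\<^esub> y"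
        using y by (simp add: Wc M.minus_add M.smult_l_minus)
      then show "\<ominus>\<^bsub>M\<^esub> a \<in> X" using XI a WE by simp
    next
      fix a b assume "a \<in> X" "b \<in> X"
      then obtain w r v s where a: "a = w \<oplus>\<^bsub>M\<^esub> r \<odot>\<^bsub>M\<^esub> y" "w \<in> W" "r \<in> carrier R"
        and b: "b = v \<oplus>\<^bsub>M\<^esub> s \<odot>\<^bsub>M\<^esub> y" "v \<in> W" "s \<in> carrier R" by (auto simp: X_def)
      then have "a \<oplus>\<^bsub>M\<^esub> b = (w \<oplus>\<^bsub>M\<^esub> v) \<oplus>\<^bsub>M\<^esub> (r \<oplus> s) \<odot>\<^bsub>M\<^esub> y"
        using y by (simp add: Wc M.smult_l_distr M.a_ac)
      then show "a \<oplus>\<^bsub>M\<^esub> b \<in> X" using XI a b WE by simp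
    next
      fix q a assume q: "q \<in> carrier R" and "a \<in> X"
      then obtain w r where a: "a = w \<oplus>\<^bsub>M\<^esub> r \<odot>\<^bsub>M\<^esub> y" "w \<in> W" "r \<in> carrier R" by (auto simp: X_def)
      then have "q \<odot>\<^bsub>M\<^esub> a = q \<odot>\<^bsub>M\<^esub> w \<oplus>\<^bsub>M\<^esub> (q \<otimes> r) \<odot>\<^bsub>M\<^esub> y"
        using y q by (simp add: Wc M.smult_r_distr M.smult_assoc1)
      then show "q \<odot>\<^bsub>M\<^esub> a \<in> X" using XI a WE q by simp
    qed
    moreover have "W \<subseteq> X"
    proof
      fix w assume "w \<in> W"
      then show "w \<in> X" using XI[of w \<zero>] y by (simp add: Wc)
    qed
    moreover have "y \<in> X" using XI[OF W0, of \<one>] y by simp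
    ultimately have "x \<in> X" using max False by blast
    then obtain w s where ws: "x = w \<oplus>\<^bsub>M\<^esub> s \<odot>\<^bsub>M\<^esub> y" "w \<in> W" "s \<in> carrier R" by (auto simp: X_def)
    have "s \<noteq> \<zero>" using ws W(3) y by (auto simp: Wc)
    then have su: "s \<in> Units R" using ws by (simp add: field_Units)
    have "inv s \<odot>\<^bsub>M\<^esub> x = inv s \<odot>\<^bsub>M\<^esub> w \<oplus>\<^bsub>M\<^esub> y"
      using su ws y by (simp add: ws(1) Wc M.smult_r_distr M.smult_assoc1[symmetric])
    then have "y = (\<ominus> (inv s)) \<odot>\<^bsub>M\<^esub> w \<oplus>\<^bsub>M\<^esub> inv s \<odot>\<^bsub>M\<^esub> x"
      using su ws(2) y by (simp add: Wc M.smult_l_minus M.a_assoc[symmetric] M.l_neg)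
    then show ?thesis
      using su WE(4) ws(2) by (intro bexI[of _ "inv s"] bexI[of _ "(\<ominus> (inv s)) \<odot>\<^bsub>M\<^esub> w"]) auto
  qed
  \<comment> \<open>The coordinate along \<open>x\<close> in the decomposition just found; it
    vanishes on \<open>W\<close> and therefore on \<open>U\<close>.\<close>
  define \<alpha> where "\<alpha> y = (THE r. r \<in> carrier R \<and> (\<exists>w\<in>W. y = w \<oplus>\<^bsub>M\<^esub> r \<odot>\<^bsub>M\<^esub> x))" for y
  have \<alpha>: "\<alpha> (w \<oplus>\<^bsub>M\<^esub> r \<odot>\<^bsub>M\<^esub> x) = r" if "w \<in> W" "r \<in> carrier R" for w r
    unfolding \<alpha>_def by (rule the_equality) (use that cancel in blast)+
  have "\<alpha> \<in> dual R M"
  proof (rule linear_mapsI)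
    fix y assume "y \<in> carrier M"
    then obtain r w where "r \<in> carrier R" "w \<in> W" "y = w \<oplus>\<^bsub>M\<^esub> r \<odot>\<^bsub>M\<^esub> x" using ex by blast
    then show "\<alpha> y \<in> carrier (scalar_algebra R)" using \<alpha> by simp
  next
    fix y z assume "y \<in> carrier M" "z \<in> carrier M"
    then obtain r w s v where rw: "r \<in> carrier R" "w \<in> W" "y = w \<oplus>\<^bsub>M\<^esub> r \<odot>\<^bsub>M\<^esub> x"
      and sv: "s \<in> carrier R" "v \<in> W" "z = v \<oplus>\<^bsub>M\<^esub> s \<odot>\<^bsub>M\<^esub> x" using ex by meson
    then have "y \<oplus>\<^bsub>M\<^esub> z = (w \<oplus>\<^bsub>M\<^esub> v) \<oplus>\<^bsub>M\<^esub> (r \<oplus> s) \<odot>\<^bsub>M\<^esub> x"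
      using assms(4) by (simp add: Wc M.smult_l_distr M.a_ac)
    then show "\<alpha> (y \<oplus>\<^bsub>M\<^esub> z) = \<alpha> y \<oplus>\<^bsub>scalar_algebra R\<^esub> \<alpha> z"
      using \<alpha> rw sv WE by simp
  next
    fix q y assume q: "q \<in> carrier R" and "y \<in> carrier M"
    then obtain r w where rw: "r \<in> carrier R" "w \<in> W" "y = w \<oplus>\<^bsub>M\<^esub> r \<odot>\<^bsub>M\<^esub> x" using ex by blast
    then have "q \<odot>\<^bsub>M\<^esub> y = q \<odot>\<^bsub>M\<^esub> w \<oplus>\<^bsub>M\<^esub> (q \<otimes> r) \<odot>\<^bsub>M\<^esub> x"
      using assms(4) q by (simp add: Wc M.smult_r_distr M.smult_assoc1)
    then show "\<alpha> (q \<odot>\<^bsub>M\<^esub> y) = q \<odot>\<^bsub>scalar_algebra R\<^esub> \<alpha> y"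
      using \<alpha> rw WE q by simp
  qed
  moreover have "\<alpha> x = \<one>" using \<alpha>[OF W0, of \<one>] assms(4) by simp
  moreover have "\<alpha> u = \<zero>" if "u \<in> U" for u
    using \<alpha>[of u \<zero>] that W(2) assms(4) by (auto simp: Wc)
  ultimately show thesis using that by blast
qed

text \<open>Apply \<open>dual_extension\<close> to the zero submodule.\<close>

lemma dual_separating:
  fixes R (structure)
  assumes "field R" "module R M"
  shows "separating R M (dual R M)"
proof -
  interpret field R by fact
  interpret M: module R M by fact
  have sub: "submodule {\<zero>\<^bsub>M\<^esub>} R M"
    by (rule M.submoduleI) auto
  show ?thesis
    unfolding separating_def
  proof (intro conjI ballI impI order_refl)
    fix x assume x: "x \<in> carrier M" "\<forall>\<alpha>\<in>dual R M. \<alpha> x = \<zero>"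
    show "x = \<zero>\<^bsub>M\<^esub>"
    proof (rule ccontr)
      assume "x \<noteq> \<zero>\<^bsub>M\<^esub>"
      then obtain \<alpha> where "\<alpha> \<in> dual R M" "\<alpha> x = \<one>"
        using dual_extension[OF assms sub x(1)] by auto
      then show False using x(2) by auto
    qed
  qed
qed


section \<open>Tensor products\<close>

lemma free_module_simps:
  "carrier (free_module R S) = {t. range t \<subseteq> carrier R \<and> finite {z. t z \<noteq> \<zero>\<^bsub>R\<^esub>} \<and> {z. t z \<noteq> \<zero>\<^bsub>R\<^esub>} \<subseteq> S}"
  "zero (free_module R S) = (\<lambda>z. \<zero>\<^bsub>R\<^esub>)"
  "add (free_module R S) = (\<lambda>s t z. s z \<oplus>\<^bsub>R\<^esub> t z)"
  "smult (free_module R S) = (\<lambda>r t z. r \<otimes>\<^bsub>R\<^esub> t z)"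
  by (auto simp: free_module_def)

lemma (in cring) free_module_module: "module R (free_module R S)"
proof -
  have closed: "t z \<in> carrier R" if "t \<in> carrier (free_module R S)" for t z
    using that by (auto simp: free_module_simps)
  have supp: "finite {z. t z \<noteq> \<zero>}" "{z. t z \<noteq> \<zero>} \<subseteq> S" if "t \<in> carrier (free_module R S)" for t
    using that by (auto simp: free_module_simps)
  \<comment> \<open>Any finite subset of \<open>S\<close> outside which \<open>t\<close> vanishes
    suffices, so the exact support of a sum or a multiple is never computed.\<close>
  have I: "t \<in> carrier (free_module R S)"
    if "\<And>z. t z \<in> carrier R" "finite T" "T \<subseteq> S" "\<And>z. z \<notin> T \<Longrightarrow> t z = \<zero>" for t T
  proof -
    have "{z. t z \<noteq> \<zero>} \<subseteq> T" using that(4) by auto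
    then show ?thesis using that by (auto simp: free_module_simps intro: finite_subset)
  qed
  show ?thesis
  proof (rule moduleI)
  show "abelian_group (free_module R S)"
  proof (rule abelian_groupI)
    fix x y assume *: "x \<in> carrier (free_module R S)" "y \<in> carrier (free_module R S)"
    show "x \<oplus>\<^bsub>free_module R S\<^esub> y \<in> carrier (free_module R S)"
      by (rule I[of _ "{z. x z \<noteq> \<zero>} \<union> {z. y z \<noteq> \<zero>}"])
        (use * closed supp in \<open>auto simp: free_module_simps(2-)\<close>)
  next
    fix x assume *: "x \<in> carrier (free_module R S)"
    have "(\<lambda>z. \<ominus> x z) \<in> carrier (free_module R S)"
      by (rule I[of _ "{z. x z \<noteq> \<zero>}"]) (use * closed supp in auto)
    then show "\<exists>y\<in>carrier (free_module R S). y \<oplus>\<^bsub>free_module R S\<^esub> x = \<zero>\<^bsub>free_module R S\<^esub>"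
      using closed[OF *] by (intro bexI) (auto simp: free_module_simps(2-) l_neg)
  qed (auto simp: free_module_simps(2-) closed a_ac intro: I[of _ "{}"])
next
  fix a x assume *: "a \<in> carrier R" "x \<in> carrier (free_module R S)"
  show "a \<odot>\<^bsub>free_module R S\<^esub> x \<in> carrier (free_module R S)"
    by (rule I[of _ "{z. x z \<noteq> \<zero>}"]) (use * closed supp in \<open>auto simp: free_module_simps(2-)\<close>)
next
  fix x assume "x \<in> carrier (free_module R S)"
  from closed[OF this] show "\<one> \<odot>\<^bsub>free_module R S\<^esub> x = x" by (simp add: free_module_simps(4))
qed (auto simp: free_module_simps l_distr r_distr m_assoc image_subset_iff intro: is_cring)
qed

lemma (in cring) free_gen_closed: "z \<in> S \<Longrightarrow> free_gen R z \<in> carrier (free_module R S)"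
  by (auto simp: free_module_simps free_gen_def if_distrib cong: if_cong)

text \<open>Removes one support point at a time. The added term is a multiple of a generator, which
  becomes a single pure tensor in the quotient.\<close>

lemma (in cring) free_module_induct [consumes 1, case_names zero add]:
  assumes t: "t \<in> carrier (free_module R S)" and zero: "P \<zero>\<^bsub>free_module R S\<^esub>"
    and add: "\<And>r z t. r \<in> carrier R \<Longrightarrow> z \<in> S \<Longrightarrow> t \<in> carrier (free_module R S) \<Longrightarrow> P t \<Longrightarrow>
      P (r \<odot>\<^bsub>free_module R S\<^esub> free_gen R z \<oplus>\<^bsub>free_module R S\<^esub> t)"
  shows "P t"
proof -
  have "P t" if "finite T" "T \<subseteq> S" "range t \<subseteq> carrier R" "\<And>z. z \<notin> T \<Longrightarrow> t z = \<zero>" for T t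
    using that
  proof (induction T arbitrary: t)
    case empty
    then have "t = \<zero>\<^bsub>free_module R S\<^esub>" by (auto simp: free_module_simps)
    then show ?case using zero by simp
  next
    case (insert w T)
    define t' where "t' = t(w := \<zero>)"
    have r: "t z \<in> carrier R" for z using insert.prems(2) by auto
    have P: "P t'"
      by (rule insert.IH) (use insert.prems r in \<open>auto simp: t'_def\<close>)
    have "{z. t' z \<noteq> \<zero>} \<subseteq> T" using insert.prems(3) by (auto simp: t'_def)
    moreover have "range t' \<subseteq> carrier R" using r by (auto simp: t'_def)
    ultimately have c: "t' \<in> carrier (free_module R S)"
      using insert.prems(1) insert.hyps by (auto simp: free_module_simps intro: finite_subset)
    have "t = t w \<odot>\<^bsub>free_module R S\<^esub> free_gen R w \<oplus>\<^bsub>free_module R S\<^esub> t'"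
      using r by (auto simp: free_module_simps free_gen_def t'_def)
    then show ?case using add[OF r _ c P, of w w] insert.prems(1) by auto
  qed
  from this[of "{z. t z \<noteq> \<zero>}"] t show ?thesis by (auto simp: free_module_simps)
qed

lemma free_module_lift:
  fixes R (structure)
  assumes "module R P" "\<And>z. z \<in> S \<Longrightarrow> b z \<in> carrier P"
  obtains h where "h \<in> linear_maps R (free_module R S) P" "\<And>z. z \<in> S \<Longrightarrow> h (free_gen R z) = b z"
proof -
  interpret P: module R P by fact
  define h where "h t = (\<Oplus>\<^bsub>P\<^esub>z\<in>{z. t z \<noteq> \<zero>}. t z \<odot>\<^bsub>P\<^esub> b z)" for t
  let ?F = "free_module R S"
  have F: "\<And>z. t z \<in> carrier R" "finite {z. t z \<noteq> \<zero>}" "{z. t z \<noteq> \<zero>} \<subseteq> S" if "t \<in> carrier ?F" for t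
    using that by (auto simp: free_module_simps)
  \<comment> \<open>The supports of two elements and of their sum differ; the three sums are
    compared over a common finite superset.\<close>
  have eq: "h t = (\<Oplus>\<^bsub>P\<^esub>z\<in>T. t z \<odot>\<^bsub>P\<^esub> b z)"
    if "t \<in> carrier ?F" "finite T" "{z. t z \<noteq> \<zero>} \<subseteq> T" "T \<subseteq> S" for t T
    unfolding h_def by (rule P.add.finprod_mono_neutral_cong_left)
      (use that F[OF that(1)] assms(2) in auto)
  have "h \<in> linear_maps R ?F P"
  proof (rule linear_mapsI)
    fix t assume "t \<in> carrier ?F"
    then show "h t \<in> carrier P"
      unfolding h_def using F[of t] assms(2) by (intro P.finsum_closed) auto
  next
    fix s t assume st: "s \<in> carrier ?F" "t \<in> carrier ?F"
    define T where "T = {z. s z \<noteq> \<zero>} \<union> {z. t z \<noteq> \<zero>}"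
    have T: "finite T" "T \<subseteq> S" using F(2,3)[OF st(1)] F(2,3)[OF st(2)] by (auto simp: T_def)
    have "h (s \<oplus>\<^bsub>?F\<^esub> t) = (\<Oplus>\<^bsub>P\<^esub>z\<in>T. (s \<oplus>\<^bsub>?F\<^esub> t) z \<odot>\<^bsub>P\<^esub> b z)"
    proof (rule eq)
      show "s \<oplus>\<^bsub>?F\<^esub> t \<in> carrier ?F"
        using module.axioms(2)[OF P.R.free_module_module] st
        by (meson abelian_groupE(1))
      show "{z. (s \<oplus>\<^bsub>?F\<^esub> t) z \<noteq> \<zero>} \<subseteq> T" by (auto simp: T_def free_module_simps)
    qed (use T in auto)
    also have "\<dots> = (\<Oplus>\<^bsub>P\<^esub>z\<in>T. s z \<odot>\<^bsub>P\<^esub> b z \<oplus>\<^bsub>P\<^esub> t z \<odot>\<^bsub>P\<^esub> b z)"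
      by (rule P.finsum_cong')
        (use F(1)[OF st(1)] F(1)[OF st(2)] T assms(2) in \<open>auto simp: free_module_simps P.smult_l_distr subset_iff\<close>)
    also have "\<dots> = h s \<oplus>\<^bsub>P\<^esub> h t"
      using F(1)[OF st(1)] F(1)[OF st(2)] T assms(2) st
      by (subst P.finsum_addf) (auto simp: eq[of _ T] subset_iff T_def)
    finally show "h (s \<oplus>\<^bsub>?F\<^esub> t) = h s \<oplus>\<^bsub>P\<^esub> h t" .
  next
    fix r t assume r: "r \<in> carrier R" and t: "t \<in> carrier ?F"
    have "h (r \<odot>\<^bsub>?F\<^esub> t) = (\<Oplus>\<^bsub>P\<^esub>z\<in>{z. t z \<noteq> \<zero>}. (r \<odot>\<^bsub>?F\<^esub> t) z \<odot>\<^bsub>P\<^esub> b z)"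
    proof (rule eq)
      show "r \<odot>\<^bsub>?F\<^esub> t \<in> carrier ?F"
        using module.smult_closed[OF P.R.free_module_module] r t by blast
      show "{z. (r \<odot>\<^bsub>?F\<^esub> t) z \<noteq> \<zero>} \<subseteq> {z. t z \<noteq> \<zero>}" using r by (auto simp: free_module_simps)
    qed (use F[OF t] in auto)
    also have "\<dots> = (\<Oplus>\<^bsub>P\<^esub>z\<in>{z. t z \<noteq> \<zero>}. r \<odot>\<^bsub>P\<^esub> (t z \<odot>\<^bsub>P\<^esub> b z))"
      by (rule P.finsum_cong')
        (use F[OF t] assms(2) r in \<open>auto simp: free_module_simps P.smult_assoc1 subset_iff\<close>)
    also have "\<dots> = r \<odot>\<^bsub>P\<^esub> h t"
      unfolding h_def using F[OF t] assms(2) r by (intro P.finsum_smult_ldistr[symmetric]) auto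
    finally show "h (r \<odot>\<^bsub>?F\<^esub> t) = r \<odot>\<^bsub>P\<^esub> h t" .
  qed
  moreover have "h (free_gen R z) = b z" if z: "z \<in> S" for z
  proof -
    have "h (free_gen R z) = (\<Oplus>\<^bsub>P\<^esub>w\<in>{z}. free_gen R z w \<odot>\<^bsub>P\<^esub> b w)"
      by (rule eq) (use z P.R.free_gen_closed in \<open>auto simp: free_gen_def\<close>)
    then show ?thesis using assms(2)[OF z] by (simp add: free_gen_def)
  qed
  ultimately show thesis using that by blast
qed

section \<open>Bilinear maps and the tensor product as a quotient\<close>

definition bilinear ::
  "('k, 'r) ring_scheme \<Rightarrow> ('k, 'a, 'm) module_scheme \<Rightarrow> ('k, 'b, 'n) module_scheme
    \<Rightarrow> ('k, 'c, 'p) module_scheme \<Rightarrow> ('a \<Rightarrow> 'b \<Rightarrow> 'c) \<Rightarrow> bool"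
  where "bilinear R M N P b \<longleftrightarrow> (\<forall>x\<in>carrier M. b x \<in> linear_maps R N P) \<and>
    (\<forall>y\<in>carrier N. (\<lambda>x. b x y) \<in> linear_maps R M P)"

text \<open>Lists of pairs stand for tensors throughout. They carry no coefficients because a scalar
  is absorbed into the first factor, as in \<open>tensor_obtain_list\<close>.\<close>

definition tens ::
  "('k, 'r) ring_scheme \<Rightarrow> ('k, 'a, 'm) module_scheme \<Rightarrow> ('k, 'b, 'n) module_scheme
    \<Rightarrow> ('a \<times> 'b) list \<Rightarrow> ('a \<times> 'b \<Rightarrow> 'k) set"
  where "tens R M N ds = lsum (tensor_space R M N) (\<lambda>(x, y). pure_tensor R M N x y) ds"

locale tensor = M: module R M + N: module R N
  for R (structure) and M :: "('k, 'a, 'm) module_scheme" and N :: "('k, 'b, 'n) module_scheme"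
begin

abbreviation F where "F \<equiv> tensor_free R M N"
abbreviation T where "T \<equiv> tensor_space R M N"
abbreviation I where "I \<equiv> tensor_null R M N"
abbreviation pt where "pt \<equiv> pure_tensor R M N"

sublocale F: module R F by (rule M.R.free_module_module)

lemma gen_closed: "x \<in> carrier M \<Longrightarrow> y \<in> carrier N \<Longrightarrow> free_gen R (x, y) \<in> carrier F"
  by (rule M.R.free_gen_closed) auto

lemma relations_closed: "bilinear_relations R M N \<subseteq> carrier F"
  by (auto simp: bilinear_relations_def Let_def gen_closed)

lemma null_submodule: "submodule I R F"
proof (rule F.submoduleI)
  have S: "submodule (carrier F) R F" by (rule F.carrier_is_submodule)
  show "I \<subseteq> carrier F" using S relations_closed by (auto simp: tensor_null_def)
  have "\<zero>\<^bsub>F\<^esub> \<in> U" if "submodule U R F" for U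
    using subgroup.one_closed[OF submodule.axioms(1)[OF that]] by simp
  then show "\<zero>\<^bsub>F\<^esub> \<in> I" by (auto simp: tensor_null_def)
qed (auto simp: tensor_null_def F.submoduleE)

lemma relations_null: "bilinear_relations R M N \<subseteq> I"
  by (auto simp: tensor_null_def)

lemma null_least: "submodule U R F \<Longrightarrow> bilinear_relations R M N \<subseteq> U \<Longrightarrow> I \<subseteq> U"
  by (auto simp: tensor_null_def)

sublocale I: abelian_subgroup I F
  by (rule abelian_subgroupI3)
    (use submodule.axioms(1)[OF null_submodule] F.abelian_group_axioms in \<open>auto intro: additive_subgroupI\<close>)

lemma coset_eq_iff:
  assumes "s \<in> carrier F" "t \<in> carrier F"
  shows "I +>\<^bsub>F\<^esub> s = I +>\<^bsub>F\<^esub> t \<longleftrightarrow> s \<ominus>\<^bsub>F\<^esub> t \<in> I"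
proof -
  have "s \<in> I +>\<^bsub>F\<^esub> t \<longleftrightarrow> s \<ominus>\<^bsub>F\<^esub> t \<in> I"
    using I.a_rcos_module[OF assms(2,1)] by (simp add: a_minus_def)
  moreover have "I +>\<^bsub>F\<^esub> s = I +>\<^bsub>F\<^esub> t \<longleftrightarrow> s \<in> I +>\<^bsub>F\<^esub> t"
  proof
    assume "I +>\<^bsub>F\<^esub> s = I +>\<^bsub>F\<^esub> t"
    then show "s \<in> I +>\<^bsub>F\<^esub> t" using I.a_rcos_self[OF assms(1)] by simp
  next
    assume "s \<in> I +>\<^bsub>F\<^esub> t"
    then show "I +>\<^bsub>F\<^esub> s = I +>\<^bsub>F\<^esub> t" using I.a_repr_independence' assms(2) by simp
  qed
  ultimately show ?thesis by simp
qed

lemma tensor_simps: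
  "carrier T = a_rcosets\<^bsub>F\<^esub> I" "zero T = I" "add T = set_add F"
  "smult T = (\<lambda>r X. \<Union>t\<in>X. I +>\<^bsub>F\<^esub> (r \<odot>\<^bsub>F\<^esub> t))"
  by (auto simp: tensor_space_def Let_def)

lemma coset_closed: "t \<in> carrier F \<Longrightarrow> I +>\<^bsub>F\<^esub> t \<in> carrier T"
  unfolding tensor_simps using I.a_subset by (rule F.a_rcosetsI)

lemma tensor_cases:
  assumes "X \<in> carrier T"
  obtains t where "t \<in> carrier F" "X = I +>\<^bsub>F\<^esub> t"
  using assms by (auto simp: tensor_simps A_RCOSETS_def' a_r_coset_def')

lemma coset_add: "s \<in> carrier F \<Longrightarrow> t \<in> carrier F \<Longrightarrow>
    (I +>\<^bsub>F\<^esub> s) \<oplus>\<^bsub>T\<^esub> (I +>\<^bsub>F\<^esub> t) = I +>\<^bsub>F\<^esub> (s \<oplus>\<^bsub>F\<^esub> t)"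
  by (simp add: tensor_simps I.a_rcos_sum)

text \<open>The union that defines scalar multiplication of cosets collapses to one coset, because
  the null submodule is closed under scalars and so all members of a coset give the same
  result.\<close>

lemma coset_smult:
  assumes "r \<in> carrier R" "t \<in> carrier F"
  shows "r \<odot>\<^bsub>T\<^esub> (I +>\<^bsub>F\<^esub> t) = I +>\<^bsub>F\<^esub> (r \<odot>\<^bsub>F\<^esub> t)"
proof -
  have "I +>\<^bsub>F\<^esub> (r \<odot>\<^bsub>F\<^esub> s) = I +>\<^bsub>F\<^esub> (r \<odot>\<^bsub>F\<^esub> t)" if s: "s \<in> I +>\<^bsub>F\<^esub> t" for s
  proof -
    have sc: "s \<in> carrier F" using s I.a_elemrcos_carrier assms(2) by blast
    have "s \<ominus>\<^bsub>F\<^esub> t \<in> I" using I.a_rcos_module_imp[OF assms(2) s] by (simp add: a_minus_def)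
    then have "r \<odot>\<^bsub>F\<^esub> (s \<ominus>\<^bsub>F\<^esub> t) \<in> I" using F.submoduleE(4)[OF null_submodule] assms(1) by blast
    then show ?thesis
      using assms sc by (simp add: coset_eq_iff a_minus_def F.smult_r_distr F.smult_r_minus)
  qed
  moreover have "I +>\<^bsub>F\<^esub> t \<noteq> {}" using I.a_rcos_self[OF assms(2)] by blast
  ultimately show ?thesis unfolding tensor_simps by (intro SUP_eq_const)
qed

lemma null_coset: "I +>\<^bsub>F\<^esub> \<zero>\<^bsub>F\<^esub> = I"
  using I.a_subset by (simp add: F.a_coset_add_zero)

lemma tensor_module: "module R T"
proof (rule moduleI)
  show "cring R" by (rule M.R.is_cring)
  show "abelian_group T"
  proof (rule abelian_groupI)
    fix X assume "X \<in> carrier T"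
    then obtain t where t: "t \<in> carrier F" "X = I +>\<^bsub>F\<^esub> t" by (rule tensor_cases)
    show "\<exists>Y\<in>carrier T. Y \<oplus>\<^bsub>T\<^esub> X = \<zero>\<^bsub>T\<^esub>"
      using t null_coset by (intro bexI[of _ "I +>\<^bsub>F\<^esub> (\<ominus>\<^bsub>F\<^esub> t)"])
        (auto simp: coset_add coset_closed F.l_neg tensor_simps(2))
    show "\<zero>\<^bsub>T\<^esub> \<oplus>\<^bsub>T\<^esub> X = X"
      unfolding tensor_simps(2) using t coset_add[OF F.zero_closed, of t] null_coset by simp
  next
    show "\<zero>\<^bsub>T\<^esub> \<in> carrier T"
      unfolding tensor_simps(2) using coset_closed[OF F.zero_closed] null_coset by simp
  qed (auto elim!: tensor_cases simp: coset_add coset_closed F.a_ac)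
qed (auto elim!: tensor_cases simp: coset_add coset_closed coset_smult
    F.smult_l_distr F.smult_r_distr F.smult_assoc1)

sublocale T: module R T by (rule tensor_module)

lemma pure_closed [simp, intro]: "x \<in> carrier M \<Longrightarrow> y \<in> carrier N \<Longrightarrow> pt x y \<in> carrier T"
  by (simp add: pure_tensor_def coset_closed gen_closed)

lemma relations:
  assumes "x \<in> carrier M" "y \<in> carrier N"
  shows "x' \<in> carrier M \<Longrightarrow>
      free_gen R (x \<oplus>\<^bsub>M\<^esub> x', y) \<ominus>\<^bsub>F\<^esub> (free_gen R (x, y) \<oplus>\<^bsub>F\<^esub> free_gen R (x', y)) \<in> I"
    and "y' \<in> carrier N \<Longrightarrow>
      free_gen R (x, y \<oplus>\<^bsub>N\<^esub> y') \<ominus>\<^bsub>F\<^esub> (free_gen R (x, y) \<oplus>\<^bsub>F\<^esub> free_gen R (x, y')) \<in> I"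
    and "r \<in> carrier R \<Longrightarrow> free_gen R (r \<odot>\<^bsub>M\<^esub> x, y) \<ominus>\<^bsub>F\<^esub> r \<odot>\<^bsub>F\<^esub> free_gen R (x, y) \<in> I"
    and "r \<in> carrier R \<Longrightarrow> free_gen R (x, r \<odot>\<^bsub>N\<^esub> y) \<ominus>\<^bsub>F\<^esub> r \<odot>\<^bsub>F\<^esub> free_gen R (x, y) \<in> I"
proof -
  note * = subsetD[OF relations_null, unfolded bilinear_relations_def Let_def]
  show "x' \<in> carrier M \<Longrightarrow>
      free_gen R (x \<oplus>\<^bsub>M\<^esub> x', y) \<ominus>\<^bsub>F\<^esub> (free_gen R (x, y) \<oplus>\<^bsub>F\<^esub> free_gen R (x', y)) \<in> I"
    by (rule *, rule UnI1, rule UnI1, rule UnI1, rule CollectI, intro exI conjI, rule refl) (use assms in simp_all)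
  show "y' \<in> carrier N \<Longrightarrow>
      free_gen R (x, y \<oplus>\<^bsub>N\<^esub> y') \<ominus>\<^bsub>F\<^esub> (free_gen R (x, y) \<oplus>\<^bsub>F\<^esub> free_gen R (x, y')) \<in> I"
    by (rule *, rule UnI1, rule UnI1, rule UnI2, rule CollectI, intro exI conjI, rule refl) (use assms in simp_all)
  show "r \<in> carrier R \<Longrightarrow> free_gen R (r \<odot>\<^bsub>M\<^esub> x, y) \<ominus>\<^bsub>F\<^esub> r \<odot>\<^bsub>F\<^esub> free_gen R (x, y) \<in> I"
    by (rule *, rule UnI1, rule UnI2, rule CollectI, intro exI conjI, rule refl) (use assms in simp_all)
  show "r \<in> carrier R \<Longrightarrow> free_gen R (x, r \<odot>\<^bsub>N\<^esub> y) \<ominus>\<^bsub>F\<^esub> r \<odot>\<^bsub>F\<^esub> free_gen R (x, y) \<in> I"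
    by (rule *, rule UnI2, rule CollectI, intro exI conjI, rule refl) (use assms in simp_all)
qed

lemma pure_bilinear: "bilinear R M N T pt"
  unfolding bilinear_def
proof (intro conjI ballI; rule linear_mapsI)
qed (simp_all add: pure_tensor_def coset_add coset_smult coset_closed gen_closed coset_eq_iff relations)

lemma tens_closed [simp, intro]: "set ds \<subseteq> carrier M \<times> carrier N \<Longrightarrow> tens R M N ds \<in> carrier T"
  unfolding tens_def by (rule T.lsum_closed) (auto simp: subset_iff)

lemma tensor_obtain_list:
  assumes "X \<in> carrier T"
  obtains ds where "set ds \<subseteq> carrier M \<times> carrier N" "X = tens R M N ds"
proof -
  obtain t where t: "t \<in> carrier F" "X = I +>\<^bsub>F\<^esub> t" using assms by (rule tensor_cases)
  have "\<exists>ds. set ds \<subseteq> carrier M \<times> carrier N \<and> I +>\<^bsub>F\<^esub> t = tens R M N ds"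
    using t(1)
  proof (induction rule: M.R.free_module_induct)
    case zero
    show ?case by (rule exI[of _ "[]"]) (simp add: tens_def tensor_simps(2) null_coset)
  next
    case (add r z t)
    obtain x y where z: "z = (x, y)" "x \<in> carrier M" "y \<in> carrier N" using add(2) by auto
    obtain ds where ds: "set ds \<subseteq> carrier M \<times> carrier N" "I +>\<^bsub>F\<^esub> t = tens R M N ds" using add by auto
    have "I +>\<^bsub>F\<^esub> (r \<odot>\<^bsub>F\<^esub> free_gen R z \<oplus>\<^bsub>F\<^esub> t) = r \<odot>\<^bsub>T\<^esub> pt x y \<oplus>\<^bsub>T\<^esub> tens R M N ds"
      using add ds z by (simp add: coset_add[symmetric] coset_smult pure_tensor_def gen_closed)
    also have "r \<odot>\<^bsub>T\<^esub> pt x y = pt (r \<odot>\<^bsub>M\<^esub> x) y"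
      using linear_smult[of "\<lambda>x. pt x y" R M T r x] pure_bilinear z add(1) by (simp add: bilinear_def)
    also have "\<dots> \<oplus>\<^bsub>T\<^esub> tens R M N ds = tens R M N ((r \<odot>\<^bsub>M\<^esub> x, y) # ds)" by (simp add: tens_def)
    finally show ?case using ds z add(1) by (intro exI[of _ "(r \<odot>\<^bsub>M\<^esub> x, y) # ds"]) auto
  qed
  then show thesis using that t by auto
qed

end

lemma (in abelian_group) lsum_delta:
  "distinct xs \<Longrightarrow> i \<in> set xs \<Longrightarrow> a \<in> carrier G \<Longrightarrow> lsum G (\<lambda>j. if j = i then a else \<zero>) xs = a"
proof (induction xs)
  case (Cons x xs)
  have "lsum G (\<lambda>j. if j = x then a else \<zero>) xs = \<zero>" if "x \<notin> set xs"
    using that by (intro lsum_zero) auto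
  then show ?case using Cons by (cases "x = i") auto
qed auto

lemma bilinearD:
  assumes "bilinear R M N P b"
  shows "x \<in> carrier M \<Longrightarrow> b x \<in> linear_maps R N P"
    and "y \<in> carrier N \<Longrightarrow> (\<lambda>x. b x y) \<in> linear_maps R M P"
    and "x \<in> carrier M \<Longrightarrow> y \<in> carrier N \<Longrightarrow> b x y \<in> carrier P"
  using assms by (auto simp: bilinear_def dest: linear_closed)

lemma bilinearI:
  assumes "\<And>x. x \<in> carrier M \<Longrightarrow> (\<lambda>y. b x y) \<in> linear_maps R N P"
    and "\<And>y. y \<in> carrier N \<Longrightarrow> (\<lambda>x. b x y) \<in> linear_maps R M P"
  shows "bilinear R M N P b"
  using assms by (auto simp: bilinear_def)

lemma bilinear_comp_left:
  "bilinear R M N Q b \<Longrightarrow> f \<in> linear_maps R L M \<Longrightarrow> y \<in> carrier N \<Longrightarrow> (\<lambda>x. b (f x) y) \<in> linear_maps R L Q"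
  by (rule linear_comp[OF bilinearD(2)])

lemma bilinear_comp_right:
  "bilinear R M N Q b \<Longrightarrow> f \<in> linear_maps R L N \<Longrightarrow> y \<in> carrier M \<Longrightarrow> (\<lambda>x. b y (f x)) \<in> linear_maps R L Q"
  by (rule linear_comp[OF bilinearD(1)])

lemma (in cring) bilinear_mult_dual:
  assumes "\<alpha> \<in> dual R M" "\<beta> \<in> dual R N"
  shows "bilinear R M N (scalar_algebra R) (\<lambda>x y. \<alpha> x \<otimes> \<beta> y)"
proof (rule bilinearI; rule linear_mapsI)
qed (use linear_closed[OF assms(1)] linear_closed[OF assms(2)] in
  \<open>auto simp: linear_add[OF assms(1)] linear_add[OF assms(2)] linear_smult[OF assms(1)]
    linear_smult[OF assms(2)] r_distr l_distr m_ac\<close>)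

section \<open>The universal property of the tensor product\<close>

context tensor
begin

lemma linear_eqI:
  assumes P: "module R P" and h: "h \<in> linear_maps R T P" "h' \<in> linear_maps R T P"
    and eq: "\<And>x y. x \<in> carrier M \<Longrightarrow> y \<in> carrier N \<Longrightarrow> h (pt x y) = h' (pt x y)"
    and X: "X \<in> carrier T"
  shows "h X = h' X"
proof -
  obtain ds where ds: "set ds \<subseteq> carrier M \<times> carrier N" "X = tens R M N ds"
    using X by (rule tensor_obtain_list)
  have "h X = lsum P (\<lambda>p. h (case p of (x, y) \<Rightarrow> pt x y)) ds"
    unfolding ds(2) tens_def by (rule linear_lsum[OF T.module_axioms P h(1)]) (use ds in auto)
  also have "\<dots> = lsum P (\<lambda>p. h' (case p of (x, y) \<Rightarrow> pt x y)) ds"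
    by (rule lsum_cong) (use ds eq in auto)
  also have "\<dots> = h' X"
    unfolding ds(2) tens_def by (rule linear_lsum[OF T.module_axioms P h(2), symmetric]) (use ds in auto)
  finally show ?thesis .
qed

lemma lift_exists:
  assumes P: "module R P" and b: "bilinear R M N P b"
  shows "\<exists>h\<in>linear_maps R T P. \<forall>x\<in>carrier M. \<forall>y\<in>carrier N. h (pt x y) = b x y"
proof -
  interpret P: module R P by fact
  note bl = bilinearD[OF b]
  obtain h where h: "h \<in> linear_maps R F P"
    and hb: "\<And>z. z \<in> carrier M \<times> carrier N \<Longrightarrow> h (free_gen R z) = (case z of (x, y) \<Rightarrow> b x y)"
    by (rule free_module_lift[OF P, where S = "carrier M \<times> carrier N" and b = "\<lambda>(x, y). b x y"])
      (use bl in auto)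
  have hb': "h (free_gen R (x, y)) = b x y" if "x \<in> carrier M" "y \<in> carrier N" for x y
    using hb[of "(x, y)"] that by simp
  have hdiff: "h (s \<ominus>\<^bsub>F\<^esub> t) = h s \<ominus>\<^bsub>P\<^esub> h t" if "s \<in> carrier F" "t \<in> carrier F" for s t
    using that linear_add[OF h, of s "\<ominus>\<^bsub>F\<^esub> t"] linear_minus[OF F.module_axioms P h, of t]
    by (simp add: a_minus_def)
  \<comment> \<open>The kernel of \<open>h\<close> is a submodule containing the bilinearity
    relations, so it contains the smallest such submodule.\<close>
  have "I \<subseteq> {t \<in> carrier F. h t = \<zero>\<^bsub>P\<^esub>}"
  proof (rule null_least)
    show "submodule {t \<in> carrier F. h t = \<zero>\<^bsub>P\<^esub>} R F"
      by (rule F.submoduleI)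
        (auto simp: linear_zero[OF F.module_axioms P h] linear_minus[OF F.module_axioms P h]
          linear_add[OF h] linear_smult[OF h])
    have "h t = \<zero>\<^bsub>P\<^esub>" if t: "t \<in> bilinear_relations R M N" for t
    proof -
      have 1: "h (free_gen R (x \<oplus>\<^bsub>M\<^esub> x', y) \<ominus>\<^bsub>F\<^esub> (free_gen R (x, y) \<oplus>\<^bsub>F\<^esub> free_gen R (x', y))) = \<zero>\<^bsub>P\<^esub>"
        if "x \<in> carrier M" "x' \<in> carrier M" "y \<in> carrier N" for x x' y
        using that linear_add[OF bl(2)[OF that(3)] that(1,2)]
        by (simp add: hdiff gen_closed linear_add[OF h] hb' bl(3) P.r_neg[folded a_minus_def])
      have 2: "h (free_gen R (x, y \<oplus>\<^bsub>N\<^esub> y') \<ominus>\<^bsub>F\<^esub> (free_gen R (x, y) \<oplus>\<^bsub>F\<^esub> free_gen R (x, y'))) = \<zero>\<^bsub>P\<^esub>"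
        if "x \<in> carrier M" "y \<in> carrier N" "y' \<in> carrier N" for x y y'
        using that linear_add[OF bl(1)[OF that(1)] that(2,3)]
        by (simp add: hdiff gen_closed linear_add[OF h] hb' bl(3) P.r_neg[folded a_minus_def])
      have 3: "h (free_gen R (r \<odot>\<^bsub>M\<^esub> x, y) \<ominus>\<^bsub>F\<^esub> r \<odot>\<^bsub>F\<^esub> free_gen R (x, y)) = \<zero>\<^bsub>P\<^esub>"
        if "r \<in> carrier R" "x \<in> carrier M" "y \<in> carrier N" for r x y
        using that linear_smult[OF bl(2)[OF that(3)] that(1,2)]
        by (simp add: hdiff gen_closed linear_smult[OF h] hb' bl(3) P.r_neg[folded a_minus_def])
      have 4: "h (free_gen R (x, r \<odot>\<^bsub>N\<^esub> y) \<ominus>\<^bsub>F\<^esub> r \<odot>\<^bsub>F\<^esub> free_gen R (x, y)) = \<zero>\<^bsub>P\<^esub>"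
        if "r \<in> carrier R" "x \<in> carrier M" "y \<in> carrier N" for r x y
        using that linear_smult[OF bl(1)[OF that(2)] that(1,3)]
        by (simp add: hdiff gen_closed linear_smult[OF h] hb' bl(3) P.r_neg[folded a_minus_def])
      show ?thesis
        using t unfolding bilinear_relations_def Let_def
        by (elim UnE CollectE exE conjE) (simp_all only: 1 2 3 4)
    qed
    then show "bilinear_relations R M N \<subseteq> {t \<in> carrier F. h t = \<zero>\<^bsub>P\<^esub>}"
      using relations_closed by blast
  qed
  then have hI: "h s = h t" if "I +>\<^bsub>F\<^esub> s = I +>\<^bsub>F\<^esub> t" "s \<in> carrier F" "t \<in> carrier F" for s t
    using that hdiff[of s t] coset_eq_iff[of s t] linear_closed[OF h]
    by (auto dest!: subsetD intro: P.minus_eq_zeroD)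
  \<comment> \<open>Any representative of the coset will do: by \<open>hI\<close> the value of
    \<open>h\<close> depends on the coset only.\<close>
  define H where "H X = h (SOME t. t \<in> carrier F \<and> X = I +>\<^bsub>F\<^esub> t)" for X
  have H: "H (I +>\<^bsub>F\<^esub> t) = h t" if "t \<in> carrier F" for t
  proof -
    have "\<exists>s. s \<in> carrier F \<and> I +>\<^bsub>F\<^esub> t = I +>\<^bsub>F\<^esub> s"
      by (rule exI[of _ t]) (simp add: that)
    note * = someI_ex[OF this]
    show ?thesis
      unfolding H_def by (rule hI[symmetric]) (use * that in simp_all)
  qed
  have "H \<in> linear_maps R T P"
  proof (rule linear_mapsI)
    fix X Y assume "X \<in> carrier T" "Y \<in> carrier T"
    then obtain s t where "s \<in> carrier F" "X = I +>\<^bsub>F\<^esub> s" "t \<in> carrier F" "Y = I +>\<^bsub>F\<^esub> t"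
      by (metis tensor_cases)
    then show "H (X \<oplus>\<^bsub>T\<^esub> Y) = H X \<oplus>\<^bsub>P\<^esub> H Y" by (simp add: coset_add H linear_add[OF h])
  next
    fix X assume "X \<in> carrier T"
    then obtain t where t: "t \<in> carrier F" "X = I +>\<^bsub>F\<^esub> t" by (rule tensor_cases)
    then show "H X \<in> carrier P" by (simp add: H linear_closed[OF h])
    show "H (r \<odot>\<^bsub>T\<^esub> X) = r \<odot>\<^bsub>P\<^esub> H X" if "r \<in> carrier R" for r
      using that t by (simp add: coset_smult H linear_smult[OF h])
  qed
  moreover have "H (pt x y) = b x y" if "x \<in> carrier M" "y \<in> carrier N" for x y
    using that by (simp add: pure_tensor_def H gen_closed hb')
  ultimately show ?thesis by blast
qed

text \<open>Existence and uniqueness together discharge the definite description in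
  \<open>tensor_lift\<close>. Uniqueness holds as an equality of functions because pure tensors span
  and both candidates are extensional.\<close>

lemma
  assumes P: "module R P" and b: "bilinear R M N P b"
  shows lift_linear: "tensor_lift R M N P b \<in> linear_maps R T P"
    and lift_pure: "\<lbrakk>x \<in> carrier M; y \<in> carrier N\<rbrakk> \<Longrightarrow> tensor_lift R M N P b (pt x y) = b x y"
proof -
  let ?Q = "\<lambda>h. h \<in> linear_maps R T P \<and> h \<in> extensional (carrier T) \<and>
    (\<forall>x\<in>carrier M. \<forall>y\<in>carrier N. h (pt x y) = b x y)"
  obtain h where h: "h \<in> linear_maps R T P" "\<forall>x\<in>carrier M. \<forall>y\<in>carrier N. h (pt x y) = b x y"
    using lift_exists[OF assms] by blast
  have "?Q (restrict h (carrier T))"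
  proof (intro conjI ballI)
    show "restrict h (carrier T) \<in> linear_maps R T P"
      by (rule linear_cong[OF T.module_axioms h(1)]) auto
  qed (use h in auto)
  moreover have "f = g" if "?Q f" "?Q g" for f g
  proof (rule extensionalityI)
    show "f \<in> extensional (carrier T)" "g \<in> extensional (carrier T)" using that by auto
    show "f X = g X" if "X \<in> carrier T" for X
      by (rule linear_eqI[OF P _ _ _ that]) (use \<open>?Q f\<close> \<open>?Q g\<close> in auto)
  qed
  ultimately have "\<exists>!h. ?Q h" by blast
  from theI'[OF this] have *: "?Q (tensor_lift R M N P b)" unfolding tensor_lift_def .
  show "tensor_lift R M N P b \<in> linear_maps R T P" using * by blast
  show "\<lbrakk>x \<in> carrier M; y \<in> carrier N\<rbrakk> \<Longrightarrow> tensor_lift R M N P b (pt x y) = b x y" using * by blast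
qed

lemma lift_tens:
  assumes P: "module R P" and b: "bilinear R M N P b" and ds: "set ds \<subseteq> carrier M \<times> carrier N"
  shows "tensor_lift R M N P b (tens R M N ds) = lsum P (\<lambda>(x, y). b x y) ds"
proof -
  have "tensor_lift R M N P b (tens R M N ds) =
    lsum P (\<lambda>p. tensor_lift R M N P b (case p of (x, y) \<Rightarrow> pt x y)) ds"
    unfolding tens_def by (rule linear_lsum[OF T.module_axioms P lift_linear[OF P b]]) (use ds in auto)
  also have "\<dots> = lsum P (\<lambda>(x, y). b x y) ds"
    by (rule lsum_cong) (use ds lift_pure[OF P b] in auto)
  finally show ?thesis .
qed

lemma tens_eqD:
  assumes "module R P" "bilinear R M N P b" "set ds \<subseteq> carrier M \<times> carrier N"
    "set es \<subseteq> carrier M \<times> carrier N" "tens R M N ds = tens R M N es"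
  shows "lsum P (\<lambda>(x, y). b x y) ds = lsum P (\<lambda>(x, y). b x y) es"
  using lift_tens[OF assms(1,2,3)] lift_tens[OF assms(1,2,4)] assms(5) by simp

section \<open>Detecting tensors with functionals\<close>

lemma pure_zero: "x \<in> carrier M \<Longrightarrow> pt x \<zero>\<^bsub>N\<^esub> = \<zero>\<^bsub>T\<^esub>"
  by (rule linear_zero[OF N.module_axioms T.module_axioms bilinearD(1)[OF pure_bilinear]])

text \<open>Induction on the number of summands: a first factor \<open>x\<close> in the span of the others is eliminated,
  and otherwise a functional that is one at \<open>x\<close> and vanishes on the others shows that the second
  factor is zero.\<close>

lemma tens_zeroI:
  assumes "field R" "set ds \<subseteq> carrier M \<times> carrier N"
    and "\<And>\<alpha>. \<alpha> \<in> dual R M \<Longrightarrow> lsum N (\<lambda>(x, y). \<alpha> x \<odot>\<^bsub>N\<^esub> y) ds = \<zero>\<^bsub>N\<^esub>"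
  shows "tens R M N ds = \<zero>\<^bsub>T\<^esub>"
  using assms(2,3)
proof (induction "length ds" arbitrary: ds)
  case 0
  then show ?case by (simp add: tens_def)
next
  case (Suc n)
  then obtain x y es where ds: "ds = (x, y) # es" by (cases ds) auto
  have n: "n = length es" using Suc ds by simp
  have xy: "x \<in> carrier M" "y \<in> carrier N" and es: "set es \<subseteq> carrier M \<times> carrier N"
    using Suc.prems ds by auto
  define u v where "u i = fst (es ! i)" and "v i = snd (es ! i)" for i
  let ?L = "[0..<n]"
  have uv: "u i \<in> carrier M" "v i \<in> carrier N" if "i < n" for i
  proof -
    have "es ! i \<in> carrier M \<times> carrier N" using es nth_mem[of i es] that n by blast
    then show "u i \<in> carrier M" "v i \<in> carrier N" by (auto simp: u_def v_def mem_Times_iff)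
  qed
  have es_eq: "es = map (\<lambda>i. (u i, v i)) ?L" unfolding u_def v_def n by (simp add: map_nth)
  have sum: "\<alpha> x \<odot>\<^bsub>N\<^esub> y \<oplus>\<^bsub>N\<^esub> lsum N (\<lambda>i. \<alpha> (u i) \<odot>\<^bsub>N\<^esub> v i) ?L = \<zero>\<^bsub>N\<^esub>" if "\<alpha> \<in> dual R M" for \<alpha>
    using Suc.prems(2)[OF that] by (simp add: ds es_eq lsum_map)
  define U where "U = {lsum M (\<lambda>i. c i \<odot>\<^bsub>M\<^esub> u i) ?L | c. \<forall>i. c i \<in> carrier R}"
  have UI: "lsum M (\<lambda>i. c i \<odot>\<^bsub>M\<^esub> u i) ?L \<in> U" if "\<And>i. c i \<in> carrier R" for c
    using that by (auto simp: U_def)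
  have sub: "submodule U R M"
  proof (rule M.submoduleI)
    show "U \<subseteq> carrier M" using uv by (auto simp: U_def)
    have "lsum M (\<lambda>i. \<zero>\<^bsub>R\<^esub> \<odot>\<^bsub>M\<^esub> u i) ?L = \<zero>\<^bsub>M\<^esub>" using uv by (intro M.lsum_zero) auto
    then show "\<zero>\<^bsub>M\<^esub> \<in> U" using UI[of "\<lambda>_. \<zero>\<^bsub>R\<^esub>"] by simp
  next
    fix a b assume "a \<in> U" "b \<in> U"
    then obtain c d where cd: "a = lsum M (\<lambda>i. c i \<odot>\<^bsub>M\<^esub> u i) ?L" "b = lsum M (\<lambda>i. d i \<odot>\<^bsub>M\<^esub> u i) ?L"
      "\<And>i. c i \<in> carrier R" "\<And>i. d i \<in> carrier R" by (auto simp: U_def)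
    have "a \<oplus>\<^bsub>M\<^esub> b = lsum M (\<lambda>i. (c i \<oplus>\<^bsub>R\<^esub> d i) \<odot>\<^bsub>M\<^esub> u i) ?L"
      unfolding cd(1,2) using uv cd(3,4)
      by (subst M.lsum_add[symmetric]) (auto simp: M.smult_l_distr intro!: lsum_cong)
    then show "a \<oplus>\<^bsub>M\<^esub> b \<in> U" using UI[of "\<lambda>i. c i \<oplus>\<^bsub>R\<^esub> d i"] cd by simp
  next
    fix r a assume r: "r \<in> carrier R" and "a \<in> U"
    then obtain c where c: "a = lsum M (\<lambda>i. c i \<odot>\<^bsub>M\<^esub> u i) ?L" "\<And>i. c i \<in> carrier R" by (auto simp: U_def)
    have "r \<odot>\<^bsub>M\<^esub> a = lsum M (\<lambda>i. (r \<otimes>\<^bsub>R\<^esub> c i) \<odot>\<^bsub>M\<^esub> u i) ?L"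
      unfolding c(1) using uv c(2) r
      by (subst M.lsum_smult) (auto simp: M.smult_assoc1 intro!: lsum_cong)
    then show "r \<odot>\<^bsub>M\<^esub> a \<in> U" using UI[of "\<lambda>i. r \<otimes>\<^bsub>R\<^esub> c i"] c r by simp
  next
    fix a assume "a \<in> U"
    then obtain c where c: "a = lsum M (\<lambda>i. c i \<odot>\<^bsub>M\<^esub> u i) ?L" "\<And>i. c i \<in> carrier R" by (auto simp: U_def)
    then have "a \<in> carrier M" using uv by auto
    then have "\<ominus>\<^bsub>M\<^esub> a = (\<ominus>\<^bsub>R\<^esub> \<one>\<^bsub>R\<^esub>) \<odot>\<^bsub>M\<^esub> a" by (simp add: M.smult_l_minus)
    also have "\<dots> = lsum M (\<lambda>i. (\<ominus>\<^bsub>R\<^esub> \<one>\<^bsub>R\<^esub> \<otimes>\<^bsub>R\<^esub> c i) \<odot>\<^bsub>M\<^esub> u i) ?L"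
      unfolding c(1) using uv c(2)
      by (subst M.lsum_smult) (auto simp: M.smult_assoc1 intro!: lsum_cong)
    finally show "\<ominus>\<^bsub>M\<^esub> a \<in> U" using UI[of "\<lambda>i. \<ominus>\<^bsub>R\<^esub> \<one>\<^bsub>R\<^esub> \<otimes>\<^bsub>R\<^esub> c i"] c by simp
  qed
  show ?case
  proof (cases "x \<in> U")
    case True
    then obtain c where c: "x = lsum M (\<lambda>i. c i \<odot>\<^bsub>M\<^esub> u i) ?L" "\<And>i. c i \<in> carrier R" by (auto simp: U_def)
    \<comment> \<open>Substituting the combination with coefficients \<open>c\<close> for
      \<open>x\<close> spreads the first summand over the others, so the same tensor is written with
      one pair fewer.\<close>
    define es' where "es' = map (\<lambda>i. (u i, v i \<oplus>\<^bsub>N\<^esub> c i \<odot>\<^bsub>N\<^esub> y)) ?L"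
    have "tens R M N es' = \<zero>\<^bsub>T\<^esub>"
    proof (rule Suc.hyps(1))
      show "n = length es'" by (simp add: es'_def)
      show "set es' \<subseteq> carrier M \<times> carrier N" using uv c xy by (auto simp: es'_def)
      fix \<alpha> assume \<alpha>: "\<alpha> \<in> dual R M"
      have \<alpha>u: "\<alpha> (u i) \<in> carrier R" if "i < n" for i using linear_closed[OF \<alpha>] uv that by simp
      have "\<alpha> x = lsum R (\<lambda>i. \<alpha> (c i \<odot>\<^bsub>M\<^esub> u i)) ?L"
        unfolding c(1) using linear_lsum[OF M.module_axioms M.R.scalar_algebra_module \<alpha>, of ?L] uv c by simp
      also have "\<dots> = lsum R (\<lambda>i. c i \<otimes>\<^bsub>R\<^esub> \<alpha> (u i)) ?L"
        by (rule lsum_cong) (use uv c linear_smult[OF \<alpha>] in auto)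
      finally have "\<alpha> x \<odot>\<^bsub>N\<^esub> y = lsum N (\<lambda>i. (c i \<otimes>\<^bsub>R\<^esub> \<alpha> (u i)) \<odot>\<^bsub>N\<^esub> y) ?L"
        using \<alpha>u c(2) xy(2) N.lsum_smult_left[of ?L "\<lambda>i. c i \<otimes>\<^bsub>R\<^esub> \<alpha> (u i)" y] by auto
      also have "\<dots> = lsum N (\<lambda>i. \<alpha> (u i) \<odot>\<^bsub>N\<^esub> (c i \<odot>\<^bsub>N\<^esub> y)) ?L"
        by (rule lsum_cong) (use \<alpha>u c xy in \<open>auto simp: N.smult_assoc1[symmetric] M.R.m_comm\<close>)
      finally have 1: "\<alpha> x \<odot>\<^bsub>N\<^esub> y = \<dots>" .
      have "lsum N (\<lambda>(x, y). \<alpha> x \<odot>\<^bsub>N\<^esub> y) es' =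
        lsum N (\<lambda>i. \<alpha> (u i) \<odot>\<^bsub>N\<^esub> (c i \<odot>\<^bsub>N\<^esub> y) \<oplus>\<^bsub>N\<^esub> \<alpha> (u i) \<odot>\<^bsub>N\<^esub> v i) ?L"
        unfolding es'_def lsum_map using \<alpha>u uv c xy
        by (intro lsum_cong) (auto simp: N.smult_r_distr N.a_comm)
      also have "\<dots> = \<alpha> x \<odot>\<^bsub>N\<^esub> y \<oplus>\<^bsub>N\<^esub> lsum N (\<lambda>i. \<alpha> (u i) \<odot>\<^bsub>N\<^esub> v i) ?L"
        unfolding 1 using \<alpha>u uv c xy by (intro N.lsum_add) auto
      finally show "lsum N (\<lambda>(x, y). \<alpha> x \<odot>\<^bsub>N\<^esub> y) es' = \<zero>\<^bsub>N\<^esub>" using sum[OF \<alpha>] by simp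
    qed
    moreover have "tens R M N ds = tens R M N es'"
    proof -
      have l: "(\<lambda>x. pt x y) \<in> linear_maps R M T" using bilinearD(2)[OF pure_bilinear] xy by blast
      have "pt x y = lsum T (\<lambda>i. pt (c i \<odot>\<^bsub>M\<^esub> u i) y) ?L"
        unfolding c(1) using linear_lsum[OF M.module_axioms T.module_axioms l, of ?L] uv c by simp
      also have "\<dots> = lsum T (\<lambda>i. pt (u i) (c i \<odot>\<^bsub>N\<^esub> y)) ?L"
        by (rule lsum_cong) (use uv c xy linear_smult[OF l] linear_smult[OF bilinearD(1)[OF pure_bilinear]] in auto)
      finally have "tens R M N ds =
        lsum T (\<lambda>i. pt (u i) (c i \<odot>\<^bsub>N\<^esub> y)) ?L \<oplus>\<^bsub>T\<^esub> lsum T (\<lambda>i. pt (u i) (v i)) ?L"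
        unfolding ds es_eq tens_def by (simp add: lsum_map)
      also have "\<dots> = lsum T (\<lambda>i. pt (u i) (c i \<odot>\<^bsub>N\<^esub> y) \<oplus>\<^bsub>T\<^esub> pt (u i) (v i)) ?L"
        using uv c xy by (intro T.lsum_add[symmetric]) auto
      also have "\<dots> = tens R M N es'"
        unfolding tens_def es'_def lsum_map using uv c xy
        by (intro lsum_cong) (auto simp: linear_add[OF bilinearD(1)[OF pure_bilinear]] T.a_comm)
      finally show ?thesis .
    qed
    ultimately show ?thesis by simp
  next
    case False
    obtain \<alpha> where \<alpha>: "\<alpha> \<in> dual R M" "\<alpha> x = \<one>\<^bsub>R\<^esub>" "\<And>w. w \<in> U \<Longrightarrow> \<alpha> w = \<zero>\<^bsub>R\<^esub>"
      using dual_extension[OF \<open>field R\<close> M.module_axioms sub xy(1) False] by blast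
    have "u i \<in> U" if "i < n" for i
    proof -
      have "lsum M (\<lambda>j. (if j = i then \<one>\<^bsub>R\<^esub> else \<zero>\<^bsub>R\<^esub>) \<odot>\<^bsub>M\<^esub> u j) ?L =
        lsum M (\<lambda>j. if j = i then u i else \<zero>\<^bsub>M\<^esub>) ?L"
        by (rule lsum_cong) (use uv in auto)
      also have "\<dots> = u i" by (rule M.lsum_delta) (use uv that in auto)
      finally show ?thesis using UI[of "\<lambda>j. if j = i then \<one>\<^bsub>R\<^esub> else \<zero>\<^bsub>R\<^esub>"] by simp
    qed
    then have "lsum N (\<lambda>i. \<alpha> (u i) \<odot>\<^bsub>N\<^esub> v i) ?L = \<zero>\<^bsub>N\<^esub>"
      using uv \<alpha>(3) by (intro N.lsum_zero) auto
    then have y0: "y = \<zero>\<^bsub>N\<^esub>" using sum[OF \<alpha>(1)] \<alpha>(2) xy by simp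
    have "tens R M N es = \<zero>\<^bsub>T\<^esub>"
    proof (rule Suc.hyps(1)[OF n es])
      fix \<beta> assume \<beta>: "\<beta> \<in> dual R M"
      have "lsum N (\<lambda>(x, y). \<beta> x \<odot>\<^bsub>N\<^esub> y) es \<in> carrier N"
        using es linear_closed[OF \<beta>] by (intro N.lsum_closed) auto
      then show "lsum N (\<lambda>(x, y). \<beta> x \<odot>\<^bsub>N\<^esub> y) es = \<zero>\<^bsub>N\<^esub>"
        using Suc.prems(2)[OF \<beta>] linear_closed[OF \<beta>] xy unfolding ds y0 by simp
    qed
    then show ?thesis unfolding ds y0 tens_def using pure_zero xy by simp
  qed
qed

text \<open>Contracting the second factors with a member of \<open>B\<close> gives a vector of
  \<open>M\<close> that all of \<open>A\<close> kills, hence zero. So every functional on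
  \<open>M\<close>, not only those in \<open>A\<close>, contracts the tensor to a vector of
  \<open>N\<close> that all of \<open>B\<close> kills, and \<open>tens_zeroI\<close>
  applies.\<close>

lemma tensor_separating:
  assumes "field R" and A: "separating R M A" and B: "separating R N B"
  shows "separating R T
    ((\<lambda>(\<alpha>, \<beta>). tensor_lift R M N (scalar_algebra R) (\<lambda>x y. \<alpha> x \<otimes>\<^bsub>R\<^esub> \<beta> y)) ` (A \<times> B))"
  unfolding separating_def
proof (intro conjI ballI impI)
  note sm = M.R.scalar_algebra_module
  have Al: "\<alpha> \<in> dual R M" if "\<alpha> \<in> A" for \<alpha> using A that by (auto simp: separating_def)
  have Bl: "\<beta> \<in> dual R N" if "\<beta> \<in> B" for \<beta> using B that by (auto simp: separating_def)
  have bil: "bilinear R M N (scalar_algebra R) (\<lambda>x y. \<alpha> x \<otimes>\<^bsub>R\<^esub> \<beta> y)" if "\<alpha> \<in> dual R M" "\<beta> \<in> dual R N" for \<alpha> \<beta>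
    using M.R.bilinear_mult_dual[OF that] .
  show "(\<lambda>(\<alpha>, \<beta>). tensor_lift R M N (scalar_algebra R) (\<lambda>x y. \<alpha> x \<otimes>\<^bsub>R\<^esub> \<beta> y)) ` (A \<times> B) \<subseteq> dual R T"
    using lift_linear[OF sm bil] Al Bl by auto
  fix X assume X: "X \<in> carrier T"
    "\<forall>h\<in>(\<lambda>(\<alpha>, \<beta>). tensor_lift R M N (scalar_algebra R) (\<lambda>x y. \<alpha> x \<otimes>\<^bsub>R\<^esub> \<beta> y)) ` (A \<times> B). h X = \<zero>\<^bsub>R\<^esub>"
  obtain ds where ds: "set ds \<subseteq> carrier M \<times> carrier N" "X = tens R M N ds"
    using X(1) by (rule tensor_obtain_list)
  have dsD: "fst p \<in> carrier M" "snd p \<in> carrier N" if "p \<in> set ds" for p using ds that by auto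
  have zero: "lsum R (\<lambda>p. \<alpha> (fst p) \<otimes>\<^bsub>R\<^esub> \<beta> (snd p)) ds = \<zero>\<^bsub>R\<^esub>" if "\<alpha> \<in> A" "\<beta> \<in> B" for \<alpha> \<beta>
    using X(2) that lift_tens[OF sm bil[OF Al Bl] ds(1), OF that] ds(2) by (auto simp: case_prod_unfold)
  have zero2: "lsum M (\<lambda>p. \<beta> (snd p) \<odot>\<^bsub>M\<^esub> fst p) ds = \<zero>\<^bsub>M\<^esub>" if \<beta>: "\<beta> \<in> B" for \<beta>
  proof -
    have c: "\<beta> (snd p) \<odot>\<^bsub>M\<^esub> fst p \<in> carrier M" if "p \<in> set ds" for p
      using dsD[OF that] linear_closed[OF Bl[OF \<beta>]] by simp
    have "\<alpha> (lsum M (\<lambda>p. \<beta> (snd p) \<odot>\<^bsub>M\<^esub> fst p) ds) = \<zero>\<^bsub>R\<^esub>" if \<alpha>: "\<alpha> \<in> A" for \<alpha>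
    proof -
      have "\<alpha> (lsum M (\<lambda>p. \<beta> (snd p) \<odot>\<^bsub>M\<^esub> fst p) ds) = lsum R (\<lambda>p. \<alpha> (\<beta> (snd p) \<odot>\<^bsub>M\<^esub> fst p)) ds"
        using linear_lsum[OF M.module_axioms sm Al[OF \<alpha>], of ds] c by simp
      also have "\<dots> = lsum R (\<lambda>p. \<alpha> (fst p) \<otimes>\<^bsub>R\<^esub> \<beta> (snd p)) ds"
        by (rule lsum_cong) (use dsD linear_closed[OF Bl[OF \<beta>]] linear_closed[OF Al[OF \<alpha>]]
          linear_smult[OF Al[OF \<alpha>]] in \<open>auto simp: M.R.m_comm\<close>)
      finally show ?thesis using zero[OF \<alpha> \<beta>] by simp
    qed
    then show ?thesis using A c by (auto simp: separating_def)
  qed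
  have "tens R M N ds = \<zero>\<^bsub>T\<^esub>"
  proof (rule tens_zeroI[OF \<open>field R\<close> ds(1)])
    fix \<alpha> assume \<alpha>: "\<alpha> \<in> dual R M"
    have c: "\<alpha> (fst p) \<odot>\<^bsub>N\<^esub> snd p \<in> carrier N" if "p \<in> set ds" for p
      using dsD[OF that] linear_closed[OF \<alpha>] by simp
    have "\<beta> (lsum N (\<lambda>p. \<alpha> (fst p) \<odot>\<^bsub>N\<^esub> snd p) ds) = \<zero>\<^bsub>R\<^esub>" if \<beta>: "\<beta> \<in> B" for \<beta>
    proof -
      have d: "\<beta> (snd p) \<odot>\<^bsub>M\<^esub> fst p \<in> carrier M" if "p \<in> set ds" for p
        using dsD[OF that] linear_closed[OF Bl[OF \<beta>]] by simp
      have "\<beta> (lsum N (\<lambda>p. \<alpha> (fst p) \<odot>\<^bsub>N\<^esub> snd p) ds) = lsum R (\<lambda>p. \<beta> (\<alpha> (fst p) \<odot>\<^bsub>N\<^esub> snd p)) ds"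
        using linear_lsum[OF N.module_axioms sm Bl[OF \<beta>], of ds] c by simp
      also have "\<dots> = lsum R (\<lambda>p. \<alpha> (\<beta> (snd p) \<odot>\<^bsub>M\<^esub> fst p)) ds"
        by (rule lsum_cong) (use dsD linear_closed[OF Bl[OF \<beta>]] linear_closed[OF \<alpha>]
          linear_smult[OF Bl[OF \<beta>]] linear_smult[OF \<alpha>] in \<open>auto simp: M.R.m_comm\<close>)
      also have "\<dots> = \<alpha> (lsum M (\<lambda>p. \<beta> (snd p) \<odot>\<^bsub>M\<^esub> fst p) ds)"
        using linear_lsum[OF M.module_axioms sm \<alpha>, of ds] d by simp
      finally show ?thesis using zero2[OF \<beta>] linear_zero[OF M.module_axioms sm \<alpha>] by simp
    qed
    then show "lsum N (\<lambda>(x, y). \<alpha> x \<odot>\<^bsub>N\<^esub> y) ds = \<zero>\<^bsub>N\<^esub>"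
      using B c by (auto simp: separating_def case_prod_unfold)
  qed
  then show "X = \<zero>\<^bsub>T\<^esub>" using ds by simp
qed

lemma tens_eqI:
  assumes "field R" "separating R M A" "separating R N B"
    and "set ds \<subseteq> carrier M \<times> carrier N" "set es \<subseteq> carrier M \<times> carrier N"
    and eq: "\<And>\<alpha> \<beta>. \<alpha> \<in> A \<Longrightarrow> \<beta> \<in> B \<Longrightarrow>
      lsum R (\<lambda>(x, y). \<alpha> x \<otimes>\<^bsub>R\<^esub> \<beta> y) ds = lsum R (\<lambda>(x, y). \<alpha> x \<otimes>\<^bsub>R\<^esub> \<beta> y) es"
  shows "tens R M N ds = tens R M N es"
proof (rule separatingD[OF T.module_axioms tensor_separating[OF assms(1-3)]])
  fix h assume "h \<in> (\<lambda>(\<alpha>, \<beta>). tensor_lift R M N (scalar_algebra R) (\<lambda>x y. \<alpha> x \<otimes>\<^bsub>R\<^esub> \<beta> y)) ` (A \<times> B)"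
  then obtain \<alpha> \<beta> where h: "\<alpha> \<in> A" "\<beta> \<in> B"
    "h = tensor_lift R M N (scalar_algebra R) (\<lambda>x y. \<alpha> x \<otimes>\<^bsub>R\<^esub> \<beta> y)" by auto
  have "\<alpha> \<in> dual R M" "\<beta> \<in> dual R N" using h assms by (auto simp: separating_def)
  note b = M.R.bilinear_mult_dual[OF this]
  show "h (tens R M N ds) = h (tens R M N es)"
    unfolding h(3) using eq[OF h(1,2)]
      lift_tens[OF M.R.scalar_algebra_module b assms(4)] lift_tens[OF M.R.scalar_algebra_module b assms(5)]
    by simp
qed (use assms in auto)

end

section \<open>Trilinear maps and rebracketing of triple tensors\<close>

definition trilinear ::
  "('k, 'r) ring_scheme \<Rightarrow> ('k, 'a, 'l) module_scheme \<Rightarrow> ('k, 'b, 'm) module_scheme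
    \<Rightarrow> ('k, 'c, 'n) module_scheme \<Rightarrow> ('k, 'd, 'p) module_scheme \<Rightarrow> ('a \<Rightarrow> 'b \<Rightarrow> 'c \<Rightarrow> 'd) \<Rightarrow> bool"
  where "trilinear R L M N Q t \<longleftrightarrow>
    (\<forall>y\<in>carrier M. \<forall>z\<in>carrier N. (\<lambda>x. t x y z) \<in> linear_maps R L Q) \<and>
    (\<forall>x\<in>carrier L. \<forall>z\<in>carrier N. (\<lambda>y. t x y z) \<in> linear_maps R M Q) \<and>
    (\<forall>x\<in>carrier L. \<forall>y\<in>carrier M. (\<lambda>z. t x y z) \<in> linear_maps R N Q)"

lemma trilinearI:
  assumes "\<And>y z. y \<in> carrier M \<Longrightarrow> z \<in> carrier N \<Longrightarrow> (\<lambda>x. t x y z) \<in> linear_maps R L Q"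
    and "\<And>x z. x \<in> carrier L \<Longrightarrow> z \<in> carrier N \<Longrightarrow> (\<lambda>y. t x y z) \<in> linear_maps R M Q"
    and "\<And>x y. x \<in> carrier L \<Longrightarrow> y \<in> carrier M \<Longrightarrow> (\<lambda>z. t x y z) \<in> linear_maps R N Q"
  shows "trilinear R L M N Q t"
  using assms by (auto simp: trilinear_def)

lemma trilinear_bilinear:
  assumes "trilinear R L M N Q t"
  shows "x \<in> carrier L \<Longrightarrow> bilinear R M N Q (t x)"
    and "z \<in> carrier N \<Longrightarrow> bilinear R L M Q (\<lambda>x y. t x y z)"
  using assms by (auto simp: trilinear_def bilinear_def)

lemma trilinear_closed:
  "trilinear R L M N Q t \<Longrightarrow> x \<in> carrier L \<Longrightarrow> y \<in> carrier M \<Longrightarrow> z \<in> carrier N \<Longrightarrow> t x y z \<in> carrier Q"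
  by (auto simp: trilinear_def dest: linear_closed)

text \<open>Linearity in the outer variable is seen on a fixed list of pairs, where the lift is a
  finite sum of maps that are linear in that variable.\<close>

lemma lift_trilinear_right:
  assumes "module R L" "tensor R M N" "module R Q" "trilinear R L M N Q t"
  shows "bilinear R L (tensor_space R M N) Q (\<lambda>x. tensor_lift R M N Q (t x))"
proof (rule bilinearI)
  interpret T: tensor R M N by fact
  note b = trilinear_bilinear(1)[OF assms(4)]
  show "tensor_lift R M N Q (t x) \<in> linear_maps R (tensor_space R M N) Q" if "x \<in> carrier L" for x
    using T.lift_linear[OF assms(3) b[OF that]] .
  fix X assume "X \<in> carrier (tensor_space R M N)"
  then obtain ds where ds: "set ds \<subseteq> carrier M \<times> carrier N" "X = tens R M N ds" by (rule T.tensor_obtain_list)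
  have "(\<lambda>x. lsum Q (\<lambda>p. t x (fst p) (snd p)) ds) \<in> linear_maps R L Q"
    by (rule linear_sum[OF assms(3)]) (use ds assms(4) in \<open>auto simp: trilinear_def\<close>)
  then show "(\<lambda>x. tensor_lift R M N Q (t x) X) \<in> linear_maps R L Q"
    by (rule linear_cong[OF assms(1)]) (simp add: ds(2) T.lift_tens[OF assms(3) b ds(1)] case_prod_unfold)
qed

lemma lift_trilinear_left:
  assumes "tensor R L M" "module R N" "module R Q" "trilinear R L M N Q t"
  shows "bilinear R (tensor_space R L M) N Q (\<lambda>u z. tensor_lift R L M Q (\<lambda>x y. t x y z) u)"
proof (rule bilinearI)
  interpret T: tensor R L M by fact
  note b = trilinear_bilinear(2)[OF assms(4)]
  show "tensor_lift R L M Q (\<lambda>x y. t x y z) \<in> linear_maps R (tensor_space R L M) Q" if "z \<in> carrier N" for z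
    using T.lift_linear[OF assms(3) b[OF that]] .
  fix X assume "X \<in> carrier (tensor_space R L M)"
  then obtain ds where ds: "set ds \<subseteq> carrier L \<times> carrier M" "X = tens R L M ds" by (rule T.tensor_obtain_list)
  have "(\<lambda>z. lsum Q (\<lambda>p. t (fst p) (snd p) z) ds) \<in> linear_maps R N Q"
    by (rule linear_sum[OF assms(3)]) (use ds assms(4) in \<open>auto simp: trilinear_def\<close>)
  then show "(\<lambda>z. tensor_lift R L M Q (\<lambda>x y. t x y z) X) \<in> linear_maps R N Q"
    by (rule linear_cong[OF assms(2)]) (simp add: ds(2) T.lift_tens[OF assms(3) b ds(1)] case_prod_unfold)
qed

lemma tensorI: "module R M \<Longrightarrow> module R N \<Longrightarrow> tensor R M N"
  by (simp add: tensor_def)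

lemma tensor_map_tens:
  assumes "module R M" "module R N" "module R M'" "module R N'"
    and "f \<in> linear_maps R M M'" "g \<in> linear_maps R N N'" "set ds \<subseteq> carrier M \<times> carrier N"
  shows "tensor_map R M N M' N' f g (tens R M N ds) = tens R M' N' (map (map_prod f g) ds)"
proof -
  interpret T: tensor R M N using assms by (simp add: tensorI)
  interpret T': tensor R M' N' using assms by (simp add: tensorI)
  have b: "bilinear R M N T'.T (\<lambda>x y. T'.pt (f x) (g y))"
    using linear_comp[OF bilinearD(1)[OF T'.pure_bilinear] assms(6)]
      linear_comp[OF bilinearD(2)[OF T'.pure_bilinear] assms(5)]
      linear_closed[OF assms(5)] linear_closed[OF assms(6)] by (intro bilinearI) auto
  show ?thesis
    unfolding tensor_map_def using T.lift_tens[OF T'.tensor_module b assms(7)]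
    by (simp add: tens_def lsum_map case_prod_unfold)
qed

lemma pure_trilinear:
  assumes "module R L" "module R M" "module R N"
  shows "trilinear R L M N (tensor_space R L (tensor_space R M N))
    (\<lambda>x y z. pure_tensor R L (tensor_space R M N) x (pure_tensor R M N y z))"
proof -
  interpret T: tensor R M N using assms by (simp add: tensorI)
  interpret P: tensor R L T.T using assms by (simp add: tensorI T.tensor_module)
  show ?thesis
    unfolding trilinear_def
  proof (intro conjI ballI)
    fix y z assume "y \<in> carrier M" "z \<in> carrier N"
    then show "(\<lambda>x. P.pt x (T.pt y z)) \<in> linear_maps R L P.T"
      by (intro bilinearD(2)[OF P.pure_bilinear]) auto
  next
    fix x z assume "x \<in> carrier L" "z \<in> carrier N"
    then show "(\<lambda>y. P.pt x (T.pt y z)) \<in> linear_maps R M P.T"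
      by (intro linear_comp[OF bilinearD(1)[OF P.pure_bilinear]] bilinearD(2)[OF T.pure_bilinear])
  next
    fix x y assume "x \<in> carrier L" "y \<in> carrier M"
    then show "(\<lambda>z. P.pt x (T.pt y z)) \<in> linear_maps R N P.T"
      by (intro linear_comp[OF bilinearD(1)[OF P.pure_bilinear]] bilinearD(1)[OF T.pure_bilinear])
  qed
qed

lemma tensor_assoc_pure:
  assumes "module R L" "module R M" "module R N"
  shows "tensor_assoc R L M N \<in> linear_maps R (tensor_space R (tensor_space R L M) N) (tensor_space R L (tensor_space R M N))"
    and "\<lbrakk>x \<in> carrier L; y \<in> carrier M; z \<in> carrier N\<rbrakk> \<Longrightarrow>
      tensor_assoc R L M N (pure_tensor R (tensor_space R L M) N (pure_tensor R L M x y) z) =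
      pure_tensor R L (tensor_space R M N) x (pure_tensor R M N y z)"
proof -
  interpret LM: tensor R L M using assms by (simp add: tensorI)
  interpret MN: tensor R M N using assms by (simp add: tensorI)
  interpret LM_N: tensor R LM.T N using assms by (simp add: tensorI LM.tensor_module)
  interpret L_MN: tensor R L MN.T using assms by (simp add: tensorI MN.tensor_module)
  note t = pure_trilinear[OF assms]
  note b = lift_trilinear_left[OF LM.tensor_axioms assms(3) L_MN.tensor_module t]
  show "tensor_assoc R L M N \<in> linear_maps R LM_N.T L_MN.T"
    unfolding tensor_assoc_def Let_def by (rule LM_N.lift_linear[OF L_MN.tensor_module b])
  show "\<lbrakk>x \<in> carrier L; y \<in> carrier M; z \<in> carrier N\<rbrakk> \<Longrightarrow>
      tensor_assoc R L M N (LM_N.pt (LM.pt x y) z) = L_MN.pt x (MN.pt y z)"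
    unfolding tensor_assoc_def Let_def
    by (subst LM_N.lift_pure[OF L_MN.tensor_module b])
      (auto simp: LM.lift_pure[OF L_MN.tensor_module trilinear_bilinear(2)[OF t]])
qed


section \<open>Sweedler sums\<close>

text \<open>\<open>d\<close> picks Sweedler representatives for all elements at once. It is an
  arbitrary choice; linearity is a property of \<open>comult\<close>, not of
  \<open>d\<close>.\<close>

definition is_comult ::
  "('k, 'r) ring_scheme \<Rightarrow> ('k, 'a, 'm) hopf_scheme \<Rightarrow> ('a \<Rightarrow> ('a \<times> 'a) list) \<Rightarrow> bool"
  where "is_comult R C d \<longleftrightarrow>
    (\<forall>c\<in>carrier C. set (d c) \<subseteq> carrier C \<times> carrier C \<and> comult C c = tens R C C (d c))"

text \<open>The two bracketings expanded into sums of pure tensors. The setting is a module with a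
  linear comultiplication, because the formulas serve both to exploit coassociativity in a coalgebra
  and to establish it for a new one.\<close>

lemma
  assumes C: "module R C" and lin: "comult C \<in> linear_maps R C (tensor_space R C C)"
    and d: "is_comult R C d" and c: "c \<in> carrier C"
  shows coassoc_left: "tensor_assoc R C C C (tensor_map R C C (tensor_space R C C) C (comult C) id (comult C c)) =
      lsum (tensor_space R C (tensor_space R C C)) (\<lambda>(y, z). lsum (tensor_space R C (tensor_space R C C))
        (\<lambda>(a, b). pure_tensor R C (tensor_space R C C) a (pure_tensor R C C b z)) (d y)) (d c)"
    and coassoc_right: "tensor_map R C C C (tensor_space R C C) id (comult C) (comult C c) =
      lsum (tensor_space R C (tensor_space R C C)) (\<lambda>(y, z). lsum (tensor_space R C (tensor_space R C C))
        (\<lambda>(a, b). pure_tensor R C (tensor_space R C C) y (pure_tensor R C C a b)) (d z)) (d c)"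
proof -
  interpret T: tensor R C C using C by (simp add: tensorI)
  interpret TC: tensor R T.T C using C by (simp add: tensorI T.tensor_module)
  interpret CT: tensor R C T.T using C by (simp add: tensorI T.tensor_module)
  have dc: "set (d x) \<subseteq> carrier C \<times> carrier C" "comult C x = tens R C C (d x)" if "x \<in> carrier C" for x
    using d that by (auto simp: is_comult_def)
  have dD: "fst p \<in> carrier C" "snd p \<in> carrier C" if "p \<in> set (d x)" "x \<in> carrier C" for p x
    using dc(1)[OF that(2)] that(1) by auto
  note al = tensor_assoc_pure(1)[OF C C C] and ap = tensor_assoc_pure(2)[OF C C C]
  have "tensor_assoc R C C C (tensor_map R C C T.T C (comult C) id (comult C c)) =
    tensor_assoc R C C C (tens R T.T C (map (map_prod (comult C) id) (d c)))"
    using tensor_map_tens[OF C C T.tensor_module C lin linear_id' dc(1)[OF c]] dc(2)[OF c] by simp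
  also have "\<dots> = lsum CT.T (\<lambda>p. tensor_assoc R C C C (TC.pt (comult C (fst p)) (snd p))) (d c)"
    unfolding tens_def
    by (subst linear_lsum[OF TC.tensor_module CT.tensor_module al])
      (use dD[OF _ c] linear_closed[OF lin] in \<open>auto simp: lsum_map case_prod_unfold\<close>)
  also have "\<dots> = lsum CT.T (\<lambda>p. lsum CT.T (\<lambda>q. CT.pt (fst q) (T.pt (snd q) (snd p))) (d (fst p))) (d c)"
  proof (rule lsum_cong[OF refl])
    fix p assume p: "p \<in> set (d c)"
    note p1 = dD(1)[OF p c] and p2 = dD(2)[OF p c]
    have l: "(\<lambda>u. tensor_assoc R C C C (TC.pt u (snd p))) \<in> linear_maps R T.T CT.T"
      using linear_comp[OF al bilinearD(2)[OF TC.pure_bilinear p2]] .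
    have "tensor_assoc R C C C (TC.pt (comult C (fst p)) (snd p)) =
      lsum CT.T (\<lambda>q. tensor_assoc R C C C (TC.pt (T.pt (fst q) (snd q)) (snd p))) (d (fst p))"
      unfolding dc(2)[OF p1] tens_def
      by (subst linear_lsum[OF T.tensor_module CT.tensor_module l])
        (use dD[OF _ p1] in \<open>auto simp: case_prod_unfold\<close>)
    also have "\<dots> = lsum CT.T (\<lambda>q. CT.pt (fst q) (T.pt (snd q) (snd p))) (d (fst p))"
      by (rule lsum_cong[OF refl]) (use dD[OF _ p1] p2 ap in auto)
    finally show "tensor_assoc R C C C (TC.pt (comult C (fst p)) (snd p)) = \<dots>" .
  qed
  finally show "tensor_assoc R C C C (tensor_map R C C T.T C (comult C) id (comult C c)) =
      lsum CT.T (\<lambda>(y, z). lsum CT.T (\<lambda>(a, b). CT.pt a (T.pt b z)) (d y)) (d c)"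
    by (simp add: case_prod_unfold)
  have "tensor_map R C C C T.T id (comult C) (comult C c) = tens R C T.T (map (map_prod id (comult C)) (d c))"
    using tensor_map_tens[OF C C C T.tensor_module linear_id' lin dc(1)[OF c]] dc(2)[OF c] by simp
  also have "\<dots> = lsum CT.T (\<lambda>p. CT.pt (fst p) (comult C (snd p))) (d c)"
    by (simp add: tens_def lsum_map case_prod_unfold)
  also have "\<dots> = lsum CT.T (\<lambda>p. lsum CT.T (\<lambda>q. CT.pt (fst p) (T.pt (fst q) (snd q))) (d (snd p))) (d c)"
  proof (rule lsum_cong[OF refl])
    fix p assume p: "p \<in> set (d c)"
    note p1 = dD(1)[OF p c] and p2 = dD(2)[OF p c]
    show "CT.pt (fst p) (comult C (snd p)) = lsum CT.T (\<lambda>q. CT.pt (fst p) (T.pt (fst q) (snd q))) (d (snd p))"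
      unfolding dc(2)[OF p2] tens_def
      by (subst linear_lsum[OF T.tensor_module CT.tensor_module bilinearD(1)[OF CT.pure_bilinear p1]])
        (use dD[OF _ p2] in \<open>auto simp: case_prod_unfold\<close>)
  qed
  finally show "tensor_map R C C C T.T id (comult C) (comult C c) =
      lsum CT.T (\<lambda>(y, z). lsum CT.T (\<lambda>(a, b). CT.pt y (T.pt a b)) (d z)) (d c)"
    by (simp add: case_prod_unfold)
qed

section \<open>Calculating in a coalgebra with chosen representatives\<close>

definition decomp :: "('k, 'r) ring_scheme \<Rightarrow> ('k, 'a, 'm) hopf_scheme \<Rightarrow> 'a \<Rightarrow> ('a \<times> 'a) list" where
  "decomp R C c = (SOME ds. set ds \<subseteq> carrier C \<times> carrier C \<and> comult C c = tens R C C ds)"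

text \<open>\<open>sw R C Q b c\<close> is the sum of the \<open>b c\<^sub>1 c\<^sub>2\<close> in Sweedler notation.\<close>

definition sw :: "('k, 'r) ring_scheme \<Rightarrow> ('k, 'a, 'm) hopf_scheme \<Rightarrow> ('b, 'n) ring_scheme \<Rightarrow>
    ('a \<Rightarrow> 'a \<Rightarrow> 'b) \<Rightarrow> 'a \<Rightarrow> 'b" where
  "sw R C Q b c = lsum Q (\<lambda>(y, z). b y z) (decomp R C c)"

context coalgebra
begin

sublocale T: tensor R C C by (simp add: tensorI module_axioms)

lemma is_comult_decomp: "is_comult R C (decomp R C)"
  unfolding is_comult_def
proof
  fix c assume "c \<in> carrier C"
  then have "comult C c \<in> carrier T.T" by (rule linear_closed[OF comult_linear])
  then obtain ds where "set ds \<subseteq> carrier C \<times> carrier C" "comult C c = tens R C C ds" by (rule T.tensor_obtain_list)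
  then have "\<exists>ds. set ds \<subseteq> carrier C \<times> carrier C \<and> comult C c = tens R C C ds" by blast
  from someI_ex[OF this] show "set (decomp R C c) \<subseteq> carrier C \<times> carrier C \<and> comult C c = tens R C C (decomp R C c)"
    unfolding decomp_def .
qed

lemma decomp_closed: "c \<in> carrier C \<Longrightarrow> set (decomp R C c) \<subseteq> carrier C \<times> carrier C"
  and comult_decomp: "c \<in> carrier C \<Longrightarrow> comult C c = tens R C C (decomp R C c)"
  using is_comult_decomp by (auto simp: is_comult_def)

lemma decomp_closed': 
  assumes "c \<in> carrier C" "p \<in> set (decomp R C c)" shows "fst p \<in> carrier C" "snd p \<in> carrier C"
  using decomp_closed[OF assms(1)] assms(2) by auto

text \<open>For bilinear \<open>b\<close> the sum does not depend on the list picked by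
  \<open>decomp\<close>; this is what gives \<open>sw\<close> its meaning and its linearity in
  \<open>c\<close>.\<close>

lemma sw_lift:
  assumes "module R Q" "bilinear R C C Q b" "c \<in> carrier C"
  shows "sw R C Q b c = tensor_lift R C C Q b (comult C c)"
  using T.lift_tens[OF assms(1,2) decomp_closed[OF assms(3)]]
  by (simp add: sw_def comult_decomp[OF assms(3)])

lemma sw_eq_list:
  assumes "module R Q" "bilinear R C C Q b" "c \<in> carrier C" "comult C c = tens R C C ds"
    "set ds \<subseteq> carrier C \<times> carrier C"
  shows "sw R C Q b c = lsum Q (\<lambda>(y, z). b y z) ds"
  using T.lift_tens[OF assms(1,2,5)] by (simp add: sw_lift[OF assms(1-3)] assms(4))

lemma sw_linear: "module R Q \<Longrightarrow> bilinear R C C Q b \<Longrightarrow> sw R C Q b \<in> linear_maps R C Q"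
  by (rule linear_cong[OF module_axioms linear_comp[OF T.lift_linear comult_linear]]) (auto simp: sw_lift)

lemma sw_closed:
  assumes "module R Q" "c \<in> carrier C" "\<And>y z. y \<in> carrier C \<Longrightarrow> z \<in> carrier C \<Longrightarrow> b y z \<in> carrier Q"
  shows "sw R C Q b c \<in> carrier Q"
proof -
  interpret Q: module R Q by fact
  show ?thesis unfolding sw_def by (rule Q.lsum_closed) (use assms decomp_closed'[OF assms(2)] in auto)
qed

lemma sw_cong:
  assumes "c \<in> carrier C" "\<And>y z. y \<in> carrier C \<Longrightarrow> z \<in> carrier C \<Longrightarrow> b y z = b' y z"
  shows "sw R C Q b c = sw R C Q b' c"
  unfolding sw_def by (rule lsum_cong[OF refl]) (use assms decomp_closed'[OF assms(1)] in auto)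

lemma linear_sw:
  assumes "module R Q" "c \<in> carrier C"
    "\<And>y z. y \<in> carrier C \<Longrightarrow> z \<in> carrier C \<Longrightarrow> (\<lambda>x. t x y z) \<in> linear_maps R M Q"
  shows "(\<lambda>x. sw R C Q (t x) c) \<in> linear_maps R M Q"
  unfolding sw_def case_prod_unfold
  by (rule linear_sum[OF assms(1)]) (use assms decomp_closed'[OF assms(2)] in auto)

lemma sw_apply:
  assumes "module R Q" "module R Q'" "h \<in> linear_maps R Q Q'" "c \<in> carrier C"
    "\<And>y z. y \<in> carrier C \<Longrightarrow> z \<in> carrier C \<Longrightarrow> b y z \<in> carrier Q"
  shows "h (sw R C Q b c) = sw R C Q' (\<lambda>y z. h (b y z)) c"
  unfolding sw_def case_prod_unfold
  by (rule linear_lsum[OF assms(1-3)]) (use assms decomp_closed'[OF assms(4)] in auto)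

lemma sw_swap:
  assumes "module R Q" "coalgebra R D" "c \<in> carrier C" "e \<in> carrier D"
    "\<And>y z u v. y \<in> carrier C \<Longrightarrow> z \<in> carrier C \<Longrightarrow> u \<in> carrier D \<Longrightarrow> v \<in> carrier D \<Longrightarrow> f y z u v \<in> carrier Q"
  shows "sw R C Q (\<lambda>y z. sw R D Q (f y z) e) c = sw R D Q (\<lambda>u v. sw R C Q (\<lambda>y z. f y z u v) c) e"
proof -
  interpret Q: module R Q by fact
  show ?thesis
    unfolding sw_def case_prod_unfold
    by (rule Q.lsum_swap) (use assms decomp_closed'[OF assms(3)] coalgebra.decomp_closed'[OF assms(2,4)] in auto)
qed

text \<open>A trilinear map factors through a linear map \<open>h\<close> on the triple tensor
  product; applying \<open>h\<close> to the coassociativity axiom gives the identity in any target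
  module.\<close>

lemma sw_coassoc:
  assumes Q: "module R Q" and t: "trilinear R C C C Q t" and c: "c \<in> carrier C"
  shows "sw R C Q (\<lambda>y z. sw R C Q (\<lambda>a b. t a b z) y) c = sw R C Q (\<lambda>y z. sw R C Q (\<lambda>a b. t y a b) z) c"
proof -
  interpret CT: tensor R C T.T by (simp add: tensorI T.tensor_module module_axioms)
  note b = lift_trilinear_right[OF module_axioms T.tensor_axioms Q t]
  define h where "h = tensor_lift R C T.T Q (\<lambda>x. tensor_lift R C C Q (t x))"
  have h: "h \<in> linear_maps R CT.T Q" unfolding h_def by (rule CT.lift_linear[OF Q b])
  have hp: "h (CT.pt x (T.pt y z)) = t x y z" if "x \<in> carrier C" "y \<in> carrier C" "z \<in> carrier C" for x y z
    using that by (simp add: h_def CT.lift_pure[OF Q b] T.lift_pure[OF Q trilinear_bilinear(1)[OF t]])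
  have cl: "CT.pt x (T.pt y z) \<in> carrier CT.T" if "x \<in> carrier C" "y \<in> carrier C" "z \<in> carrier C" for x y z
    using that by auto
  have "sw R C CT.T (\<lambda>y z. sw R C CT.T (\<lambda>a b. CT.pt a (T.pt b z)) y) c =
    sw R C CT.T (\<lambda>y z. sw R C CT.T (\<lambda>a b. CT.pt y (T.pt a b)) z) c"
    using coassoc[OF c] coassoc_left[OF module_axioms comult_linear is_comult_decomp c]
      coassoc_right[OF module_axioms comult_linear is_comult_decomp c] by (simp add: sw_def)
  then have "h (sw R C CT.T (\<lambda>y z. sw R C CT.T (\<lambda>a b. CT.pt a (T.pt b z)) y) c) =
    h (sw R C CT.T (\<lambda>y z. sw R C CT.T (\<lambda>a b. CT.pt y (T.pt a b)) z) c)" by simp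
  moreover have "h (sw R C CT.T (\<lambda>y z. sw R C CT.T (\<lambda>a b. CT.pt a (T.pt b z)) y) c) =
      sw R C Q (\<lambda>y z. h (sw R C CT.T (\<lambda>a b. CT.pt a (T.pt b z)) y)) c"
    by (rule sw_apply[OF CT.tensor_module Q h c]) (auto intro!: sw_closed CT.tensor_module)
  moreover have "\<dots> = sw R C Q (\<lambda>y z. sw R C Q (\<lambda>a b. t a b z) y) c"
    by (rule sw_cong[OF c])
      (auto simp: hp cl sw_apply[OF CT.tensor_module Q h] intro!: sw_cong)
  moreover have "h (sw R C CT.T (\<lambda>y z. sw R C CT.T (\<lambda>a b. CT.pt y (T.pt a b)) z) c) =
      sw R C Q (\<lambda>y z. h (sw R C CT.T (\<lambda>a b. CT.pt y (T.pt a b)) z)) c"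
    by (rule sw_apply[OF CT.tensor_module Q h c]) (auto intro!: sw_closed CT.tensor_module)
  moreover have "\<dots> = sw R C Q (\<lambda>y z. sw R C Q (\<lambda>a b. t y a b) z) c"
    by (rule sw_cong[OF c])
      (auto simp: hp cl sw_apply[OF CT.tensor_module Q h] intro!: sw_cong)
  ultimately show ?thesis by simp
qed

lemma counit_closed: "x \<in> carrier C \<Longrightarrow> counit C x \<in> carrier R"
  using linear_closed[OF counit_linear] by simp

lemma sw_counit_left:
  assumes "module R Q" "h \<in> linear_maps R C Q" "c \<in> carrier C"
  shows "sw R C Q (\<lambda>y z. counit C y \<odot>\<^bsub>Q\<^esub> h z) c = h c"
proof -
  have b: "bilinear R C C C (\<lambda>y z. counit C y \<odot>\<^bsub>C\<^esub> z)"
    by (rule bilinearI) (auto intro!: linear_smult_const linear_smult_left linear_id counit_linear counit_closed module_axioms)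
  have "h c = h (sw R C C (\<lambda>y z. counit C y \<odot>\<^bsub>C\<^esub> z) c)"
    using counit_left[OF assms(3)] sw_lift[OF module_axioms b assms(3)] by simp
  also have "\<dots> = sw R C Q (\<lambda>y z. h (counit C y \<odot>\<^bsub>C\<^esub> z)) c"
    by (rule sw_apply[OF module_axioms assms(1,2,3)]) (auto simp: counit_closed)
  also have "\<dots> = sw R C Q (\<lambda>y z. counit C y \<odot>\<^bsub>Q\<^esub> h z) c"
    by (rule sw_cong[OF assms(3)]) (auto simp: linear_smult[OF assms(2)] counit_closed)
  finally show ?thesis by simp
qed

lemma sw_counit_right:
  assumes "module R Q" "h \<in> linear_maps R C Q" "c \<in> carrier C"
  shows "sw R C Q (\<lambda>y z. counit C z \<odot>\<^bsub>Q\<^esub> h y) c = h c"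
proof -
  have b: "bilinear R C C C (\<lambda>y z. counit C z \<odot>\<^bsub>C\<^esub> y)"
    by (rule bilinearI) (auto intro!: linear_smult_const linear_smult_left linear_id counit_linear counit_closed module_axioms)
  have "h c = h (sw R C C (\<lambda>y z. counit C z \<odot>\<^bsub>C\<^esub> y) c)"
    using counit_right[OF assms(3)] sw_lift[OF module_axioms b assms(3)] by simp
  also have "\<dots> = sw R C Q (\<lambda>y z. h (counit C z \<odot>\<^bsub>C\<^esub> y)) c"
    by (rule sw_apply[OF module_axioms assms(1,2,3)]) (auto simp: counit_closed)
  also have "\<dots> = sw R C Q (\<lambda>y z. counit C z \<odot>\<^bsub>Q\<^esub> h y) c"
    by (rule sw_cong[OF assms(3)]) (auto simp: linear_smult[OF assms(2)] counit_closed)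
  finally show ?thesis by simp
qed

end


section \<open>The antipode reverses products and coproducts\<close>

text \<open>Representatives of a product in a tensor product of two algebras. Only the two
  multiplications enter, so algebras that share them give literally the same list.\<close>

definition prod_list_pairs ::
  "('a, 'm) monoid_scheme \<Rightarrow> ('b, 'n) monoid_scheme \<Rightarrow> ('a \<times> 'b) list \<Rightarrow> ('a \<times> 'b) list \<Rightarrow> ('a \<times> 'b) list"
  where "prod_list_pairs A B ds es =
    concat (map (\<lambda>p. map (\<lambda>q. (fst p \<otimes>\<^bsub>A\<^esub> fst q, snd p \<otimes>\<^bsub>B\<^esub> snd q)) es) ds)"

lemma (in abelian_group) lsum_prod_list_pairs:
  assumes "\<And>p q. p \<in> set ds \<Longrightarrow> q \<in> set es \<Longrightarrow> b (fst p \<otimes>\<^bsub>A\<^esub> fst q) (snd p \<otimes>\<^bsub>B\<^esub> snd q) \<in> carrier G"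
  shows "lsum G (\<lambda>(x, y). b x y) (prod_list_pairs A B ds es) =
    lsum G (\<lambda>p. lsum G (\<lambda>q. b (fst p \<otimes>\<^bsub>A\<^esub> fst q) (snd p \<otimes>\<^bsub>B\<^esub> snd q)) es) ds"
  unfolding prod_list_pairs_def
  by (subst lsum_concat) (use assms in \<open>auto simp: lsum_map\<close>)

context k_algebra
begin

lemma linear_mult_right: "f \<in> linear_maps R M A \<Longrightarrow> a \<in> carrier A \<Longrightarrow> (\<lambda>x. f x \<otimes>\<^bsub>A\<^esub> a) \<in> linear_maps R M A"
  by (rule linear_mapsI) (auto simp: linear_closed linear_add linear_smult A.l_distr smult_mult_left)

lemma linear_mult_left: "f \<in> linear_maps R M A \<Longrightarrow> a \<in> carrier A \<Longrightarrow> (\<lambda>x. a \<otimes>\<^bsub>A\<^esub> f x) \<in> linear_maps R M A"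
  by (rule linear_mapsI) (auto simp: linear_closed linear_add linear_smult A.r_distr smult_mult_right)

lemma bilinear_mult: "bilinear R A A A (mult A)"
  by (rule bilinearI) (auto intro: linear_mult_left linear_mult_right linear_id)

end

section \<open>Multiplication in a tensor product of algebras\<close>

lemma tensor_algebra_simps:
  "carrier (tensor_algebra R A B) = carrier (tensor_space R A B)"
  "one (tensor_algebra R A B) = pure_tensor R A B \<one>\<^bsub>A\<^esub> \<one>\<^bsub>B\<^esub>"
  "add (tensor_algebra R A B) = add (tensor_space R A B)"
  "smult (tensor_algebra R A B) = smult (tensor_space R A B)"
  by (auto simp: tensor_algebra_def Let_def)

lemma tensor_algebra_mult:
  assumes A: "k_algebra R A" and B: "k_algebra R B"
    and ds: "set ds \<subseteq> carrier A \<times> carrier B" and es: "set es \<subseteq> carrier A \<times> carrier B"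
  shows "tens R A B ds \<otimes>\<^bsub>tensor_algebra R A B\<^esub> tens R A B es = tens R A B (prod_list_pairs A B ds es)"
proof -
  interpret A: k_algebra R A by fact
  interpret B: k_algebra R B by fact
  interpret T: tensor R A B by (simp add: tensorI A.module_axioms B.module_axioms)
  have bi: "bilinear R A B T.T (\<lambda>x' y'. T.pt (x \<otimes>\<^bsub>A\<^esub> x') (y \<otimes>\<^bsub>B\<^esub> y'))" if "x \<in> carrier A" "y \<in> carrier B" for x y
    using that by (intro bilinearI linear_comp[OF bilinearD(1)[OF T.pure_bilinear]]
      linear_comp[OF bilinearD(2)[OF T.pure_bilinear]] A.linear_mult_left B.linear_mult_left linear_id) auto
  define m where "m x y = lsum T.T (\<lambda>q. T.pt (x \<otimes>\<^bsub>A\<^esub> fst q) (y \<otimes>\<^bsub>B\<^esub> snd q)) es" for x y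
  have esD: "fst q \<in> carrier A" "snd q \<in> carrier B" if "q \<in> set es" for q using es that by auto
  have dsD: "fst q \<in> carrier A" "snd q \<in> carrier B" if "q \<in> set ds" for q using ds that by auto
  have m: "tensor_lift R A B T.T (\<lambda>x' y'. T.pt (x \<otimes>\<^bsub>A\<^esub> x') (y \<otimes>\<^bsub>B\<^esub> y')) (tens R A B es) = m x y"
    if "x \<in> carrier A" "y \<in> carrier B" for x y
    using T.lift_tens[OF T.tensor_module bi[OF that] es] by (simp add: m_def case_prod_unfold)
  have mb: "bilinear R A B T.T m"
    unfolding m_def using esD
    by (intro bilinearI linear_sum[OF T.tensor_module] linear_comp[OF bilinearD(1)[OF T.pure_bilinear]]
      linear_comp[OF bilinearD(2)[OF T.pure_bilinear]] A.linear_mult_right B.linear_mult_right linear_id) auto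
  \<comment> \<open>The inner lift agrees with \<open>m\<close> on the carriers, and bilinearity is
    visible from the explicit sum \<open>m\<close>.\<close>
  have "bilinear R A B T.T (\<lambda>x y. tensor_lift R A B T.T (\<lambda>x' y'. T.pt (x \<otimes>\<^bsub>A\<^esub> x') (y \<otimes>\<^bsub>B\<^esub> y')) (tens R A B es))"
    by (intro bilinearI linear_cong[OF B.module_axioms bilinearD(1)[OF mb]]
      linear_cong[OF A.module_axioms bilinearD(2)[OF mb]]) (auto simp: m)
  then have "tens R A B ds \<otimes>\<^bsub>tensor_algebra R A B\<^esub> tens R A B es =
    lsum T.T (\<lambda>p. tensor_lift R A B T.T (\<lambda>x' y'. T.pt (fst p \<otimes>\<^bsub>A\<^esub> x') (snd p \<otimes>\<^bsub>B\<^esub> y')) (tens R A B es)) ds"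
    unfolding tensor_algebra_def Let_def using T.lift_tens[OF T.tensor_module _ ds]
    by (simp add: case_prod_unfold)
  also have "\<dots> = lsum T.T (\<lambda>p. m (fst p) (snd p)) ds"
    by (rule lsum_cong[OF refl]) (use dsD m in auto)
  also have "\<dots> = tens R A B (prod_list_pairs A B ds es)"
    unfolding tens_def m_def by (rule T.T.lsum_prod_list_pairs[symmetric]) (use esD dsD in auto)
  finally show ?thesis .
qed

lemma prod_list_pairs_closed:
  assumes "k_algebra R A" "k_algebra R B"
    and ds: "set ds \<subseteq> carrier A \<times> carrier B" and es: "set es \<subseteq> carrier A \<times> carrier B"
  shows "set (prod_list_pairs A B ds es) \<subseteq> carrier A \<times> carrier B"
proof -
  interpret A: k_algebra R A by fact
  interpret B: k_algebra R B by fact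
  have esD: "fst q \<in> carrier A" "snd q \<in> carrier B" if "q \<in> set es" for q using es that by auto
  have dsD: "fst q \<in> carrier A" "snd q \<in> carrier B" if "q \<in> set ds" for q using ds that by auto
  show ?thesis using esD dsD by (auto simp: prod_list_pairs_def)
qed

section \<open>Sweedler sums in a bialgebra\<close>

context bialgebra
begin

lemma sw_mult:
  assumes Q: "module R Q" and b: "bilinear R H H Q b" and xy: "x \<in> carrier H" "y \<in> carrier H"
  shows "sw R H Q b (x \<otimes>\<^bsub>H\<^esub> y) =
    sw R H Q (\<lambda>x1 x2. sw R H Q (\<lambda>y1 y2. b (x1 \<otimes>\<^bsub>H\<^esub> y1) (x2 \<otimes>\<^bsub>H\<^esub> y2)) y) x"
proof -
  interpret Q: module R Q by fact
  have "comult H (x \<otimes>\<^bsub>H\<^esub> y) = comult H x \<otimes>\<^bsub>tensor_algebra R H H\<^esub> comult H y"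
    using comult_hom xy by (auto simp: alg_hom_def ring_hom_def)
  also have "\<dots> = tens R H H (prod_list_pairs H H (decomp R H x) (decomp R H y))"
    using tensor_algebra_mult[OF k_algebra_axioms k_algebra_axioms decomp_closed[OF xy(1)] decomp_closed[OF xy(2)]]
      xy comult_decomp by simp
  finally have "sw R H Q b (x \<otimes>\<^bsub>H\<^esub> y) = lsum Q (\<lambda>(y, z). b y z) (prod_list_pairs H H (decomp R H x) (decomp R H y))"
    using prod_list_pairs_closed[OF k_algebra_axioms k_algebra_axioms decomp_closed[OF xy(1)] decomp_closed[OF xy(2)]]
    using xy by (intro sw_eq_list[OF Q b]) auto
  also have "\<dots> = sw R H Q (\<lambda>x1 x2. sw R H Q (\<lambda>y1 y2. b (x1 \<otimes>\<^bsub>H\<^esub> y1) (x2 \<otimes>\<^bsub>H\<^esub> y2)) y) x"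
    unfolding sw_def
    by (subst Q.lsum_prod_list_pairs)
      (use decomp_closed'[OF xy(1)] decomp_closed'[OF xy(2)] bilinearD(3)[OF b] in \<open>auto simp: case_prod_unfold\<close>)
  finally show ?thesis .
qed

lemma sw_one:
  assumes Q: "module R Q" and b: "bilinear R H H Q b"
  shows "sw R H Q b \<one>\<^bsub>H\<^esub> = b \<one>\<^bsub>H\<^esub> \<one>\<^bsub>H\<^esub>"
proof -
  have "comult H \<one>\<^bsub>H\<^esub> = pure_tensor R H H \<one>\<^bsub>H\<^esub> \<one>\<^bsub>H\<^esub>"
    using comult_hom by (auto simp: alg_hom_def ring_hom_def tensor_algebra_simps)
  then show ?thesis using sw_lift[OF Q b] T.lift_pure[OF Q b] by simp
qed

lemma counit_mult: "x \<in> carrier H \<Longrightarrow> y \<in> carrier H \<Longrightarrow> counit H (x \<otimes>\<^bsub>H\<^esub> y) = counit H x \<otimes> counit H y"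
  and counit_one: "counit H \<one>\<^bsub>H\<^esub> = \<one>"
  using counit_hom by (auto simp: alg_hom_def ring_hom_def)

lemma linear_sw_comp:
  "module R Q \<Longrightarrow> bilinear R H H Q b \<Longrightarrow> f \<in> linear_maps R M H \<Longrightarrow> (\<lambda>x. sw R H Q b (f x)) \<in> linear_maps R M Q"
  by (rule linear_comp[OF sw_linear])

text \<open>Coassociativity of the tensor coalgebra H \<otimes> H, expressed without constructing
  it: coassociativity is applied once in each variable, and the sums over \<open>x\<close> and
  \<open>y\<close> are exchanged in between.\<close>

lemma sw_coassoc2:
  assumes Q: "module R Q" and x: "x \<in> carrier H" and y: "y \<in> carrier H"
    and t1: "\<And>a b c. a \<in> carrier H \<Longrightarrow> b \<in> carrier H \<Longrightarrow> c \<in> carrier H \<Longrightarrow> trilinear R H H H Q (t a b c)"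
    and t2: "\<And>p q r. p \<in> carrier H \<Longrightarrow> q \<in> carrier H \<Longrightarrow> r \<in> carrier H \<Longrightarrow> trilinear R H H H Q (\<lambda>a b c. t a b c p q r)"
  shows "sw R H Q (\<lambda>x1 x2. sw R H Q (\<lambda>y1 y2. sw R H Q (\<lambda>a b. sw R H Q (\<lambda>p q. t a b x2 p q y2) y1) x1) y) x =
    sw R H Q (\<lambda>x1 x2. sw R H Q (\<lambda>y1 y2. sw R H Q (\<lambda>b c. sw R H Q (\<lambda>q r. t x1 b c y1 q r) y2) x2) y) x"
proof -
  note cl = trilinear_closed[OF t1]
  note swap = sw_swap[OF Q coalgebra_axioms]
  have "sw R H Q (\<lambda>x1 x2. sw R H Q (\<lambda>y1 y2. sw R H Q (\<lambda>a b. sw R H Q (\<lambda>p q. t a b x2 p q y2) y1) x1) y) x =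
    sw R H Q (\<lambda>x1 x2. sw R H Q (\<lambda>a b. sw R H Q (\<lambda>y1 y2. sw R H Q (\<lambda>p q. t a b x2 p q y2) y1) y) x1) x"
    by (rule sw_cong[OF x], rule swap) (use y in \<open>auto intro!: sw_closed[OF Q] cl\<close>)
  also have "\<dots> = sw R H Q (\<lambda>x1 x2. sw R H Q (\<lambda>a b. sw R H Q (\<lambda>y1 y2. sw R H Q (\<lambda>q r. t a b x2 y1 q r) y2) y) x1) x"
    by (intro sw_cong[OF x] sw_cong sw_coassoc[OF Q _ y] t1)
  also have "\<dots> = sw R H Q (\<lambda>x1 x2. sw R H Q (\<lambda>b c. sw R H Q (\<lambda>y1 y2. sw R H Q (\<lambda>q r. t x1 b c y1 q r) y2) y) x2) x"
    by (rule sw_coassoc[OF Q _ x])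
      (use t2[unfolded trilinear_def] y in \<open>auto intro!: trilinearI linear_sw[OF Q]\<close>)
  also have "\<dots> = sw R H Q (\<lambda>x1 x2. sw R H Q (\<lambda>y1 y2. sw R H Q (\<lambda>b c. sw R H Q (\<lambda>q r. t x1 b c y1 q r) y2) x2) y) x"
    by (rule sw_cong[OF x], rule swap) (use y in \<open>auto intro!: sw_closed[OF Q] cl\<close>)
  finally show ?thesis .
qed

end

section \<open>The antipode on the unit, under the counit, and on products\<close>

context hopf_algebra
begin

abbreviation (input) "SS \<equiv> antipode H"
abbreviation (input) "\<epsilon> \<equiv> counit H"

lemma antipode_closed: "x \<in> carrier H \<Longrightarrow> SS x \<in> carrier H"
  by (rule linear_closed[OF antipode_linear])

lemma linear_antipode: "f \<in> linear_maps R M H \<Longrightarrow> (\<lambda>x. SS (f x)) \<in> linear_maps R M H"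
  by (rule linear_comp[OF antipode_linear])

lemma linear_counit: "f \<in> linear_maps R M H \<Longrightarrow> (\<lambda>x. \<epsilon> (f x)) \<in> dual R M"
  by (rule linear_comp[OF counit_linear])

lemma sw_antipode_left: "c \<in> carrier H \<Longrightarrow> sw R H H (\<lambda>y z. SS y \<otimes>\<^bsub>H\<^esub> z) c = \<epsilon> c \<odot>\<^bsub>H\<^esub> \<one>\<^bsub>H\<^esub>"
  and sw_antipode_right: "c \<in> carrier H \<Longrightarrow> sw R H H (\<lambda>y z. y \<otimes>\<^bsub>H\<^esub> SS z) c = \<epsilon> c \<odot>\<^bsub>H\<^esub> \<one>\<^bsub>H\<^esub>"
proof -
  assume c: "c \<in> carrier H"
  note dc = decomp_closed[OF c] comult_decomp[OF c]
  have cl: "set (map (map_prod SS id) (decomp R H c)) \<subseteq> carrier H \<times> carrier H"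
    "set (map (map_prod id SS) (decomp R H c)) \<subseteq> carrier H \<times> carrier H"
    using decomp_closed'[OF c] antipode_closed by auto
  note m = module_axioms
  show "sw R H H (\<lambda>y z. SS y \<otimes>\<^bsub>H\<^esub> z) c = \<epsilon> c \<odot>\<^bsub>H\<^esub> \<one>\<^bsub>H\<^esub>"
    using antipode_left[OF c] dc tensor_map_tens[OF m m m m antipode_linear linear_id' dc(1)]
      T.lift_tens[OF m bilinear_mult cl(1)] by (simp add: sw_def lsum_map case_prod_unfold)
  show "sw R H H (\<lambda>y z. y \<otimes>\<^bsub>H\<^esub> SS z) c = \<epsilon> c \<odot>\<^bsub>H\<^esub> \<one>\<^bsub>H\<^esub>"
    using antipode_right[OF c] dc tensor_map_tens[OF m m m m linear_id' antipode_linear dc(1)]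
      T.lift_tens[OF m bilinear_mult cl(2)] by (simp add: sw_def lsum_map case_prod_unfold)
qed

lemmas lin = linear_sw linear_sw_comp linear_mult_left linear_mult_right linear_antipode linear_id
  linear_smult_const linear_smult_left linear_counit
  bilinearI trilinearI module_axioms A.m_closed antipode_closed counit_closed

lemma antipode_one: "SS \<one>\<^bsub>H\<^esub> = \<one>\<^bsub>H\<^esub>"
proof -
  have "sw R H H (\<lambda>y z. SS y \<otimes>\<^bsub>H\<^esub> z) \<one>\<^bsub>H\<^esub> = SS \<one>\<^bsub>H\<^esub> \<otimes>\<^bsub>H\<^esub> \<one>\<^bsub>H\<^esub>"
    by (rule sw_one) (intro lin; assumption)+
  then show ?thesis using sw_antipode_left[of "\<one>\<^bsub>H\<^esub>"] antipode_closed by (simp add: counit_one)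
qed

text \<open>Apply the counit to the left antipode axiom. It is multiplicative, so the counit of the
  second Sweedler factor splits off and is absorbed by the counit law.\<close>

lemma counit_antipode:
  assumes x: "x \<in> carrier H"
  shows "\<epsilon> (SS x) = \<epsilon> x"
proof -
  note s = R.scalar_algebra_module
  have "\<epsilon> x = \<epsilon> (sw R H H (\<lambda>y z. SS y \<otimes>\<^bsub>H\<^esub> z) x)"
    using linear_smult[OF counit_linear, of "\<epsilon> x" "\<one>\<^bsub>H\<^esub>"] x
    by (simp add: sw_antipode_left counit_one counit_closed)
  also have "\<dots> = sw R H (scalar_algebra R) (\<lambda>y z. \<epsilon> (SS y \<otimes>\<^bsub>H\<^esub> z)) x"
    by (rule sw_apply[OF module_axioms s counit_linear x]) (auto simp: antipode_closed)
  also have "\<dots> = sw R H (scalar_algebra R) (\<lambda>y z. \<epsilon> z \<odot>\<^bsub>scalar_algebra R\<^esub> \<epsilon> (SS y)) x"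
    by (rule sw_cong[OF x]) (auto simp: counit_mult antipode_closed counit_closed R.m_comm)
  also have "\<dots> = \<epsilon> (SS x)"
    by (rule sw_counit_right[OF s _ x]) (rule linear_comp[OF counit_linear antipode_linear])
  finally show ?thesis by simp
qed

lemma sw_mult_left:
  assumes "c \<in> carrier H" "a \<in> carrier H" "\<And>y z. y \<in> carrier H \<Longrightarrow> z \<in> carrier H \<Longrightarrow> b y z \<in> carrier H"
  shows "a \<otimes>\<^bsub>H\<^esub> sw R H H b c = sw R H H (\<lambda>y z. a \<otimes>\<^bsub>H\<^esub> b y z) c"
  by (rule sw_apply[OF module_axioms module_axioms linear_mult_left[OF linear_id assms(2)] assms(1,3)])

lemma sw_mult_right:
  assumes "c \<in> carrier H" "a \<in> carrier H" "\<And>y z. y \<in> carrier H \<Longrightarrow> z \<in> carrier H \<Longrightarrow> b y z \<in> carrier H"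
  shows "sw R H H b c \<otimes>\<^bsub>H\<^esub> a = sw R H H (\<lambda>y z. b y z \<otimes>\<^bsub>H\<^esub> a) c"
  by (rule sw_apply[OF module_axioms module_axioms linear_mult_right[OF linear_id assms(2)] assms(1,3)])

text \<open>Both sides are convolution inverses of the multiplication map on the coalgebra \<open>H \<otimes> H\<close>.\<close>

lemma antipode_mult:
  assumes x: "x \<in> carrier H" and y: "y \<in> carrier H"
  shows "SS (x \<otimes>\<^bsub>H\<^esub> y) = SS y \<otimes>\<^bsub>H\<^esub> SS x"
proof -
  note m = module_axioms
  note cl = antipode_closed
  \<comment> \<open>The summand of a threefold convolution product on H \<otimes> H: antipode after
    multiplication, multiplication, reversed product of antipodes. Cancelling the first two factors
    leaves one side of the claim, cancelling the last two leaves the other.\<close>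
  define t where "t a b c p q r = (SS (a \<otimes>\<^bsub>H\<^esub> p) \<otimes>\<^bsub>H\<^esub> (b \<otimes>\<^bsub>H\<^esub> q)) \<otimes>\<^bsub>H\<^esub> (SS r \<otimes>\<^bsub>H\<^esub> SS c)" for a b c p q r
  have L: "sw R H H (\<lambda>a b. sw R H H (\<lambda>p q. SS (a \<otimes>\<^bsub>H\<^esub> p) \<otimes>\<^bsub>H\<^esub> (b \<otimes>\<^bsub>H\<^esub> q)) v) u =
      (\<epsilon> u \<otimes> \<epsilon> v) \<odot>\<^bsub>H\<^esub> \<one>\<^bsub>H\<^esub>" if "u \<in> carrier H" "v \<in> carrier H" for u v
  proof -
    have "bilinear R H H H (\<lambda>y z. SS y \<otimes>\<^bsub>H\<^esub> z)" by (intro lin; assumption?)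
    from sw_mult[OF m this that] show ?thesis using that by (simp add: sw_antipode_left counit_mult)
  qed
  \<comment> \<open>The factors coming from \<open>v\<close> stand between those coming from
    \<open>u\<close>, so they collapse to a scalar first.\<close>
  have M: "sw R H H (\<lambda>a b. sw R H H (\<lambda>p q. (a \<otimes>\<^bsub>H\<^esub> p) \<otimes>\<^bsub>H\<^esub> (SS q \<otimes>\<^bsub>H\<^esub> SS b)) v) u =
      (\<epsilon> u \<otimes> \<epsilon> v) \<odot>\<^bsub>H\<^esub> \<one>\<^bsub>H\<^esub>" if u: "u \<in> carrier H" and v: "v \<in> carrier H" for u v
  proof -
    have "sw R H H (\<lambda>a b. sw R H H (\<lambda>p q. (a \<otimes>\<^bsub>H\<^esub> p) \<otimes>\<^bsub>H\<^esub> (SS q \<otimes>\<^bsub>H\<^esub> SS b)) v) u =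
      sw R H H (\<lambda>a b. \<epsilon> v \<odot>\<^bsub>H\<^esub> (a \<otimes>\<^bsub>H\<^esub> SS b)) u"
    proof (rule sw_cong[OF u])
      fix a b assume ab: "a \<in> carrier H" "b \<in> carrier H"
      have "sw R H H (\<lambda>p q. (a \<otimes>\<^bsub>H\<^esub> p) \<otimes>\<^bsub>H\<^esub> (SS q \<otimes>\<^bsub>H\<^esub> SS b)) v =
        sw R H H (\<lambda>p q. a \<otimes>\<^bsub>H\<^esub> ((p \<otimes>\<^bsub>H\<^esub> SS q) \<otimes>\<^bsub>H\<^esub> SS b)) v"
        by (rule sw_cong[OF v]) (use ab cl in \<open>simp add: A.m_assoc\<close>)
      also have "\<dots> = a \<otimes>\<^bsub>H\<^esub> (sw R H H (\<lambda>p q. p \<otimes>\<^bsub>H\<^esub> SS q) v \<otimes>\<^bsub>H\<^esub> SS b)"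
        using ab cl v by (simp add: sw_mult_left sw_mult_right)
      also have "\<dots> = \<epsilon> v \<odot>\<^bsub>H\<^esub> (a \<otimes>\<^bsub>H\<^esub> SS b)"
        using ab cl v counit_closed by (simp add: sw_antipode_right smult_mult_left smult_mult_right)
      finally show "sw R H H (\<lambda>p q. (a \<otimes>\<^bsub>H\<^esub> p) \<otimes>\<^bsub>H\<^esub> (SS q \<otimes>\<^bsub>H\<^esub> SS b)) v = \<dots>" .
    qed
    also have "\<dots> = \<epsilon> v \<odot>\<^bsub>H\<^esub> sw R H H (\<lambda>a b. a \<otimes>\<^bsub>H\<^esub> SS b) u"
      by (rule sw_apply[OF m m linear_smult_const[OF m linear_id] u, symmetric])
        (use v cl counit_closed in auto)
    finally show ?thesis using u v counit_closed by (simp add: sw_antipode_right smult_assoc1[symmetric] R.m_comm)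
  qed
  have t1: "trilinear R H H H H (t a b c)" if "a \<in> carrier H" "b \<in> carrier H" "c \<in> carrier H" for a b c
    unfolding t_def by (intro lin that; assumption?)
  have t2: "trilinear R H H H H (\<lambda>a b c. t a b c p q r)" if "p \<in> carrier H" "q \<in> carrier H" "r \<in> carrier H" for p q r
    unfolding t_def by (intro lin that; assumption?)
  have "sw R H H (\<lambda>x1 x2. sw R H H (\<lambda>y1 y2. sw R H H (\<lambda>a b. sw R H H (\<lambda>p q. t a b x2 p q y2) y1) x1) y) x =
    sw R H H (\<lambda>x1 x2. sw R H H (\<lambda>y1 y2. \<epsilon> x1 \<odot>\<^bsub>H\<^esub> (\<epsilon> y1 \<odot>\<^bsub>H\<^esub> (SS y2 \<otimes>\<^bsub>H\<^esub> SS x2))) y) x"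
  proof (intro sw_cong[OF x] sw_cong[OF y])
    fix x1 x2 y1 y2 assume c: "x1 \<in> carrier H" "x2 \<in> carrier H" "y1 \<in> carrier H" "y2 \<in> carrier H"
    have "sw R H H (\<lambda>a b. sw R H H (\<lambda>p q. t a b x2 p q y2) y1) x1 =
      sw R H H (\<lambda>a b. sw R H H (\<lambda>p q. SS (a \<otimes>\<^bsub>H\<^esub> p) \<otimes>\<^bsub>H\<^esub> (b \<otimes>\<^bsub>H\<^esub> q)) y1) x1 \<otimes>\<^bsub>H\<^esub> (SS y2 \<otimes>\<^bsub>H\<^esub> SS x2)"
      unfolding t_def using c cl by (simp add: sw_mult_right sw_closed[OF m] cong: sw_cong)
    then show "sw R H H (\<lambda>a b. sw R H H (\<lambda>p q. t a b x2 p q y2) y1) x1 =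
      \<epsilon> x1 \<odot>\<^bsub>H\<^esub> (\<epsilon> y1 \<odot>\<^bsub>H\<^esub> (SS y2 \<otimes>\<^bsub>H\<^esub> SS x2))"
      using c cl L counit_closed by (simp add: smult_mult_left smult_assoc1)
  qed
  also have "\<dots> = sw R H H (\<lambda>x1 x2. \<epsilon> x1 \<odot>\<^bsub>H\<^esub> sw R H H (\<lambda>y1 y2. \<epsilon> y1 \<odot>\<^bsub>H\<^esub> (SS y2 \<otimes>\<^bsub>H\<^esub> SS x2)) y) x"
    by (rule sw_cong[OF x], rule sw_apply[OF m m linear_smult_const[OF m linear_id] y, symmetric])
      (use cl counit_closed in auto)
  also have "\<dots> = sw R H H (\<lambda>x1 x2. \<epsilon> x1 \<odot>\<^bsub>H\<^esub> (SS y \<otimes>\<^bsub>H\<^esub> SS x2)) x"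
    by (rule sw_cong[OF x], subst sw_counit_left[OF m _ y]) (intro lin refl; assumption?)+
  also have "\<dots> = SS y \<otimes>\<^bsub>H\<^esub> SS x"
    by (rule sw_counit_left[OF m _ x]) (intro lin y; assumption?)
  finally have 1: "sw R H H (\<lambda>x1 x2. sw R H H (\<lambda>y1 y2. sw R H H (\<lambda>a b. sw R H H (\<lambda>p q. t a b x2 p q y2) y1) x1) y) x =
    SS y \<otimes>\<^bsub>H\<^esub> SS x" .
  have "sw R H H (\<lambda>x1 x2. sw R H H (\<lambda>y1 y2. sw R H H (\<lambda>b c. sw R H H (\<lambda>q r. t x1 b c y1 q r) y2) x2) y) x =
    sw R H H (\<lambda>x1 x2. sw R H H (\<lambda>y1 y2. \<epsilon> x2 \<odot>\<^bsub>H\<^esub> (\<epsilon> y2 \<odot>\<^bsub>H\<^esub> SS (x1 \<otimes>\<^bsub>H\<^esub> y1))) y) x"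
  proof (intro sw_cong[OF x] sw_cong[OF y])
    fix x1 x2 y1 y2 assume c: "x1 \<in> carrier H" "x2 \<in> carrier H" "y1 \<in> carrier H" "y2 \<in> carrier H"
    have "sw R H H (\<lambda>b c. sw R H H (\<lambda>q r. t x1 b c y1 q r) y2) x2 =
      sw R H H (\<lambda>b c. sw R H H (\<lambda>q r. SS (x1 \<otimes>\<^bsub>H\<^esub> y1) \<otimes>\<^bsub>H\<^esub> ((b \<otimes>\<^bsub>H\<^esub> q) \<otimes>\<^bsub>H\<^esub> (SS r \<otimes>\<^bsub>H\<^esub> SS c))) y2) x2"
      unfolding t_def by (intro sw_cong[OF c(2)] sw_cong[OF c(4)]) (use c cl in \<open>simp add: A.m_assoc\<close>)
    also have "\<dots> = SS (x1 \<otimes>\<^bsub>H\<^esub> y1) \<otimes>\<^bsub>H\<^esub>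
        sw R H H (\<lambda>b c. sw R H H (\<lambda>q r. (b \<otimes>\<^bsub>H\<^esub> q) \<otimes>\<^bsub>H\<^esub> (SS r \<otimes>\<^bsub>H\<^esub> SS c)) y2) x2"
      using c cl by (simp add: sw_mult_left sw_closed[OF m] cong: sw_cong)
    finally show "sw R H H (\<lambda>b c. sw R H H (\<lambda>q r. t x1 b c y1 q r) y2) x2 =
      \<epsilon> x2 \<odot>\<^bsub>H\<^esub> (\<epsilon> y2 \<odot>\<^bsub>H\<^esub> SS (x1 \<otimes>\<^bsub>H\<^esub> y1))"
      using c cl M counit_closed by (simp add: smult_mult_right smult_assoc1)
  qed
  also have "\<dots> = sw R H H (\<lambda>x1 x2. \<epsilon> x2 \<odot>\<^bsub>H\<^esub> sw R H H (\<lambda>y1 y2. \<epsilon> y2 \<odot>\<^bsub>H\<^esub> SS (x1 \<otimes>\<^bsub>H\<^esub> y1)) y) x"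
    by (rule sw_cong[OF x], rule sw_apply[OF m m linear_smult_const[OF m linear_id] y, symmetric])
      (use cl counit_closed in auto)
  also have "\<dots> = sw R H H (\<lambda>x1 x2. \<epsilon> x2 \<odot>\<^bsub>H\<^esub> SS (x1 \<otimes>\<^bsub>H\<^esub> y)) x"
    by (rule sw_cong[OF x], subst sw_counit_right[OF m _ y]) (intro lin refl; assumption?)+
  also have "\<dots> = SS (x \<otimes>\<^bsub>H\<^esub> y)"
    by (rule sw_counit_right[OF m _ x]) (intro lin y; assumption?)
  finally have 2: "sw R H H (\<lambda>x1 x2. sw R H H (\<lambda>y1 y2. sw R H H (\<lambda>b c. sw R H H (\<lambda>q r. t x1 b c y1 q r) y2) x2) y) x =
    SS (x \<otimes>\<^bsub>H\<^esub> y)" .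
  show ?thesis using 1 2 sw_coassoc2[where t = t, OF m x y t1 t2] by simp
qed

end

section \<open>The antipode and the comultiplication\<close>

context hopf_algebra
begin

text \<open>As for \<open>antipode_mult\<close>, both sides are convolution inverses of the comultiplication. Composing
  with an arbitrary bilinear \<open>b\<close> and keeping track of right factors in \<open>D\<close> avoids computing in the
  algebra \<open>H \<otimes> H\<close>.\<close>

lemma sw_antipode:
  assumes Q: "module R Q" and b: "bilinear R H H Q b" and x: "x \<in> carrier H"
  shows "sw R H Q b (SS x) = sw R H Q (\<lambda>y z. b (SS z) (SS y)) x"
proof -
  note m = module_axioms and cl = antipode_closed
  \<comment> \<open>\<open>b\<close> applied to the product of the comultiplication of
    \<open>x\<close> with p \<otimes> q. Right factors in H \<otimes> H are recorded in the last two
    arguments.\<close>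
  define D where "D x p q = sw R H Q (\<lambda>y z. b (y \<otimes>\<^bsub>H\<^esub> p) (z \<otimes>\<^bsub>H\<^esub> q)) x" for x p q
  have bD: "bilinear R H H Q (\<lambda>y z. b (y \<otimes>\<^bsub>H\<^esub> p) (z \<otimes>\<^bsub>H\<^esub> q))" if "p \<in> carrier H" "q \<in> carrier H" for p q
    by (intro bilinearI bilinear_comp_left[OF b] bilinear_comp_right[OF b] lin that; assumption?)
  have D1: "(\<lambda>x. D (f x) p q) \<in> linear_maps R H Q"
    if "f \<in> linear_maps R H H" "p \<in> carrier H" "q \<in> carrier H" for f p q
    unfolding D_def by (rule linear_sw_comp[OF Q bD that(1)]) (use that in auto)
  have D2: "(\<lambda>p. D x (f p) q) \<in> linear_maps R H Q"
    if "f \<in> linear_maps R H H" "x \<in> carrier H" "q \<in> carrier H" for f x q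
    unfolding D_def by (intro linear_sw[OF Q] bilinear_comp_left[OF b] lin that; assumption?)
  have D3: "(\<lambda>q. D x p (f q)) \<in> linear_maps R H Q"
    if "f \<in> linear_maps R H H" "x \<in> carrier H" "p \<in> carrier H" for f x p
    unfolding D_def by (intro linear_sw[OF Q] bilinear_comp_right[OF b] lin that; assumption?)
  have Dc: "D x p q \<in> carrier Q" if "x \<in> carrier H" "p \<in> carrier H" "q \<in> carrier H" for x p q
    using linear_closed[OF D1[OF linear_id that(2,3)] that(1)] .
  note linD = D1 D2 D3 linear_sw[OF Q] linear_sw_comp[OF Q] linear_smult_const[OF Q] linear_smult_left[OF Q] lin
  \<comment> \<open>Associativity in H \<otimes> H combined with multiplicativity of the
    comultiplication.\<close>
  have Dmult: "sw R H Q (\<lambda>y1 y2. D u (y1 \<otimes>\<^bsub>H\<^esub> p) (y2 \<otimes>\<^bsub>H\<^esub> q)) v = D (u \<otimes>\<^bsub>H\<^esub> v) p q"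
    if c: "u \<in> carrier H" "v \<in> carrier H" "p \<in> carrier H" "q \<in> carrier H" for u v p q
  proof -
    have "D (u \<otimes>\<^bsub>H\<^esub> v) p q = sw R H Q (\<lambda>x1 x2. sw R H Q (\<lambda>y1 y2.
        b (x1 \<otimes>\<^bsub>H\<^esub> y1 \<otimes>\<^bsub>H\<^esub> p) (x2 \<otimes>\<^bsub>H\<^esub> y2 \<otimes>\<^bsub>H\<^esub> q)) v) u"
      unfolding D_def by (rule sw_mult[OF Q bD[OF c(3,4)] c(1,2)])
    also have "\<dots> = sw R H Q (\<lambda>x1 x2. sw R H Q (\<lambda>y1 y2.
        b (x1 \<otimes>\<^bsub>H\<^esub> (y1 \<otimes>\<^bsub>H\<^esub> p)) (x2 \<otimes>\<^bsub>H\<^esub> (y2 \<otimes>\<^bsub>H\<^esub> q))) v) u"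
      by (intro sw_cong c) (use c in \<open>simp add: A.m_assoc\<close>)
    also have "\<dots> = sw R H Q (\<lambda>y1 y2. D u (y1 \<otimes>\<^bsub>H\<^esub> p) (y2 \<otimes>\<^bsub>H\<^esub> q)) v"
      unfolding D_def by (rule sw_swap[OF Q coalgebra_axioms c(1,2)]) (use c bilinearD(3)[OF b] in auto)
    finally show ?thesis by simp
  qed
  \<comment> \<open>In Sweedler notation z1 S(z4) \<otimes> z2 S(z3) equals \<epsilon>(z) 1
    \<otimes> 1, so the reversed antipodes give a right convolution inverse of the comultiplication.
    Rebracketing brings z2 and z3 together; once they have collapsed, z1 and z4 are
    adjacent.\<close>
  have V: "sw R H Q (\<lambda>x1 x2. sw R H Q (\<lambda>p q. sw R H Q (\<lambda>r s. E (p \<otimes>\<^bsub>H\<^esub> SS s) (q \<otimes>\<^bsub>H\<^esub> SS r)) x2) x1) z =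
      \<epsilon> z \<odot>\<^bsub>Q\<^esub> E \<one>\<^bsub>H\<^esub> \<one>\<^bsub>H\<^esub>" if z: "z \<in> carrier H" and E: "bilinear R H H Q E" for E z
  proof -
    note linE = bilinear_comp_left[OF E] bilinear_comp_right[OF E] linear_sw[OF Q] linear_sw_comp[OF Q] lin
    note Ec = bilinearD(3)[OF E]
    have "sw R H Q (\<lambda>x1 x2. sw R H Q (\<lambda>p q. sw R H Q (\<lambda>r s. E (p \<otimes>\<^bsub>H\<^esub> SS s) (q \<otimes>\<^bsub>H\<^esub> SS r)) x2) x1) z =
      sw R H Q (\<lambda>x1 x2. sw R H Q (\<lambda>p q. sw R H Q (\<lambda>r s. E (x1 \<otimes>\<^bsub>H\<^esub> SS s) (p \<otimes>\<^bsub>H\<^esub> SS r)) q) x2) z"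
      by (rule sw_coassoc[OF Q _ z]) (intro linE; assumption?)
    also have "\<dots> = sw R H Q (\<lambda>x1 x2. sw R H Q (\<lambda>u s. sw R H Q (\<lambda>p r. E (x1 \<otimes>\<^bsub>H\<^esub> SS s) (p \<otimes>\<^bsub>H\<^esub> SS r)) u) x2) z"
      by (rule sw_cong[OF z], rule sw_coassoc[OF Q, symmetric]) (intro linE; assumption?)+
    also have "\<dots> = sw R H Q (\<lambda>x1 x2. E (x1 \<otimes>\<^bsub>H\<^esub> SS x2) \<one>\<^bsub>H\<^esub>) z"
    proof (rule sw_cong[OF z])
      fix x1 x2 assume c: "x1 \<in> carrier H" "x2 \<in> carrier H"
      have "sw R H Q (\<lambda>u s. sw R H Q (\<lambda>p r. E (x1 \<otimes>\<^bsub>H\<^esub> SS s) (p \<otimes>\<^bsub>H\<^esub> SS r)) u) x2 =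
        sw R H Q (\<lambda>u s. \<epsilon> u \<odot>\<^bsub>Q\<^esub> E (x1 \<otimes>\<^bsub>H\<^esub> SS s) \<one>\<^bsub>H\<^esub>) x2"
      proof (rule sw_cong[OF c(2)])
        fix u s assume us: "u \<in> carrier H" "s \<in> carrier H"
        have l: "E (x1 \<otimes>\<^bsub>H\<^esub> SS s) \<in> linear_maps R H Q" by (rule bilinearD(1)[OF E]) (use c us cl in auto)
        have "sw R H Q (\<lambda>p r. E (x1 \<otimes>\<^bsub>H\<^esub> SS s) (p \<otimes>\<^bsub>H\<^esub> SS r)) u =
          E (x1 \<otimes>\<^bsub>H\<^esub> SS s) (sw R H H (\<lambda>p r. p \<otimes>\<^bsub>H\<^esub> SS r) u)"
          by (rule sw_apply[OF m Q l us(1), symmetric]) (use cl in auto)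
        then show "sw R H Q (\<lambda>p r. E (x1 \<otimes>\<^bsub>H\<^esub> SS s) (p \<otimes>\<^bsub>H\<^esub> SS r)) u = \<epsilon> u \<odot>\<^bsub>Q\<^esub> E (x1 \<otimes>\<^bsub>H\<^esub> SS s) \<one>\<^bsub>H\<^esub>"
          using us counit_closed by (simp add: sw_antipode_right linear_smult[OF l])
      qed
      also have "\<dots> = E (x1 \<otimes>\<^bsub>H\<^esub> SS x2) \<one>\<^bsub>H\<^esub>"
        by (rule sw_counit_left[OF Q _ c(2)]) (intro linE c A.one_closed; assumption?)
      finally show "sw R H Q (\<lambda>u s. sw R H Q (\<lambda>p r. E (x1 \<otimes>\<^bsub>H\<^esub> SS s) (p \<otimes>\<^bsub>H\<^esub> SS r)) u) x2 = \<dots>" .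
    qed
    also have "\<dots> = E (sw R H H (\<lambda>x1 x2. x1 \<otimes>\<^bsub>H\<^esub> SS x2) z) \<one>\<^bsub>H\<^esub>"
      by (rule sw_apply[OF m Q bilinearD(2)[OF E] z, symmetric]) (use cl in auto)
    also have "\<dots> = \<epsilon> z \<odot>\<^bsub>Q\<^esub> E \<one>\<^bsub>H\<^esub> \<one>\<^bsub>H\<^esub>"
      using z counit_closed linear_smult[OF bilinearD(2)[OF E]] by (simp add: sw_antipode_right)
    finally show ?thesis .
  qed
  have ED: "bilinear R H H Q (\<lambda>p q. D u p q)" if "u \<in> carrier H" for u
    by (rule bilinearI) (use D2[OF linear_id that] D3[OF linear_id that] in auto)
  \<comment> \<open>A counit is inserted to the right of the antipode and expanded by
    \<open>V\<close>. Then S(x1) meets x2 under one comultiplication, by \<open>Dmult\<close>, and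
    the left antipode axiom removes both.\<close>
  have "sw R H Q b (SS x) = D (SS x) \<one>\<^bsub>H\<^esub> \<one>\<^bsub>H\<^esub>"
    unfolding D_def by (rule sw_cong) (use x cl in auto)
  also have "\<dots> = sw R H Q (\<lambda>x1 x2. \<epsilon> x2 \<odot>\<^bsub>Q\<^esub> D (SS x1) \<one>\<^bsub>H\<^esub> \<one>\<^bsub>H\<^esub>) x"
    by (rule sw_counit_right[OF Q _ x, symmetric]) (rule D1[OF antipode_linear], auto)
  also have "\<dots> = sw R H Q (\<lambda>x1 x2. sw R H Q (\<lambda>y z. sw R H Q (\<lambda>p q.
      sw R H Q (\<lambda>r s. D (SS x1) (p \<otimes>\<^bsub>H\<^esub> SS s) (q \<otimes>\<^bsub>H\<^esub> SS r)) z) y) x2) x"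
    by (rule sw_cong[OF x], rule V[symmetric]) (use ED cl in auto)
  also have "\<dots> = sw R H Q (\<lambda>x1 x2. sw R H Q (\<lambda>y z. sw R H Q (\<lambda>r s. sw R H Q (\<lambda>p q.
      D (SS x1) (p \<otimes>\<^bsub>H\<^esub> SS s) (q \<otimes>\<^bsub>H\<^esub> SS r)) y) z) x2) x"
    by (intro sw_cong[OF x] sw_cong sw_swap[OF Q coalgebra_axioms]) (use Dc cl in auto)
  also have "\<dots> = sw R H Q (\<lambda>x1 x2. sw R H Q (\<lambda>y z. sw R H Q (\<lambda>r s. D (SS x1 \<otimes>\<^bsub>H\<^esub> y) (SS s) (SS r)) z) x2) x"
    by (intro sw_cong[OF x] sw_cong Dmult; (rule cl)?)
  also have "\<dots> = sw R H Q (\<lambda>x1 x2. sw R H Q (\<lambda>y z. sw R H Q (\<lambda>r s. D (SS y \<otimes>\<^bsub>H\<^esub> z) (SS s) (SS r)) x2) x1) x"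
    by (rule sw_coassoc[OF Q _ x, symmetric]) (intro linD; assumption?)
  also have "\<dots> = sw R H Q (\<lambda>x1 x2. \<epsilon> x1 \<odot>\<^bsub>Q\<^esub> sw R H Q (\<lambda>r s. D \<one>\<^bsub>H\<^esub> (SS s) (SS r)) x2) x"
  proof (rule sw_cong[OF x])
    fix x1 x2 assume c: "x1 \<in> carrier H" "x2 \<in> carrier H"
    define h where "h u = sw R H Q (\<lambda>r s. D u (SS s) (SS r)) x2" for u
    have h: "h \<in> linear_maps R H Q"
      unfolding h_def by (intro linD c; assumption?)
    have "sw R H Q (\<lambda>y z. h (SS y \<otimes>\<^bsub>H\<^esub> z)) x1 = h (sw R H H (\<lambda>y z. SS y \<otimes>\<^bsub>H\<^esub> z) x1)"
      by (rule sw_apply[OF m Q h c(1), symmetric]) (use cl in auto)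
    also have "\<dots> = \<epsilon> x1 \<odot>\<^bsub>Q\<^esub> h \<one>\<^bsub>H\<^esub>"
      using c counit_closed by (simp add: sw_antipode_left linear_smult[OF h])
    finally show "sw R H Q (\<lambda>y z. sw R H Q (\<lambda>r s. D (SS y \<otimes>\<^bsub>H\<^esub> z) (SS s) (SS r)) x2) x1 =
      \<epsilon> x1 \<odot>\<^bsub>Q\<^esub> sw R H Q (\<lambda>r s. D \<one>\<^bsub>H\<^esub> (SS s) (SS r)) x2"
      by (simp add: h_def)
  qed
  also have "\<dots> = sw R H Q (\<lambda>r s. D \<one>\<^bsub>H\<^esub> (SS s) (SS r)) x"
    by (rule sw_counit_left[OF Q _ x]) (intro linD sw_linear[OF Q] A.one_closed; assumption?)
  also have "\<dots> = sw R H Q (\<lambda>y z. b (SS z) (SS y)) x"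
  proof (rule sw_cong[OF x])
    fix y z assume "y \<in> carrier H" "z \<in> carrier H"
    then have "SS y \<in> carrier H" "SS z \<in> carrier H" by (auto simp: cl)
    then show "D \<one>\<^bsub>H\<^esub> (SS z) (SS y) = b (SS z) (SS y)"
      unfolding D_def using sw_one[OF Q bD] by simp
  qed
  finally show ?thesis .
qed

end

lemma image_prodE:
  assumes "h \<in> (\<lambda>(a, b). f a b) ` (A \<times> B)"
  obtains a b where "a \<in> A" "b \<in> B" "h = f a b"
  using assms by auto

text \<open>Serves for a comultiplication given by chosen representatives, which is not visibly
  linear; composed with the functionals of a separating family it is.\<close>

lemma linear_if_separating:
  assumes M: "module R M" and N: "module R N" and sep: "separating R N \<Phi>"
    and c: "\<And>x. x \<in> carrier M \<Longrightarrow> f x \<in> carrier N"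
    and l: "\<And>h. h \<in> \<Phi> \<Longrightarrow> (\<lambda>x. h (f x)) \<in> dual R M"
  shows "f \<in> linear_maps R M N"
proof (rule linear_mapsI)
  interpret M: module R M by fact
  interpret N: module R N by fact
  have h: "h \<in> dual R N" if "h \<in> \<Phi>" for h using sep that by (auto simp: separating_def)
  show "f x \<in> carrier N" if "x \<in> carrier M" for x using c that .
  show "f (x \<oplus>\<^bsub>M\<^esub> y) = f x \<oplus>\<^bsub>N\<^esub> f y" if "x \<in> carrier M" "y \<in> carrier M" for x y
    by (rule separatingD[OF N sep]) (use that c linear_add[OF l that] linear_add[OF h] in auto)
  show "f (r \<odot>\<^bsub>M\<^esub> x) = r \<odot>\<^bsub>N\<^esub> f x" if "r \<in> carrier R" "x \<in> carrier M" for r x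
    by (rule separatingD[OF N sep]) (use that c linear_smult[OF l that] linear_smult[OF h] in auto)
qed


section \<open>Hopf algebras from separating functionals\<close>

text \<open>Every axiom about tensors is replaced by scalar identities for functionals from
  \<open>\<Phi>\<close>. This is enough because products of separating functionals separate H
  \<otimes> H and then H \<otimes> (H \<otimes> H). The antipode axioms take values in
  \<open>H\<close> itself and are kept as they are. The representatives \<open>d\<close> are an
  arbitrary choice.\<close>

locale hopf_data = k_algebra R H
  for R (structure) and H :: "('k, 'a, 'm) hopf_scheme" (structure) +
  fixes \<Phi> :: "('a \<Rightarrow> 'k) set" and d :: "'a \<Rightarrow> ('a \<times> 'a) list"
  assumes sep: "separating R H \<Phi>"
    and d_closed: "x \<in> carrier H \<Longrightarrow> set (d x) \<subseteq> carrier H \<times> carrier H"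
    and comult_eq: "x \<in> carrier H \<Longrightarrow> comult H x = tens R H H (d x)"
    and conv_linear: "\<alpha> \<in> \<Phi> \<Longrightarrow> \<beta> \<in> \<Phi> \<Longrightarrow> (\<lambda>x. lsum R (\<lambda>(y, z). \<alpha> y \<otimes> \<beta> z) (d x)) \<in> dual R H"
    and conv_assoc: "\<alpha> \<in> \<Phi> \<Longrightarrow> \<beta> \<in> \<Phi> \<Longrightarrow> \<gamma> \<in> \<Phi> \<Longrightarrow> x \<in> carrier H \<Longrightarrow>
      lsum R (\<lambda>(y, z). lsum R (\<lambda>(a, b). \<alpha> a \<otimes> \<beta> b) (d y) \<otimes> \<gamma> z) (d x) =
      lsum R (\<lambda>(y, z). \<alpha> y \<otimes> lsum R (\<lambda>(a, b). \<beta> a \<otimes> \<gamma> b) (d z)) (d x)"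
    and conv_counit_left: "\<alpha> \<in> \<Phi> \<Longrightarrow> x \<in> carrier H \<Longrightarrow> lsum R (\<lambda>(y, z). counit H y \<otimes> \<alpha> z) (d x) = \<alpha> x"
    and conv_counit_right: "\<alpha> \<in> \<Phi> \<Longrightarrow> x \<in> carrier H \<Longrightarrow> lsum R (\<lambda>(y, z). counit H z \<otimes> \<alpha> y) (d x) = \<alpha> x"
    and conv_mult: "\<alpha> \<in> \<Phi> \<Longrightarrow> \<beta> \<in> \<Phi> \<Longrightarrow> x \<in> carrier H \<Longrightarrow> y \<in> carrier H \<Longrightarrow>
      lsum R (\<lambda>(u, v). \<alpha> u \<otimes> \<beta> v) (d (x \<otimes>\<^bsub>H\<^esub> y)) =
      lsum R (\<lambda>(u, v). \<alpha> u \<otimes> \<beta> v) (prod_list_pairs H H (d x) (d y))"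
    and conv_one: "\<alpha> \<in> \<Phi> \<Longrightarrow> \<beta> \<in> \<Phi> \<Longrightarrow>
      lsum R (\<lambda>(u, v). \<alpha> u \<otimes> \<beta> v) (d \<one>\<^bsub>H\<^esub>) = \<alpha> \<one>\<^bsub>H\<^esub> \<otimes> \<beta> \<one>\<^bsub>H\<^esub>"
    and counit_alg_hom: "counit H \<in> alg_hom R H (scalar_algebra R)"
    and antipode_lin: "antipode H \<in> linear_maps R H H"
    and lsum_antipode_left: "x \<in> carrier H \<Longrightarrow>
      lsum H (\<lambda>(y, z). antipode H y \<otimes>\<^bsub>H\<^esub> z) (d x) = counit H x \<odot>\<^bsub>H\<^esub> \<one>\<^bsub>H\<^esub>"
    and lsum_antipode_right: "x \<in> carrier H \<Longrightarrow>
      lsum H (\<lambda>(y, z). y \<otimes>\<^bsub>H\<^esub> antipode H z) (d x) = counit H x \<odot>\<^bsub>H\<^esub> \<one>\<^bsub>H\<^esub>"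
begin

sublocale T: tensor R H H by (simp add: tensorI module_axioms)
sublocale TT: tensor R H T.T by (simp add: tensorI module_axioms T.tensor_module)

lemma \<Phi>_dual: "\<alpha> \<in> \<Phi> \<Longrightarrow> \<alpha> \<in> dual R H" using sep by (auto simp: separating_def)

lemma \<Phi>_bilinear: "\<alpha> \<in> \<Phi> \<Longrightarrow> \<beta> \<in> \<Phi> \<Longrightarrow> bilinear R H H (scalar_algebra R) (\<lambda>y z. \<alpha> y \<otimes> \<beta> z)"
  by (rule R.bilinear_mult_dual) (auto intro: \<Phi>_dual)

abbreviation "\<Phi>2 \<equiv> (\<lambda>(\<alpha>, \<beta>). tensor_lift R H H (scalar_algebra R) (\<lambda>x y. \<alpha> x \<otimes> \<beta> y)) ` (\<Phi> \<times> \<Phi>)"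

lemma sep2: "separating R T.T \<Phi>2"
  by (rule T.tensor_separating[OF R.field_axioms sep sep])

lemma lift2_tens: "\<alpha> \<in> \<Phi> \<Longrightarrow> \<beta> \<in> \<Phi> \<Longrightarrow> set ds \<subseteq> carrier H \<times> carrier H \<Longrightarrow>
    tensor_lift R H H (scalar_algebra R) (\<lambda>x y. \<alpha> x \<otimes> \<beta> y) (tens R H H ds) = lsum R (\<lambda>(x, y). \<alpha> x \<otimes> \<beta> y) ds"
  using T.lift_tens[OF R.scalar_algebra_module \<Phi>_bilinear] by simp

lemma d_closed': "x \<in> carrier H \<Longrightarrow> p \<in> set (d x) \<Longrightarrow> fst p \<in> carrier H \<and> snd p \<in> carrier H"
  using d_closed by fastforce

lemma comult_lin: "comult H \<in> linear_maps R H T.T"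
proof (rule linear_if_separating[OF module_axioms T.tensor_module sep2])
  show "comult H x \<in> carrier T.T" if "x \<in> carrier H" for x
    using comult_eq[OF that] d_closed[OF that] by auto
  fix h assume "h \<in> \<Phi>2"
  then obtain \<alpha> \<beta> where ab: "\<alpha> \<in> \<Phi>" "\<beta> \<in> \<Phi>" "h = tensor_lift R H H (scalar_algebra R) (\<lambda>x y. \<alpha> x \<otimes> \<beta> y)"
    by auto
  show "(\<lambda>x. h (comult H x)) \<in> dual R H"
    by (rule linear_cong[OF module_axioms conv_linear[OF ab(1,2)]])
      (simp add: ab(3) comult_eq lift2_tens[OF ab(1,2) d_closed])
qed

lemma is_comult: "is_comult R H d"
  using d_closed comult_eq by (auto simp: is_comult_def)

text \<open>The functionals \<alpha> \<otimes> (\<beta> \<otimes> \<gamma>) with factors from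
  \<open>\<Phi>\<close> separate the triple tensor product, and after applying one of them the two
  bracketings are the two sides of \<open>conv_assoc\<close>.\<close>

lemma coassociative:
  assumes x: "x \<in> carrier H"
  shows "tensor_assoc R H H H (tensor_map R H H T.T H (comult H) id (comult H x)) =
    tensor_map R H H H T.T id (comult H) (comult H x)"
  unfolding coassoc_left[OF module_axioms comult_lin is_comult x] coassoc_right[OF module_axioms comult_lin is_comult x]
    case_prod_unfold
proof (rule separatingD[OF TT.tensor_module TT.tensor_separating[OF R.field_axioms sep sep2]])
  note s = R.scalar_algebra_module
  have dD: "fst p \<in> carrier H" "snd p \<in> carrier H" if "x \<in> carrier H" "p \<in> set (d x)" for p x
    using d_closed'[OF that] by auto
  note dDx = dD[OF x] dD[OF dD(1)[OF x]] dD[OF dD(2)[OF x]]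
  let ?l = "\<lambda>p. lsum TT.T (\<lambda>q. TT.pt (fst q) (T.pt (snd q) (snd p))) (d (fst p))"
  let ?r = "\<lambda>p. lsum TT.T (\<lambda>q. TT.pt (fst p) (T.pt (fst q) (snd q))) (d (snd p))"
  have lc: "?l p \<in> carrier TT.T" and rc: "?r p \<in> carrier TT.T" if "p \<in> set (d x)" for p
    using that dDx by (auto intro!: TT.T.lsum_closed)
  show "lsum TT.T ?l (d x) \<in> carrier TT.T" "lsum TT.T ?r (d x) \<in> carrier TT.T"
    by (intro TT.T.lsum_closed lc rc; assumption)+
  fix h assume "h \<in> (\<lambda>(\<alpha>, \<beta>). tensor_lift R H T.T (scalar_algebra R) (\<lambda>x y. \<alpha> x \<otimes> \<beta> y)) ` (\<Phi> \<times> \<Phi>2)"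
  then obtain \<alpha> k where abc1: "\<alpha> \<in> \<Phi>" and k2: "k \<in> \<Phi>2"
    and hk: "h = tensor_lift R H T.T (scalar_algebra R) (\<lambda>x y. \<alpha> x \<otimes> k y)"
    by (rule image_prodE)
  obtain \<beta> \<gamma> where abc23: "\<beta> \<in> \<Phi>" "\<gamma> \<in> \<Phi>"
    and k: "k = tensor_lift R H H (scalar_algebra R) (\<lambda>x y. \<beta> x \<otimes> \<gamma> y)"
    using k2 by (rule image_prodE)
  note abc = abc1 abc23
  have kd: "k \<in> dual R T.T" unfolding k by (rule T.lift_linear[OF s \<Phi>_bilinear[OF abc(2,3)]])
  note bk = R.bilinear_mult_dual[OF \<Phi>_dual[OF abc(1)] kd]
  have hd: "h \<in> dual R TT.T" unfolding hk by (rule TT.lift_linear[OF s bk])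
  have kp: "k (T.pt b c) = \<beta> b \<otimes> \<gamma> c" if "b \<in> carrier H" "c \<in> carrier H" for b c
    using that by (simp add: k T.lift_pure[OF s \<Phi>_bilinear[OF abc(2,3)]])
  have hp: "h (TT.pt a (T.pt b c)) = \<alpha> a \<otimes> (\<beta> b \<otimes> \<gamma> c)"
    if "a \<in> carrier H" "b \<in> carrier H" "c \<in> carrier H" for a b c
    using that by (simp add: hk TT.lift_pure[OF s bk] kp)
  have ac: "\<alpha> a \<in> carrier R" "\<beta> a \<in> carrier R" "\<gamma> a \<in> carrier R" if "a \<in> carrier H" for a
    using linear_closed[OF \<Phi>_dual[OF abc(1)]] linear_closed[OF \<Phi>_dual[OF abc(2)]]
      linear_closed[OF \<Phi>_dual[OF abc(3)]] that by auto
  have "h (lsum TT.T ?l (d x)) = lsum R (\<lambda>p. h (?l p)) (d x)"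
    using linear_lsum[OF TT.tensor_module s hd, of "d x" ?l] lc by simp
  also have "\<dots> = lsum R (\<lambda>p. lsum R (\<lambda>q. \<alpha> (fst q) \<otimes> \<beta> (snd q)) (d (fst p)) \<otimes> \<gamma> (snd p)) (d x)"
  proof (rule lsum_cong[OF refl])
    fix p assume p: "p \<in> set (d x)"
    have "h (?l p) = lsum R (\<lambda>q. h (TT.pt (fst q) (T.pt (snd q) (snd p)))) (d (fst p))"
      using linear_lsum[OF TT.tensor_module s hd, of "d (fst p)" "\<lambda>q. TT.pt (fst q) (T.pt (snd q) (snd p))"]
        dDx p by auto
    also have "\<dots> = lsum R (\<lambda>q. \<alpha> (fst q) \<otimes> \<beta> (snd q) \<otimes> \<gamma> (snd p)) (d (fst p))"
      by (rule lsum_cong[OF refl]) (use dDx[OF p] hp ac in \<open>simp add: R.m_assoc\<close>)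
    also have "\<dots> = lsum R (\<lambda>q. \<alpha> (fst q) \<otimes> \<beta> (snd q)) (d (fst p)) \<otimes> \<gamma> (snd p)"
      by (rule R.lsum_rdistr[symmetric]) (use dDx[OF p] ac in auto)
    finally show "h (?l p) = \<dots>" .
  qed
  also have "\<dots> = lsum R (\<lambda>p. \<alpha> (fst p) \<otimes> lsum R (\<lambda>q. \<beta> (fst q) \<otimes> \<gamma> (snd q)) (d (snd p))) (d x)"
    using conv_assoc[OF abc x] by (simp add: case_prod_unfold)
  also have "\<dots> = lsum R (\<lambda>p. h (?r p)) (d x)"
  proof (rule lsum_cong[OF refl])
    fix p assume p: "p \<in> set (d x)"
    have "h (?r p) = lsum R (\<lambda>q. h (TT.pt (fst p) (T.pt (fst q) (snd q)))) (d (snd p))"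
      using linear_lsum[OF TT.tensor_module s hd, of "d (snd p)" "\<lambda>q. TT.pt (fst p) (T.pt (fst q) (snd q))"]
        dDx p by auto
    also have "\<dots> = lsum R (\<lambda>q. \<alpha> (fst p) \<otimes> (\<beta> (fst q) \<otimes> \<gamma> (snd q))) (d (snd p))"
      by (rule lsum_cong[OF refl]) (use dDx[OF p] hp in simp)
    also have "\<dots> = \<alpha> (fst p) \<otimes> lsum R (\<lambda>q. \<beta> (fst q) \<otimes> \<gamma> (snd q)) (d (snd p))"
      by (rule R.lsum_ldistr[symmetric]) (use dDx[OF p] ac in auto)
    finally show "\<alpha> (fst p) \<otimes> lsum R (\<lambda>q. \<beta> (fst q) \<otimes> \<gamma> (snd q)) (d (snd p)) = h (?r p)" by simp
  qed
  also have "\<dots> = h (lsum TT.T ?r (d x))"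
    using linear_lsum[OF TT.tensor_module s hd, of "d x" ?r] rc by simp
  finally show "h (lsum TT.T ?l (d x)) = h (lsum TT.T ?r (d x))" .
qed

lemma counit_dual: "counit H \<in> dual R H"
  using counit_alg_hom by (auto simp: alg_hom_def)

lemma counit_in: "x \<in> carrier H \<Longrightarrow> counit H x \<in> carrier R"
  using linear_closed[OF counit_dual] by simp

lemma counital:
  assumes x: "x \<in> carrier H"
  shows "tensor_lift R H H H (\<lambda>x y. counit H x \<odot>\<^bsub>H\<^esub> y) (comult H x) = x"
    and "tensor_lift R H H H (\<lambda>x y. counit H y \<odot>\<^bsub>H\<^esub> x) (comult H x) = x"
proof -
  note s = R.scalar_algebra_module
  have smc: "(\<lambda>x. counit H x \<odot>\<^bsub>H\<^esub> y) \<in> linear_maps R H H" if "y \<in> carrier H" for y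
    using that by (intro linear_mapsI) (auto simp: counit_in smult_l_distr smult_assoc1 smult_r_distr
      linear_add[OF counit_dual] linear_smult[OF counit_dual])
  have b1: "bilinear R H H H (\<lambda>x y. counit H x \<odot>\<^bsub>H\<^esub> y)"
    using smc by (intro bilinearI) (auto intro: linear_smult_const module_axioms linear_id counit_in)
  have b2: "bilinear R H H H (\<lambda>x y. counit H y \<odot>\<^bsub>H\<^esub> x)"
    using smc by (intro bilinearI) (auto intro: linear_smult_const module_axioms linear_id counit_in)
  note dD = d_closed'[OF x]
  have "lsum H (\<lambda>p. counit H (fst p) \<odot>\<^bsub>H\<^esub> snd p) (d x) = x"
  proof (rule separatingD[OF module_axioms sep])
    fix \<alpha> assume a: "\<alpha> \<in> \<Phi>"
    have "\<alpha> (lsum H (\<lambda>p. counit H (fst p) \<odot>\<^bsub>H\<^esub> snd p) (d x)) = lsum R (\<lambda>p. \<alpha> (counit H (fst p) \<odot>\<^bsub>H\<^esub> snd p)) (d x)"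
      using linear_lsum[OF module_axioms s \<Phi>_dual[OF a], of "d x"] dD counit_in by auto
    also have "\<dots> = lsum R (\<lambda>p. counit H (fst p) \<otimes> \<alpha> (snd p)) (d x)"
      by (rule lsum_cong[OF refl]) (use dD counit_in linear_smult[OF \<Phi>_dual[OF a]] in auto)
    finally show "\<alpha> (lsum H (\<lambda>p. counit H (fst p) \<odot>\<^bsub>H\<^esub> snd p) (d x)) = \<alpha> x"
      using conv_counit_left[OF a x] by (simp add: case_prod_unfold)
  qed (use x dD counit_in in auto)
  then show "tensor_lift R H H H (\<lambda>x y. counit H x \<odot>\<^bsub>H\<^esub> y) (comult H x) = x"
    using T.lift_tens[OF module_axioms b1 d_closed[OF x]] by (simp add: comult_eq x case_prod_unfold)
  have "lsum H (\<lambda>p. counit H (snd p) \<odot>\<^bsub>H\<^esub> fst p) (d x) = x"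
  proof (rule separatingD[OF module_axioms sep])
    fix \<alpha> assume a: "\<alpha> \<in> \<Phi>"
    have "\<alpha> (lsum H (\<lambda>p. counit H (snd p) \<odot>\<^bsub>H\<^esub> fst p) (d x)) = lsum R (\<lambda>p. \<alpha> (counit H (snd p) \<odot>\<^bsub>H\<^esub> fst p)) (d x)"
      using linear_lsum[OF module_axioms s \<Phi>_dual[OF a], of "d x"] dD counit_in by auto
    also have "\<dots> = lsum R (\<lambda>p. counit H (snd p) \<otimes> \<alpha> (fst p)) (d x)"
      by (rule lsum_cong[OF refl]) (use dD counit_in linear_smult[OF \<Phi>_dual[OF a]] in auto)
    finally show "\<alpha> (lsum H (\<lambda>p. counit H (snd p) \<odot>\<^bsub>H\<^esub> fst p) (d x)) = \<alpha> x"
      using conv_counit_right[OF a x] by (simp add: case_prod_unfold)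
  qed (use x dD counit_in in auto)
  then show "tensor_lift R H H H (\<lambda>x y. counit H y \<odot>\<^bsub>H\<^esub> x) (comult H x) = x"
    using T.lift_tens[OF module_axioms b2 d_closed[OF x]] by (simp add: comult_eq x case_prod_unfold)
qed

lemma comult_alg_hom: "comult H \<in> alg_hom R H (tensor_algebra R H H)"
proof -
  have lin: "comult H \<in> linear_maps R H (tensor_algebra R H H)"
    using comult_lin by (simp add: linear_maps_def tensor_algebra_simps)
  have "comult H \<in> ring_hom H (tensor_algebra R H H)"
  proof (rule ring_hom_memI)
    fix x y assume xy: "x \<in> carrier H" "y \<in> carrier H"
    show "comult H x \<in> carrier (tensor_algebra R H H)" using linear_closed[OF lin xy(1)] .
    show "comult H (x \<oplus>\<^bsub>H\<^esub> y) = comult H x \<oplus>\<^bsub>tensor_algebra R H H\<^esub> comult H y"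
      using linear_add[OF lin xy] .
    have "comult H (x \<otimes>\<^bsub>H\<^esub> y) = tens R H H (prod_list_pairs H H (d x) (d y))"
      using xy by (simp add: comult_eq) (intro T.tens_eqI[OF R.field_axioms sep sep] d_closed conv_mult
        prod_list_pairs_closed[OF k_algebra_axioms k_algebra_axioms] A.m_closed)
    then show "comult H (x \<otimes>\<^bsub>H\<^esub> y) = comult H x \<otimes>\<^bsub>tensor_algebra R H H\<^esub> comult H y"
      using xy tensor_algebra_mult[OF k_algebra_axioms k_algebra_axioms d_closed d_closed]
      by (simp add: comult_eq)
  next
    have "comult H \<one>\<^bsub>H\<^esub> = tens R H H [(\<one>\<^bsub>H\<^esub>, \<one>\<^bsub>H\<^esub>)]"
      unfolding comult_eq[OF A.one_closed]
      by (rule T.tens_eqI[OF R.field_axioms sep sep])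
        (use d_closed[OF A.one_closed] conv_one linear_closed[OF \<Phi>_dual] in auto)
    then show "comult H \<one>\<^bsub>H\<^esub> = \<one>\<^bsub>tensor_algebra R H H\<^esub>"
      by (simp add: tensor_algebra_simps tens_def)
  qed
  then show ?thesis using lin by (simp add: alg_hom_def)
qed

lemma antipode_axioms:
  assumes c: "x \<in> carrier H"
  shows "tensor_lift R H H H (mult H) (tensor_map R H H H H (antipode H) id (comult H x)) =
      counit H x \<odot>\<^bsub>H\<^esub> \<one>\<^bsub>H\<^esub>"
    and "tensor_lift R H H H (mult H) (tensor_map R H H H H id (antipode H) (comult H x)) =
      counit H x \<odot>\<^bsub>H\<^esub> \<one>\<^bsub>H\<^esub>"
proof -
  note m = module_axioms
  have cl: "set (map (map_prod (antipode H) id) (d x)) \<subseteq> carrier H \<times> carrier H"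
    "set (map (map_prod id (antipode H)) (d x)) \<subseteq> carrier H \<times> carrier H"
    using d_closed'[OF c] linear_closed[OF antipode_lin] by auto
  show "tensor_lift R H H H (mult H) (tensor_map R H H H H (antipode H) id (comult H x)) =
      counit H x \<odot>\<^bsub>H\<^esub> \<one>\<^bsub>H\<^esub>"
    using lsum_antipode_left[OF c] tensor_map_tens[OF m m m m antipode_lin linear_id' d_closed[OF c]]
      T.lift_tens[OF m bilinear_mult cl(1)] by (simp add: lsum_map case_prod_unfold comult_eq[OF c])
  show "tensor_lift R H H H (mult H) (tensor_map R H H H H id (antipode H) (comult H x)) =
      counit H x \<odot>\<^bsub>H\<^esub> \<one>\<^bsub>H\<^esub>"
    using lsum_antipode_right[OF c] tensor_map_tens[OF m m m m linear_id' antipode_lin d_closed[OF c]]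
      T.lift_tens[OF m bilinear_mult cl(2)] by (simp add: lsum_map case_prod_unfold comult_eq[OF c])
qed

lemma is_hopf_algebra: "hopf_algebra R H"
  by (intro hopf_algebra.intro bialgebra.intro coalgebra.intro hopf_algebra_axioms.intro
      bialgebra_axioms.intro coalgebra_axioms.intro k_algebra_axioms R.field_axioms module_axioms
      comult_lin counit_dual coassociative counital comult_alg_hom counit_alg_hom antipode_lin antipode_axioms)

end


section \<open>Word functions\<close>

lemma (in ring) lsum_mult_lsum:
  assumes "\<And>x. x \<in> set xs \<Longrightarrow> f x \<in> carrier R" "\<And>y. y \<in> set ys \<Longrightarrow> g y \<in> carrier R"
  shows "lsum R f xs \<otimes> lsum R g ys = lsum R (\<lambda>x. lsum R (\<lambda>y. f x \<otimes> g y) ys) xs"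
proof -
  have "lsum R f xs \<otimes> lsum R g ys = lsum R (\<lambda>x. f x \<otimes> lsum R g ys) xs"
    by (rule lsum_rdistr) (use assms in auto)
  also have "\<dots> = lsum R (\<lambda>x. lsum R (\<lambda>y. f x \<otimes> g y) ys) xs"
    by (rule lsum_cong[OF refl], rule lsum_ldistr) (use assms in auto)
  finally show ?thesis .
qed

type_synonym ('k, 'a) letter = "nat \<times> ('a \<Rightarrow> 'k)"

locale words = k_algebra R A for R :: "('k, 'r) ring_scheme" (structure) and A :: "('k, 'a, 'm) module_scheme" (structure)
begin

text \<open>Letters range over a whole type; a letter whose second component is not a linear functional on \<open>A\<close>
  is read as the zero functional.\<close>

definition ev :: "('a \<Rightarrow> 'k) \<Rightarrow> 'a \<Rightarrow> 'k" where
  "ev l a = (if l \<in> dual R A \<and> a \<in> carrier A then l a else \<zero>)"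

lemma ev_dual: "ev l \<in> dual R A"
  by (rule linear_mapsI) (auto simp: ev_def linear_closed[of _ R A] linear_add linear_smult
    dest: linear_closed[of _ R A "scalar_algebra R"])

lemma ev_closed [simp, intro]: "ev l a \<in> carrier R"
  by (auto simp: ev_def dest: linear_closed[of _ R A "scalar_algebra R"])

lemma ev_eq: "l \<in> dual R A \<Longrightarrow> a \<in> carrier A \<Longrightarrow> ev l a = l a"
  by (simp add: ev_def)

text \<open>The recursion runs on the word alone, with \<open>hd\<close> and \<open>tl\<close>
  reading off the row; only rows as long as the word are of interest. The same device recurs in
  \<open>tww\<close>, \<open>twl\<close> and \<open>mrow\<close>.\<close>

primrec evw :: "('k, 'a) letter list \<Rightarrow> 'a list \<Rightarrow> 'k" where
  "evw [] b = \<one>"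
| "evw (x # w) b = ev (snd x) (hd b) \<otimes> evw w (tl b)"

lemma evw_closed [simp, intro]: "evw w b \<in> carrier R"
  by (induction w arbitrary: b) auto

lemma evw_append: "length a = length u \<Longrightarrow> evw (u @ v) (a @ b) = evw u a \<otimes> evw v b"
  by (induction u arbitrary: a) (auto simp: R.m_assoc length_Suc_conv)

definition evr :: "('k, 'a) letter list \<Rightarrow> 'k \<times> 'a list \<Rightarrow> 'k" where
  "evr w p = fst p \<otimes> evw w (snd p)"

definition rows :: "nat list \<Rightarrow> ('k \<times> 'a list) set" where
  "rows ns = {(c, b). c \<in> carrier R \<and> length b = length ns \<and> set b \<subseteq> carrier A}"

lemma evr_closed [simp, intro]: "p \<in> rows ns \<Longrightarrow> evr w p \<in> carrier R"
  by (auto simp: evr_def rows_def)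

text \<open>The row \<open>(c, [b\<^sub>1, \<dots>, b\<^sub>m])\<close> stands for \<open>c b\<^sub>1 \<otimes> \<dots> \<otimes> b\<^sub>m\<close>, and \<open>\<phi>\<close> is represented at \<open>ns\<close> by an element of the
  \<open>m\<close>-th tensor power of \<open>A\<close>, where \<open>m\<close> is the length of \<open>ns\<close>.\<close>

definition represents :: "(('k, 'a) letter list \<Rightarrow> 'k) \<Rightarrow> nat list \<Rightarrow> ('k \<times> 'a list) list \<Rightarrow> bool" where
  "represents \<phi> ns L \<longleftrightarrow> set L \<subseteq> rows ns \<and> (\<forall>w. map fst w = ns \<longrightarrow> \<phi> w = lsum R (evr w) L)"

definition tensorial :: "(('k, 'a) letter list \<Rightarrow> 'k) set" where
  "tensorial = {\<phi>. \<forall>ns. \<exists>L. represents \<phi> ns L}"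

definition rep :: "(('k, 'a) letter list \<Rightarrow> 'k) \<Rightarrow> nat list \<Rightarrow> ('k \<times> 'a list) list" where
  "rep \<phi> ns = (SOME L. represents \<phi> ns L)"

lemma represents_rep: "\<phi> \<in> tensorial \<Longrightarrow> represents \<phi> ns (rep \<phi> ns)"
  unfolding rep_def tensorial_def by (rule someI_ex) auto

lemma tensorialI: "(\<And>ns. represents \<phi> ns (L ns)) \<Longrightarrow> \<phi> \<in> tensorial"
  by (auto simp: tensorial_def)

lemma representsD:
  assumes "represents \<phi> ns L"
  shows "p \<in> set L \<Longrightarrow> p \<in> rows ns" and "map fst w = ns \<Longrightarrow> \<phi> w = lsum R (evr w) L"
  using assms by (auto simp: represents_def)

lemma tensorial_closed [simp, intro]: "\<phi> \<in> tensorial \<Longrightarrow> \<phi> w \<in> carrier R"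
  using representsD[OF represents_rep[of \<phi> "map fst w"]] by (auto intro!: R.lsum_closed)

text \<open>Odd letters stand for the opposite algebra of \<open>A\<close>.\<close>

definition mu :: "nat \<Rightarrow> 'a \<Rightarrow> 'a \<Rightarrow> 'a" where
  "mu n a b = (if even n then a \<otimes>\<^bsub>A\<^esub> b else b \<otimes>\<^bsub>A\<^esub> a)"

lemma mu_closed [simp, intro]: "a \<in> carrier A \<Longrightarrow> b \<in> carrier A \<Longrightarrow> mu n a b \<in> carrier A"
  by (auto simp: mu_def)

lemma mu_assoc: "a \<in> carrier A \<Longrightarrow> b \<in> carrier A \<Longrightarrow> c \<in> carrier A \<Longrightarrow> mu n (mu n a b) c = mu n a (mu n b c)"
  by (auto simp: mu_def A.m_assoc)

lemma mu_one [simp]: "a \<in> carrier A \<Longrightarrow> mu n a \<one>\<^bsub>A\<^esub> = a" "a \<in> carrier A \<Longrightarrow> mu n \<one>\<^bsub>A\<^esub> a = a"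
  by (auto simp: mu_def)

lemma mu_linear: "b \<in> carrier A \<Longrightarrow> (\<lambda>a. mu n a b) \<in> linear_maps R A A"
  "b \<in> carrier A \<Longrightarrow> (\<lambda>a. mu n b a) \<in> linear_maps R A A"
  unfolding mu_def by (cases "even n"; simp add: linear_mult_left linear_mult_right linear_id)+

section \<open>Products of word functions\<close>

definition tw :: "('a \<Rightarrow> 'a) \<Rightarrow> ('a \<Rightarrow> 'k) \<Rightarrow> 'a \<Rightarrow> 'k" where
  "tw f l = (\<lambda>a. if a \<in> carrier A then ev l (f a) else \<zero>)"

lemma ev_tw: "f \<in> linear_maps R A A \<Longrightarrow> a \<in> carrier A \<Longrightarrow> ev (tw f l) a = ev l (f a)"
proof -
  assume f: "f \<in> linear_maps R A A" and a: "a \<in> carrier A"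
  have "tw f l \<in> dual R A"
    by (rule linear_cong[OF module_axioms linear_comp[OF ev_dual f]]) (simp add: tw_def)
  then show ?thesis using a by (simp add: ev_def[of "tw f l"]) (simp add: tw_def)
qed

text \<open>The transpose of right multiplication: by \<open>evw_tww\<close>, evaluating at the
  twisted word multiplies the rows by \<open>b\<close> on the right. A word function can thus be
  multiplied by a pure tensor without choosing rows for it; \<open>twl\<close> does the same on the
  other side.\<close>

primrec tww :: "('k, 'a) letter list \<Rightarrow> 'a list \<Rightarrow> ('k, 'a) letter list" where
  "tww [] b = []"
| "tww (x # w) b = (fst x, tw (\<lambda>a. mu (fst x) a (hd b)) (snd x)) # tww w (tl b)"

primrec twl :: "('k, 'a) letter list \<Rightarrow> 'a list \<Rightarrow> ('k, 'a) letter list" where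
  "twl [] b = []"
| "twl (x # w) b = (fst x, tw (\<lambda>a. mu (fst x) (hd b) a) (snd x)) # twl w (tl b)"

primrec mrow :: "nat list \<Rightarrow> 'a list \<Rightarrow> 'a list \<Rightarrow> 'a list" where
  "mrow [] a b = []"
| "mrow (n # ns) a b = mu n (hd a) (hd b) # mrow ns (tl a) (tl b)"

lemma map_fst_tw [simp]: "map fst (tww w b) = map fst w" "map fst (twl w b) = map fst w"
  by (induction w arbitrary: b) auto

lemma length_mrow [simp]: "length (mrow ns a b) = length ns"
  by (induction ns arbitrary: a b) auto

lemma mrow_closed:
  "length a = length ns \<Longrightarrow> length b = length ns \<Longrightarrow> set a \<subseteq> carrier A \<Longrightarrow> set b \<subseteq> carrier A \<Longrightarrow>
    set (mrow ns a b) \<subseteq> carrier A"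
proof (induction ns arbitrary: a b)
  case (Cons n ns)
  then obtain x a' y b' where "a = x # a'" "b = y # b'" by (auto simp: length_Suc_conv)
  then show ?case using Cons.IH[of a' b'] Cons.prems by simp
qed simp

lemma evw_tww:
  "length a = length w \<Longrightarrow> length b = length w \<Longrightarrow> set a \<subseteq> carrier A \<Longrightarrow> set b \<subseteq> carrier A \<Longrightarrow>
    evw (tww w b) a = evw w (mrow (map fst w) a b)"
  by (induction w arbitrary: a b) (auto simp: length_Suc_conv ev_tw mu_linear)

lemma evw_twl:
  "length a = length w \<Longrightarrow> length b = length w \<Longrightarrow> set a \<subseteq> carrier A \<Longrightarrow> set b \<subseteq> carrier A \<Longrightarrow>
    evw (twl w a) b = evw w (mrow (map fst w) a b)"
  by (induction w arbitrary: a b) (auto simp: length_Suc_conv ev_tw mu_linear)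

lemma tww_append: "length a = length u \<Longrightarrow> tww (u @ v) (a @ b) = tww u a @ tww v b"
  by (induction u arbitrary: a) (auto simp: length_Suc_conv)

lemma mrow_assoc:
  "length a = length ns \<Longrightarrow> length b = length ns \<Longrightarrow> length c = length ns \<Longrightarrow>
    set a \<subseteq> carrier A \<Longrightarrow> set b \<subseteq> carrier A \<Longrightarrow> set c \<subseteq> carrier A \<Longrightarrow>
    mrow ns (mrow ns a b) c = mrow ns a (mrow ns b c)"
  by (induction ns arbitrary: a b c) (auto simp: length_Suc_conv mu_assoc)

lemma mrow_append: "length a = length ns \<Longrightarrow> length b = length ns \<Longrightarrow>
    mrow (ns @ ms) (a @ a') (b @ b') = mrow ns a b @ mrow ms a' b'"
  by (induction ns arbitrary: a b) (auto simp: length_Suc_conv)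

text \<open>Raising an index by one changes its parity, hence replaces \<open>mu\<close> by the
  opposite multiplication, and this undoes the exchange of the two factors. It is the reason why
  \<open>pS\<close> reverses products.\<close>

lemma mrow_rev:
  "length a = length ns \<Longrightarrow> length b = length ns \<Longrightarrow>
    mrow (rev (map Suc ns)) (rev b) (rev a) = rev (mrow ns a b)"
  by (induction ns arbitrary: a b) (auto simp: length_Suc_conv mrow_append mu_def)

lemma mrow_ones:
  "length a = length ns \<Longrightarrow> set a \<subseteq> carrier A \<Longrightarrow> mrow ns a (replicate (length ns) \<one>\<^bsub>A\<^esub>) = a"
  "length a = length ns \<Longrightarrow> set a \<subseteq> carrier A \<Longrightarrow> mrow ns (replicate (length ns) \<one>\<^bsub>A\<^esub>) a = a"
  by (induction ns arbitrary: a) (auto simp: length_Suc_conv)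

definition row :: "nat list \<Rightarrow> 'k \<times> 'a list \<Rightarrow> 'k \<times> 'a list \<Rightarrow> 'k \<times> 'a list" where
  "row ns p q = (fst p \<otimes> fst q, mrow ns (snd p) (snd q))"

lemma row_closed [simp, intro]: "p \<in> rows ns \<Longrightarrow> q \<in> rows ns \<Longrightarrow> row ns p q \<in> rows ns"
  unfolding rows_def row_def using mrow_closed[of "snd p" ns "snd q"] by (simp add: case_prod_unfold)

lemma evr_row_closed [simp]: "p \<in> rows ns \<Longrightarrow> q \<in> rows ns \<Longrightarrow> evr w (row ns p q) \<in> carrier R"
  by (rule evr_closed[OF row_closed])

lemma row_assoc: "p \<in> rows ns \<Longrightarrow> q \<in> rows ns \<Longrightarrow> r \<in> rows ns \<Longrightarrow>
    row ns (row ns p q) r = row ns p (row ns q r)"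
  by (auto simp: rows_def row_def mrow_assoc R.m_assoc)

lemma evr_tww: "p \<in> rows (map fst w) \<Longrightarrow> q \<in> rows (map fst w) \<Longrightarrow>
    fst q \<otimes> evr (tww w (snd q)) p = evr w (row (map fst w) p q)"
  by (auto simp: rows_def row_def evr_def evw_tww R.m_ac)

lemma evr_twl: "p \<in> rows (map fst w) \<Longrightarrow> q \<in> rows (map fst w) \<Longrightarrow>
    fst p \<otimes> evr (twl w (snd p)) q = evr w (row (map fst w) p q)"
  by (auto simp: rows_def row_def evr_def evw_twl R.m_ac)

lemma rowsD: "p \<in> rows ns \<Longrightarrow> fst p \<in> carrier R" by (auto simp: rows_def)

text \<open>The choice made by \<open>rep\<close> does not matter: \<open>pmult_right\<close> and \<open>pmult_left\<close> compute the product from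
  arbitrary rows representing one of the factors.\<close>

definition pmult :: "(('k, 'a) letter list \<Rightarrow> 'k) \<Rightarrow> (('k, 'a) letter list \<Rightarrow> 'k) \<Rightarrow> ('k, 'a) letter list \<Rightarrow> 'k" where
  "pmult \<phi> \<psi> w = lsum R (\<lambda>q. fst q \<otimes> \<phi> (tww w (snd q))) (rep \<psi> (map fst w))"

lemma lsum_tww:
  assumes L: "represents \<phi> (map fst w) L" and M: "set M \<subseteq> rows (map fst w)"
  shows "lsum R (\<lambda>q. fst q \<otimes> \<phi> (tww w (snd q))) M =
    lsum R (\<lambda>p. lsum R (\<lambda>q. evr w (row (map fst w) p q)) M) L"
proof -
  note Lr = representsD(1)[OF L]
  have Mr: "q \<in> rows (map fst w)" if "q \<in> set M" for q using M that by auto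
  have "lsum R (\<lambda>q. fst q \<otimes> \<phi> (tww w (snd q))) M =
    lsum R (\<lambda>q. lsum R (\<lambda>p. evr w (row (map fst w) p q)) L) M"
  proof (rule lsum_cong[OF refl])
    fix q assume q: "q \<in> set M"
    have "fst q \<otimes> \<phi> (tww w (snd q)) = fst q \<otimes> lsum R (evr (tww w (snd q))) L"
      using representsD(2)[OF L] by simp
    also have "\<dots> = lsum R (\<lambda>p. fst q \<otimes> evr (tww w (snd q)) p) L"
      by (rule R.lsum_ldistr) (use Lr Mr[OF q] rowsD in auto)
    also have "\<dots> = lsum R (\<lambda>p. evr w (row (map fst w) p q)) L"
      by (rule lsum_cong[OF refl], rule evr_tww) (use Lr Mr[OF q] in auto)
    finally show "fst q \<otimes> \<phi> (tww w (snd q)) = \<dots>" .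
  qed
  also have "\<dots> = lsum R (\<lambda>p. lsum R (\<lambda>q. evr w (row (map fst w) p q)) M) L"
    by (rule R.lsum_swap) (use Lr Mr in auto)
  finally show ?thesis .
qed

lemma lsum_twl:
  assumes M: "represents \<psi> (map fst w) M" and L: "set L \<subseteq> rows (map fst w)"
  shows "lsum R (\<lambda>p. fst p \<otimes> \<psi> (twl w (snd p))) L =
    lsum R (\<lambda>p. lsum R (\<lambda>q. evr w (row (map fst w) p q)) M) L"
proof (rule lsum_cong[OF refl])
  note Mr = representsD(1)[OF M]
  fix p assume p: "p \<in> set L"
  then have pr: "p \<in> rows (map fst w)" using L by auto
  have "fst p \<otimes> \<psi> (twl w (snd p)) = fst p \<otimes> lsum R (evr (twl w (snd p))) M"
    using representsD(2)[OF M] by simp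
  also have "\<dots> = lsum R (\<lambda>q. fst p \<otimes> evr (twl w (snd p)) q) M"
    by (rule R.lsum_ldistr) (use Mr pr rowsD in auto)
  also have "\<dots> = lsum R (\<lambda>q. evr w (row (map fst w) p q)) M"
    by (rule lsum_cong[OF refl], rule evr_twl) (use Mr pr in auto)
  finally show "fst p \<otimes> \<psi> (twl w (snd p)) = \<dots>" .
qed

text \<open>The rows are replaced one factor at a time: the sum with \<open>tww\<close> sees
  \<open>\<phi>\<close> only as a function and the sum with \<open>twl\<close> sees
  \<open>\<psi>\<close> only as a function, so neither depends on how that factor is
  represented.\<close>

lemma pmult_rows:
  assumes "\<phi> \<in> tensorial" "\<psi> \<in> tensorial" "represents \<phi> (map fst w) L" "represents \<psi> (map fst w) M"
  shows "pmult \<phi> \<psi> w = lsum R (\<lambda>p. lsum R (\<lambda>q. evr w (row (map fst w) p q)) M) L"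
proof -
  note r = represents_rep[OF assms(2), of "map fst w"]
  have "pmult \<phi> \<psi> w = lsum R (\<lambda>p. lsum R (\<lambda>q. evr w (row (map fst w) p q)) (rep \<psi> (map fst w))) L"
    unfolding pmult_def by (rule lsum_tww[OF assms(3)]) (use representsD(1)[OF r] in auto)
  also have "\<dots> = lsum R (\<lambda>p. fst p \<otimes> \<psi> (twl w (snd p))) L"
    by (rule lsum_twl[OF r, symmetric]) (use representsD(1)[OF assms(3)] in auto)
  also have "\<dots> = lsum R (\<lambda>p. lsum R (\<lambda>q. evr w (row (map fst w) p q)) M) L"
    by (rule lsum_twl[OF assms(4)]) (use representsD(1)[OF assms(3)] in auto)
  finally show ?thesis .
qed

lemma pmult_right:
  assumes "\<phi> \<in> tensorial" "\<psi> \<in> tensorial" "represents \<psi> (map fst w) M"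
  shows "pmult \<phi> \<psi> w = lsum R (\<lambda>q. fst q \<otimes> \<phi> (tww w (snd q))) M"
  using pmult_rows[OF assms(1,2) represents_rep[OF assms(1)] assms(3)]
    lsum_tww[where w = w and M = M, OF represents_rep[OF assms(1)]] assms(3)
  by (simp add: represents_def)

lemma pmult_left:
  assumes "\<phi> \<in> tensorial" "\<psi> \<in> tensorial" "represents \<phi> (map fst w) L"
  shows "pmult \<phi> \<psi> w = lsum R (\<lambda>p. fst p \<otimes> \<psi> (twl w (snd p))) L"
  using pmult_rows[OF assms(1,2) assms(3) represents_rep[OF assms(2)]]
    lsum_twl[where w = w and L = L, OF represents_rep[OF assms(2)]] assms(3)
  by (simp add: represents_def)

lemma represents_pmult:
  assumes "\<phi> \<in> tensorial" "\<psi> \<in> tensorial" and L: "represents \<phi> ns L" and M: "represents \<psi> ns M"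
  shows "represents (pmult \<phi> \<psi>) ns (concat (map (\<lambda>p. map (row ns p) M) L))"
  unfolding represents_def
proof (intro conjI allI impI)
  note Lr = representsD(1)[OF L] and Mr = representsD(1)[OF M]
  show "set (concat (map (\<lambda>p. map (row ns p) M) L)) \<subseteq> rows ns" using Lr Mr by auto
  fix w :: "('k, 'a) letter list" assume w: "map fst w = ns"
  show "pmult \<phi> \<psi> w = lsum R (evr w) (concat (map (\<lambda>p. map (row ns p) M) L))"
    using pmult_rows[OF assms(1,2), where w = w and L = L and M = M] L M w Lr Mr
    by (subst R.lsum_concat) (auto simp: lsum_map)
qed

lemma pmult_tensorial [simp, intro]: "\<phi> \<in> tensorial \<Longrightarrow> \<psi> \<in> tensorial \<Longrightarrow> pmult \<phi> \<psi> \<in> tensorial"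
  by (rule tensorialI, rule represents_pmult) (auto intro: represents_rep)

section \<open>The algebra of tensorial word functions\<close>

lemma represents_add:
  assumes "represents \<phi> ns L" "represents \<psi> ns M"
  shows "represents (\<lambda>w. \<phi> w \<oplus> \<psi> w) ns (L @ M)"
  unfolding represents_def
proof (intro conjI allI impI)
  fix w :: "('k, 'a) letter list" assume w: "map fst w = ns"
  show "\<phi> w \<oplus> \<psi> w = lsum R (evr w) (L @ M)"
    unfolding representsD(2)[OF assms(1) w] representsD(2)[OF assms(2) w]
    by (rule R.lsum_append[symmetric]) (use representsD(1)[OF assms(1)] representsD(1)[OF assms(2)] in \<open>auto intro!: evr_closed[of _ ns]\<close>)
qed (use assms in \<open>auto simp: represents_def\<close>)

lemma represents_smult:
  assumes "represents \<phi> ns L" "r \<in> carrier R"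
  shows "represents (\<lambda>w. r \<otimes> \<phi> w) ns (map (\<lambda>p. (r \<otimes> fst p, snd p)) L)"
  unfolding represents_def
proof (intro conjI allI impI)
  note Lr = representsD(1)[OF assms(1)]
  show "set (map (\<lambda>p. (r \<otimes> fst p, snd p)) L) \<subseteq> rows ns" using Lr assms(2) by (fastforce simp: rows_def)
  fix w :: "('k, 'a) letter list" assume w: "map fst w = ns"
  have "r \<otimes> \<phi> w = lsum R (\<lambda>p. r \<otimes> evr w p) L"
    unfolding representsD(2)[OF assms(1) w] by (rule R.lsum_ldistr) (use evr_closed[OF Lr] assms(2) in auto)
  also have "\<dots> = lsum R (evr w) (map (\<lambda>p. (r \<otimes> fst p, snd p)) L)"
    unfolding lsum_map by (rule lsum_cong[OF refl]) (use rowsD[OF Lr] assms(2) in \<open>auto simp: evr_def R.m_assoc\<close>)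
  finally show "r \<otimes> \<phi> w = \<dots>" .
qed

lemma represents_zero: "represents (\<lambda>w. \<zero>) ns []"
  by (auto simp: represents_def)

definition pone :: "('k, 'a) letter list \<Rightarrow> 'k" where
  "pone w = evw w (replicate (length w) \<one>\<^bsub>A\<^esub>)"

lemma represents_one: "represents pone ns [(\<one>, replicate (length ns) \<one>\<^bsub>A\<^esub>)]"
proof -
  have "pone w = evr w (\<one>, replicate (length ns) \<one>\<^bsub>A\<^esub>)" if "map fst w = ns" for w
    using arg_cong[OF that, of length] by (simp add: pone_def evr_def)
  then show ?thesis by (auto simp: represents_def rows_def evr_def)
qed

text \<open>Up to isomorphism, the direct product over all index lists of the tensor products of
  copies of \<open>A\<close>, where an odd index contributes the opposite algebra of
  \<open>A\<close>.\<close>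

definition PA :: "('k, ('k, 'a) letter list \<Rightarrow> 'k) module" where
  "PA = \<lparr>carrier = tensorial, mult = pmult, one = pone, zero = (\<lambda>w. \<zero>), add = (\<lambda>\<phi> \<psi> w. \<phi> w \<oplus> \<psi> w),
    smult = (\<lambda>r \<phi> w. r \<otimes> \<phi> w)\<rparr>"

lemma PA_simps [simp]:
  "carrier PA = tensorial" "mult PA = pmult" "one PA = pone" "zero PA = (\<lambda>w. \<zero>)"
  "add PA = (\<lambda>\<phi> \<psi> w. \<phi> w \<oplus> \<psi> w)" "smult PA = (\<lambda>r \<phi> w. r \<otimes> \<phi> w)"
  by (auto simp: PA_def)

lemma tensorial_ops [simp, intro]:
  "\<phi> \<in> tensorial \<Longrightarrow> \<psi> \<in> tensorial \<Longrightarrow> (\<lambda>w. \<phi> w \<oplus> \<psi> w) \<in> tensorial"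
  "r \<in> carrier R \<Longrightarrow> \<phi> \<in> tensorial \<Longrightarrow> (\<lambda>w. r \<otimes> \<phi> w) \<in> tensorial"
  "(\<lambda>w. \<zero>) \<in> tensorial" "pone \<in> tensorial"
proof -
  show "(\<lambda>w. \<phi> w \<oplus> \<psi> w) \<in> tensorial" if "\<phi> \<in> tensorial" "\<psi> \<in> tensorial"
    by (rule tensorialI) (rule represents_add[OF represents_rep[OF that(1)] represents_rep[OF that(2)]])
  show "(\<lambda>w. r \<otimes> \<phi> w) \<in> tensorial" if "r \<in> carrier R" "\<phi> \<in> tensorial"
    by (rule tensorialI) (rule represents_smult[OF represents_rep[OF that(2)] that(1)])
  show "(\<lambda>w. \<zero>) \<in> tensorial" by (rule tensorialI) (rule represents_zero)
  show "pone \<in> tensorial" by (rule tensorialI) (rule represents_one)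
qed

lemma pmult_add_left:
  assumes "\<phi> \<in> tensorial" "\<phi>' \<in> tensorial" "\<psi> \<in> tensorial"
  shows "pmult (\<lambda>w. \<phi> w \<oplus> \<phi>' w) \<psi> = (\<lambda>w. pmult \<phi> \<psi> w \<oplus> pmult \<phi>' \<psi> w)"
proof
  fix w
  note r = representsD(1)[OF represents_rep[OF assms(3)], THEN rowsD]
  show "pmult (\<lambda>w. \<phi> w \<oplus> \<phi>' w) \<psi> w = pmult \<phi> \<psi> w \<oplus> pmult \<phi>' \<psi> w"
    unfolding pmult_def using assms r
    by (subst R.lsum_add[symmetric]) (auto simp: R.r_distr intro!: lsum_cong)
qed

lemma pmult_add_right:
  assumes "\<phi> \<in> tensorial" "\<psi> \<in> tensorial" "\<psi>' \<in> tensorial"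
  shows "pmult \<phi> (\<lambda>w. \<psi> w \<oplus> \<psi>' w) = (\<lambda>w. pmult \<phi> \<psi> w \<oplus> pmult \<phi> \<psi>' w)"
proof
  fix w
  note r = representsD(1)[OF represents_rep[OF assms(1)], THEN rowsD]
  show "pmult \<phi> (\<lambda>w. \<psi> w \<oplus> \<psi>' w) w = pmult \<phi> \<psi> w \<oplus> pmult \<phi> \<psi>' w"
    using assms r by (simp add: pmult_left[OF assms(1) _ represents_rep[OF assms(1)]])
      (subst R.lsum_add[symmetric], auto simp: R.r_distr intro!: lsum_cong)
qed

lemma pmult_smult_left:
  assumes "r \<in> carrier R" "\<phi> \<in> tensorial" "\<psi> \<in> tensorial"
  shows "pmult (\<lambda>w. r \<otimes> \<phi> w) \<psi> = (\<lambda>w. r \<otimes> pmult \<phi> \<psi> w)"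
proof
  fix w
  note rr = representsD(1)[OF represents_rep[OF assms(3)], THEN rowsD]
  show "pmult (\<lambda>w. r \<otimes> \<phi> w) \<psi> w = r \<otimes> pmult \<phi> \<psi> w"
    unfolding pmult_def using assms rr
    by (subst R.lsum_ldistr) (auto simp: R.m_ac intro!: lsum_cong)
qed

lemma pmult_smult_right:
  assumes "r \<in> carrier R" "\<phi> \<in> tensorial" "\<psi> \<in> tensorial"
  shows "pmult \<phi> (\<lambda>w. r \<otimes> \<psi> w) = (\<lambda>w. r \<otimes> pmult \<phi> \<psi> w)"
proof
  fix w
  note rr = representsD(1)[OF represents_rep[OF assms(2)], THEN rowsD]
  show "pmult \<phi> (\<lambda>w. r \<otimes> \<psi> w) w = r \<otimes> pmult \<phi> \<psi> w"
    using assms rr by (simp add: pmult_left[OF assms(2) _ represents_rep[OF assms(2)]])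
      (subst R.lsum_ldistr, auto simp: R.m_ac intro!: lsum_cong)
qed

lemma pmult_assoc:
  assumes "\<phi> \<in> tensorial" "\<psi> \<in> tensorial" "\<chi> \<in> tensorial"
  shows "pmult (pmult \<phi> \<psi>) \<chi> = pmult \<phi> (pmult \<psi> \<chi>)"
proof
  fix w :: "('k, 'a) letter list"
  define ns where "ns = map fst w"
  note a = represents_rep[OF assms(1), of ns] and b = represents_rep[OF assms(2), of ns]
    and c = represents_rep[OF assms(3), of ns]
  let ?L = "rep \<phi> ns" and ?M = "rep \<psi> ns" and ?N = "rep \<chi> ns"
  note ar = representsD(1)[OF a] and br = representsD(1)[OF b] and cr = representsD(1)[OF c]
  have "pmult (pmult \<phi> \<psi>) \<chi> w = lsum R (\<lambda>p. lsum R (\<lambda>q. evr w (row ns p q)) ?N)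
      (concat (map (\<lambda>p. map (row ns p) ?M) ?L))"
    using pmult_rows[of "pmult \<phi> \<psi>" \<chi> w] represents_pmult[OF assms(1,2) a b] c assms by (simp add: ns_def)
  also have "\<dots> = lsum R (\<lambda>p. lsum R (\<lambda>q. lsum R (\<lambda>r. evr w (row ns (row ns p q) r)) ?N) ?M) ?L"
    by (subst R.lsum_concat) (use ar br cr in \<open>auto simp: lsum_map intro!: R.lsum_closed\<close>)
  also have "\<dots> = lsum R (\<lambda>p. lsum R (\<lambda>q. lsum R (\<lambda>r. evr w (row ns p (row ns q r))) ?N) ?M) ?L"
    by (intro lsum_cong refl) (use ar br cr in \<open>auto simp: row_assoc\<close>)
  also have "\<dots> = lsum R (\<lambda>p. lsum R (\<lambda>q. evr w (row ns p q)) (concat (map (\<lambda>p. map (row ns p) ?N) ?M))) ?L"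
    by (rule lsum_cong[OF refl], subst R.lsum_concat) (use ar br cr in \<open>auto simp: lsum_map\<close>)
  also have "\<dots> = pmult \<phi> (pmult \<psi> \<chi>) w"
    using pmult_rows[of \<phi> "pmult \<psi> \<chi>" w] represents_pmult[OF assms(2,3) b c] a assms by (simp add: ns_def)
  finally show "pmult (pmult \<phi> \<psi>) \<chi> w = pmult \<phi> (pmult \<psi> \<chi>) w" .
qed

lemma pmult_one:
  assumes "\<phi> \<in> tensorial"
  shows "pmult \<phi> pone = \<phi>" "pmult pone \<phi> = \<phi>"
proof -
  have o: "pone \<in> tensorial" by simp
  note a = represents_rep[OF assms] and ar = representsD(1)[OF represents_rep[OF assms]]
  define e where "e ns = (\<one>, replicate (length ns) \<one>\<^bsub>A\<^esub>)" for ns :: "nat list"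
  have e: "represents pone ns [e ns]" "e ns \<in> rows ns" for ns
    using represents_one by (auto simp: e_def rows_def)
  have row_e: "row ns p (e ns) = p" "row ns (e ns) p = p" if "p \<in> rows ns" for ns p
    using that by (auto simp: e_def row_def rows_def mrow_ones)
  have c: "evr w p \<in> carrier R" if "p \<in> set (rep \<phi> (map fst w))" for w :: "('k, 'a) letter list" and p
    by (rule evr_closed[OF ar[OF that]])
  have sum: "lsum R (evr w) (rep \<phi> (map fst w)) = \<phi> w" for w
    using representsD(2)[OF a[of "map fst w"]] by simp
  show "pmult \<phi> pone = \<phi>"
  proof
    fix w
    have "pmult \<phi> pone w = lsum R (evr w) (rep \<phi> (map fst w))"
      unfolding pmult_rows[OF assms o a e(1)]
      by (rule lsum_cong[OF refl]) (use row_e(1)[OF ar] c in simp)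
    then show "pmult \<phi> pone w = \<phi> w" by (simp only: sum)
  qed
  show "pmult pone \<phi> = \<phi>"
  proof
    fix w
    have "lsum R (\<lambda>q. evr w (row (map fst w) (e (map fst w)) q)) (rep \<phi> (map fst w)) =
      lsum R (evr w) (rep \<phi> (map fst w))"
      by (rule lsum_cong[OF refl]) (use row_e(2)[OF ar] in simp)
    then show "pmult pone \<phi> w = \<phi> w"
      unfolding pmult_rows[OF o assms e(1) a] using assms by (simp add: sum)
  qed
qed

lemma PA_algebra: "k_algebra R PA"
proof (intro k_algebra.intro k_algebra_axioms.intro)
  show "field R" by (rule R.field_axioms)
  have ab: "abelian_group PA"
  proof (rule abelian_groupI)
    fix \<phi> assume f: "\<phi> \<in> carrier PA"
    then have "(\<lambda>w. (\<ominus> \<one>) \<otimes> \<phi> w) \<in> carrier PA" "\<And>w. (\<ominus> \<one>) \<otimes> \<phi> w \<oplus> \<phi> w = \<zero>"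
      by (simp_all only: PA_simps tensorial_ops R.a_inv_closed R.one_closed)
        (simp add: R.l_minus R.l_neg)
    then show "\<exists>\<psi>\<in>carrier PA. \<psi> \<oplus>\<^bsub>PA\<^esub> \<phi> = \<zero>\<^bsub>PA\<^esub>"
      by (intro bexI[of _ "\<lambda>w. (\<ominus> \<one>) \<otimes> \<phi> w"]) (simp_all only: PA_simps)
  qed (auto simp: R.a_ac)
  show "module R PA"
    by (rule moduleI[OF R.is_cring ab]) (auto simp: R.l_distr R.r_distr R.m_assoc)
  show "ring PA"
    by (rule ringI[OF ab]) (auto intro!: monoidI simp: pmult_add_left pmult_add_right pmult_assoc pmult_one)
qed (auto simp: pmult_smult_left pmult_smult_right)

end


section \<open>The cofree Hopf algebra\<close>

text \<open>Since \<open>s\<close> reverses products, the factors from one list stand between the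
  factors from the other. The inner ones collapse to a scalar, which moves out and leaves the
  identity for the outer list. This carries the antipode axioms from two elements to their
  product.\<close>

lemma (in k_algebra) lsum_antipode_prod:
  assumes ds: "set ds \<subseteq> carrier A \<times> carrier A" and es: "set es \<subseteq> carrier A \<times> carrier A"
    and s: "\<And>x. x \<in> carrier A \<Longrightarrow> s x \<in> carrier A"
    and anti: "\<And>x y. x \<in> carrier A \<Longrightarrow> y \<in> carrier A \<Longrightarrow> s (x \<otimes>\<^bsub>A\<^esub> y) = s y \<otimes>\<^bsub>A\<^esub> s x"
    and ab: "a \<in> carrier R" "b \<in> carrier R"
  shows "lsum A (\<lambda>(y, z). s y \<otimes>\<^bsub>A\<^esub> z) ds = a \<odot>\<^bsub>A\<^esub> \<one>\<^bsub>A\<^esub> \<Longrightarrow> lsum A (\<lambda>(y, z). s y \<otimes>\<^bsub>A\<^esub> z) es = b \<odot>\<^bsub>A\<^esub> \<one>\<^bsub>A\<^esub> \<Longrightarrow>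
      lsum A (\<lambda>(y, z). s y \<otimes>\<^bsub>A\<^esub> z) (prod_list_pairs A A ds es) = (a \<otimes> b) \<odot>\<^bsub>A\<^esub> \<one>\<^bsub>A\<^esub>"
    and "lsum A (\<lambda>(y, z). y \<otimes>\<^bsub>A\<^esub> s z) ds = a \<odot>\<^bsub>A\<^esub> \<one>\<^bsub>A\<^esub> \<Longrightarrow> lsum A (\<lambda>(y, z). y \<otimes>\<^bsub>A\<^esub> s z) es = b \<odot>\<^bsub>A\<^esub> \<one>\<^bsub>A\<^esub> \<Longrightarrow>
      lsum A (\<lambda>(y, z). y \<otimes>\<^bsub>A\<^esub> s z) (prod_list_pairs A A ds es) = (a \<otimes> b) \<odot>\<^bsub>A\<^esub> \<one>\<^bsub>A\<^esub>"
proof -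
  have dsD: "fst q \<in> carrier A" "snd q \<in> carrier A" if "q \<in> set ds" for q using ds that by auto
  have esD: "fst q \<in> carrier A" "snd q \<in> carrier A" if "q \<in> set es" for q using es that by auto
  note D = dsD esD s
  show "lsum A (\<lambda>(y, z). s y \<otimes>\<^bsub>A\<^esub> z) (prod_list_pairs A A ds es) = (a \<otimes> b) \<odot>\<^bsub>A\<^esub> \<one>\<^bsub>A\<^esub>"
    if h: "lsum A (\<lambda>(y, z). s y \<otimes>\<^bsub>A\<^esub> z) ds = a \<odot>\<^bsub>A\<^esub> \<one>\<^bsub>A\<^esub>" "lsum A (\<lambda>(y, z). s y \<otimes>\<^bsub>A\<^esub> z) es = b \<odot>\<^bsub>A\<^esub> \<one>\<^bsub>A\<^esub>"
  proof -
    have "lsum A (\<lambda>(y, z). s y \<otimes>\<^bsub>A\<^esub> z) (prod_list_pairs A A ds es) =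
      lsum A (\<lambda>p. lsum A (\<lambda>q. s (fst p \<otimes>\<^bsub>A\<^esub> fst q) \<otimes>\<^bsub>A\<^esub> (snd p \<otimes>\<^bsub>A\<^esub> snd q)) es) ds"
      by (rule M.lsum_prod_list_pairs) (use D in auto)
    \<comment> \<open>The inner factors come from \<open>ds\<close>, so that sum has to be carried
      out first; in the other identity they come from \<open>es\<close> and the order is already
      right.\<close>
    also have "\<dots> = lsum A (\<lambda>q. lsum A (\<lambda>p. s (fst p \<otimes>\<^bsub>A\<^esub> fst q) \<otimes>\<^bsub>A\<^esub> (snd p \<otimes>\<^bsub>A\<^esub> snd q)) ds) es"
      by (rule M.lsum_swap) (use D in auto)
    also have "\<dots> = lsum A (\<lambda>q. a \<odot>\<^bsub>A\<^esub> (s (fst q) \<otimes>\<^bsub>A\<^esub> snd q)) es"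
    proof (rule lsum_cong[OF refl])
      fix q assume q: "q \<in> set es"
      have "lsum A (\<lambda>p. s (fst p \<otimes>\<^bsub>A\<^esub> fst q) \<otimes>\<^bsub>A\<^esub> (snd p \<otimes>\<^bsub>A\<^esub> snd q)) ds =
        lsum A (\<lambda>p. s (fst q) \<otimes>\<^bsub>A\<^esub> ((s (fst p) \<otimes>\<^bsub>A\<^esub> snd p) \<otimes>\<^bsub>A\<^esub> snd q)) ds"
        by (rule lsum_cong[OF refl]) (use D q in \<open>simp add: anti A.m_assoc\<close>)
      also have "\<dots> = s (fst q) \<otimes>\<^bsub>A\<^esub> (lsum A (\<lambda>p. s (fst p) \<otimes>\<^bsub>A\<^esub> snd p) ds \<otimes>\<^bsub>A\<^esub> snd q)"
        using D q by (simp add: A.lsum_ldistr A.lsum_rdistr)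
      also have "\<dots> = a \<odot>\<^bsub>A\<^esub> (s (fst q) \<otimes>\<^bsub>A\<^esub> snd q)"
        using D q h(1) ab by (simp add: case_prod_unfold smult_mult_left smult_mult_right)
      finally show "lsum A (\<lambda>p. s (fst p \<otimes>\<^bsub>A\<^esub> fst q) \<otimes>\<^bsub>A\<^esub> (snd p \<otimes>\<^bsub>A\<^esub> snd q)) ds = \<dots>" .
    qed
    also have "\<dots> = a \<odot>\<^bsub>A\<^esub> lsum A (\<lambda>q. s (fst q) \<otimes>\<^bsub>A\<^esub> snd q) es"
      by (rule lsum_smult[symmetric]) (use D ab in auto)
    finally show ?thesis using h(2) ab by (simp add: case_prod_unfold smult_assoc1)
  qed
  show "lsum A (\<lambda>(y, z). y \<otimes>\<^bsub>A\<^esub> s z) (prod_list_pairs A A ds es) = (a \<otimes> b) \<odot>\<^bsub>A\<^esub> \<one>\<^bsub>A\<^esub>"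
    if h: "lsum A (\<lambda>(y, z). y \<otimes>\<^bsub>A\<^esub> s z) ds = a \<odot>\<^bsub>A\<^esub> \<one>\<^bsub>A\<^esub>" "lsum A (\<lambda>(y, z). y \<otimes>\<^bsub>A\<^esub> s z) es = b \<odot>\<^bsub>A\<^esub> \<one>\<^bsub>A\<^esub>"
  proof -
    have "lsum A (\<lambda>(y, z). y \<otimes>\<^bsub>A\<^esub> s z) (prod_list_pairs A A ds es) =
      lsum A (\<lambda>p. lsum A (\<lambda>q. (fst p \<otimes>\<^bsub>A\<^esub> fst q) \<otimes>\<^bsub>A\<^esub> s (snd p \<otimes>\<^bsub>A\<^esub> snd q)) es) ds"
      by (rule M.lsum_prod_list_pairs) (use D in auto)
    also have "\<dots> = lsum A (\<lambda>p. b \<odot>\<^bsub>A\<^esub> (fst p \<otimes>\<^bsub>A\<^esub> s (snd p))) ds"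
    proof (rule lsum_cong[OF refl])
      fix p assume p: "p \<in> set ds"
      have "lsum A (\<lambda>q. (fst p \<otimes>\<^bsub>A\<^esub> fst q) \<otimes>\<^bsub>A\<^esub> s (snd p \<otimes>\<^bsub>A\<^esub> snd q)) es =
        lsum A (\<lambda>q. fst p \<otimes>\<^bsub>A\<^esub> ((fst q \<otimes>\<^bsub>A\<^esub> s (snd q)) \<otimes>\<^bsub>A\<^esub> s (snd p))) es"
        by (rule lsum_cong[OF refl]) (use D p in \<open>simp add: anti A.m_assoc\<close>)
      also have "\<dots> = fst p \<otimes>\<^bsub>A\<^esub> (lsum A (\<lambda>q. fst q \<otimes>\<^bsub>A\<^esub> s (snd q)) es \<otimes>\<^bsub>A\<^esub> s (snd p))"
        using D p by (simp add: A.lsum_ldistr A.lsum_rdistr)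
      also have "\<dots> = b \<odot>\<^bsub>A\<^esub> (fst p \<otimes>\<^bsub>A\<^esub> s (snd p))"
        using D p h(2) ab by (simp add: case_prod_unfold smult_mult_left smult_mult_right)
      finally show "lsum A (\<lambda>q. (fst p \<otimes>\<^bsub>A\<^esub> fst q) \<otimes>\<^bsub>A\<^esub> s (snd p \<otimes>\<^bsub>A\<^esub> snd q)) es = \<dots>" .
    qed
    also have "\<dots> = b \<odot>\<^bsub>A\<^esub> lsum A (\<lambda>q. fst q \<otimes>\<^bsub>A\<^esub> s (snd q)) ds"
      by (rule lsum_smult[symmetric]) (use D ab in auto)
    finally show ?thesis using h(1) ab by (simp add: case_prod_unfold smult_assoc1[symmetric] R.m_comm)
  qed
qed

section \<open>Antipode and deconcatenation on word functions\<close>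

context words
begin

definition sg :: "('k, 'a) letter list \<Rightarrow> ('k, 'a) letter list" where
  "sg w = rev (map (\<lambda>x. (Suc (fst x), snd x)) w)"

definition pS :: "(('k, 'a) letter list \<Rightarrow> 'k) \<Rightarrow> ('k, 'a) letter list \<Rightarrow> 'k" where
  "pS \<phi> w = \<phi> (sg w)"

lemma sg_simps [simp]: "sg [] = []" "sg (x # w) = sg w @ [(Suc (fst x), snd x)]"
  "sg (u @ v) = sg v @ sg u" "length (sg w) = length w" "map fst (sg w) = rev (map Suc (map fst w))"
  by (auto simp: sg_def rev_map comp_def)

lemma evw_sg: "length b = length w \<Longrightarrow> evw (sg w) b = evw w (rev b)"
proof (induction w arbitrary: b)
  case (Cons x w)
  then obtain b' z where b: "b = b' @ [z]" by (cases b rule: rev_cases) auto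
  then show ?case using Cons by (simp add: evw_append R.m_comm)
qed simp

definition rrow :: "'k \<times> 'a list \<Rightarrow> 'k \<times> 'a list" where
  "rrow p = (fst p, rev (snd p))"

lemma represents_pS:
  assumes "represents \<phi> (rev (map Suc ns)) L"
  shows "represents (pS \<phi>) ns (map rrow L)"
  unfolding represents_def
proof (intro conjI allI impI)
  note Lr = representsD(1)[OF assms]
  show "set (map rrow L) \<subseteq> rows ns" using Lr by (fastforce simp: rows_def rrow_def)
  fix w :: "('k, 'a) letter list" assume w: "map fst w = ns"
  have "pS \<phi> w = lsum R (evr (sg w)) L"
    unfolding pS_def by (rule representsD(2)[OF assms]) (simp add: w)
  also have "\<dots> = lsum R (evr w) (map rrow L)"
    unfolding lsum_map
  proof (rule lsum_cong[OF refl])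
    fix p assume "p \<in> set L"
    from Lr[OF this] have "length (snd p) = length w" using w by (auto simp: rows_def)
    then show "evr (sg w) p = evr w (rrow p)" by (simp add: evr_def rrow_def evw_sg)
  qed
  finally show "pS \<phi> w = lsum R (evr w) (map rrow L)" .
qed

lemma pS_tensorial [simp, intro]: "\<phi> \<in> tensorial \<Longrightarrow> pS \<phi> \<in> tensorial"
  by (rule tensorialI, rule represents_pS) (rule represents_rep)

lemma pS_one: "pS pone = pone"
  by (rule ext) (simp add: pS_def pone_def evw_sg)

lemma pS_mult:
  assumes "\<phi> \<in> tensorial" "\<psi> \<in> tensorial"
  shows "pS (pmult \<phi> \<psi>) = pmult (pS \<psi>) (pS \<phi>)"
proof
  fix w :: "('k, 'a) letter list"
  define ns where "ns = map fst w"
  define ms where "ms = rev (map Suc ns)"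
  have ms: "map fst (sg w) = ms" by (simp add: ms_def ns_def)
  note a = represents_rep[OF assms(1), of ms] and b = represents_rep[OF assms(2), of ms]
  note ar = representsD(1)[OF a] and br = representsD(1)[OF b]
  note ra = represents_pS[OF a[unfolded ms_def]] and rb = represents_pS[OF b[unfolded ms_def]]
  have rr: "evr (sg w) (row ms p q) = evr w (row ns (rrow q) (rrow p))" if "p \<in> rows ms" "q \<in> rows ms" for p q
  proof -
    have l: "length (snd p) = length ns" "length (snd q) = length ns" "fst p \<in> carrier R" "fst q \<in> carrier R"
      using that by (auto simp: rows_def ms_def)
    have "mrow ms (snd p) (snd q) = rev (mrow ns (rev (snd q)) (rev (snd p)))"
      using mrow_rev[of "rev (snd q)" ns "rev (snd p)"] l by (simp add: ms_def)
    then show ?thesis using l by (simp add: evr_def row_def rrow_def evw_sg ns_def R.m_comm)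
  qed
  have "pS (pmult \<phi> \<psi>) w = lsum R (\<lambda>p. lsum R (\<lambda>q. evr (sg w) (row ms p q)) (rep \<psi> ms)) (rep \<phi> ms)"
    unfolding pS_def using pmult_rows[OF assms, where w = "sg w", unfolded ms, OF a b] .
  also have "\<dots> = lsum R (\<lambda>p. lsum R (\<lambda>q. evr w (row ns (rrow q) (rrow p))) (rep \<psi> ms)) (rep \<phi> ms)"
    by (intro lsum_cong refl rr ar br)
  also have "\<dots> = lsum R (\<lambda>q. lsum R (\<lambda>p. evr w (row ns (rrow q) (rrow p))) (rep \<phi> ms)) (rep \<psi> ms)"
  proof (rule R.lsum_swap)
    fix p q assume "p \<in> set (rep \<phi> ms)" "q \<in> set (rep \<psi> ms)"
    then have "rrow p \<in> rows ns" "rrow q \<in> rows ns"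
      using representsD(1)[OF ra] representsD(1)[OF rb] by (auto simp: ms_def)
    then show "evr w (row ns (rrow q) (rrow p)) \<in> carrier R" by simp
  qed
  also have "\<dots> = pmult (pS \<psi>) (pS \<phi>) w"
    using pmult_rows[OF pS_tensorial[OF assms(2)] pS_tensorial[OF assms(1)], where w = w, folded ns_def, OF rb ra]
    by (simp add: lsum_map ms_def)
  finally show "pS (pmult \<phi> \<psi>) w = pmult (pS \<psi>) (pS \<phi>) w" .
qed

text \<open>The list represents the deconcatenation of \<open>\<phi>\<close> in the algebraic tensor
  square. For a general tensorial function no such list need exist, because one finite sum has to
  work for all \<open>u\<close> and \<open>v\<close>, of any lengths and indices.\<close>

definition splits :: "(('k, 'a) letter list \<Rightarrow> 'k) \<Rightarrow>
    ((('k, 'a) letter list \<Rightarrow> 'k) \<times> (('k, 'a) letter list \<Rightarrow> 'k)) list \<Rightarrow> bool" where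
  "splits \<phi> ds \<longleftrightarrow> (\<forall>u v. \<phi> (u @ v) = lsum R (\<lambda>(y, z). y u \<otimes> z v) ds)"

lemma splitsD: "splits \<phi> ds \<Longrightarrow> \<phi> (u @ v) = lsum R (\<lambda>p. fst p u \<otimes> snd p v) ds"
  by (simp add: splits_def case_prod_unfold)

text \<open>Deconcatenation is multiplicative because the product acts letter by letter. Rows of
  \<open>\<psi>\<close> on a concatenated index list are assembled from rows of the two factors of
  each pair in \<open>es\<close>; with these rows the product falls apart at the cut.\<close>

lemma splits_pmult:
  assumes tt: "\<phi> \<in> tensorial" "\<psi> \<in> tensorial"
    and ds: "set ds \<subseteq> tensorial \<times> tensorial" "splits \<phi> ds"
    and es: "set es \<subseteq> tensorial \<times> tensorial" "splits \<psi> es"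
  shows "splits (pmult \<phi> \<psi>) (prod_list_pairs PA PA ds es)"
  unfolding splits_def
proof (intro allI)
  fix u v :: "('k, 'a) letter list"
  have dsD: "fst q \<in> tensorial" "snd q \<in> tensorial" if "q \<in> set ds" for q using ds that by auto
  have esD: "fst q \<in> tensorial" "snd q \<in> tensorial" if "q \<in> set es" for q using es that by auto
  define ns ms where "ns = map fst u" and "ms = map fst v"
  define j :: "'k \<times> 'a list \<Rightarrow> 'k \<times> 'a list \<Rightarrow> 'k \<times> 'a list"
    where "j p q = (fst p \<otimes> fst q, snd p @ snd q)" for p q
  define M where "M = concat (map (\<lambda>e. concat (map (\<lambda>p. map (j p) (rep (snd e) ms)) (rep (fst e) ns))) es)"
  have r1: "p \<in> rows ns" if "e \<in> set es" "p \<in> set (rep (fst e) ns)" for e p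
    using representsD(1)[OF represents_rep[OF esD(1)]] that .
  have r2: "p \<in> rows ms" if "e \<in> set es" "p \<in> set (rep (snd e) ms)" for e p
    using representsD(1)[OF represents_rep[OF esD(2)]] that .
  have jr: "j p q \<in> rows (ns @ ms)" if "p \<in> rows ns" "q \<in> rows ms" for p q
    using that by (auto simp: j_def rows_def)
  have lM: "lsum R f M = lsum R (\<lambda>e. lsum R (\<lambda>p. lsum R (\<lambda>q. f (j p q)) (rep (snd e) ms)) (rep (fst e) ns)) es"
    if f: "\<And>p q. p \<in> rows ns \<Longrightarrow> q \<in> rows ms \<Longrightarrow> f (j p q) \<in> carrier R" for f
  proof -
    have "lsum R f M = lsum R (\<lambda>e. lsum R f (concat (map (\<lambda>p. map (j p) (rep (snd e) ms)) (rep (fst e) ns)))) es"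
      unfolding M_def by (rule R.lsum_concat) (use r1 r2 f in auto)
    also have "\<dots> = lsum R (\<lambda>e. lsum R (\<lambda>p. lsum R f (map (j p) (rep (snd e) ms))) (rep (fst e) ns)) es"
      by (rule lsum_cong[OF refl], rule R.lsum_concat) (use r1 r2 f in auto)
    finally show ?thesis by (simp only: lsum_map)
  qed
  have rM: "represents \<psi> (ns @ ms) M"
    unfolding represents_def
  proof (intro conjI allI impI)
    show "set M \<subseteq> rows (ns @ ms)" using r1 r2 jr by (auto simp: M_def)
    fix w :: "('k, 'a) letter list" assume w: "map fst w = ns @ ms"
    define u' v' where "u' = take (length ns) w" and "v' = drop (length ns) w"
    have w': "w = u' @ v'" "map fst u' = ns" "map fst v' = ms"
      using w by (auto simp: u'_def v'_def take_map[symmetric] drop_map[symmetric])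
    have "\<psi> w = lsum R (\<lambda>e. fst e u' \<otimes> snd e v') es" unfolding w'(1) by (rule splitsD[OF es(2)])
    also have "\<dots> = lsum R (\<lambda>e. lsum R (\<lambda>p. lsum R (\<lambda>q. evr w (j p q)) (rep (snd e) ms)) (rep (fst e) ns)) es"
    proof (rule lsum_cong[OF refl])
      fix e assume e: "e \<in> set es"
      have "fst e u' \<otimes> snd e v' = lsum R (evr u') (rep (fst e) ns) \<otimes> lsum R (evr v') (rep (snd e) ms)"
        using representsD(2)[OF represents_rep[OF esD(1)[OF e]] w'(2)]
          representsD(2)[OF represents_rep[OF esD(2)[OF e]] w'(3)] by simp
      also have "\<dots> = lsum R (\<lambda>p. lsum R (\<lambda>q. evr u' p \<otimes> evr v' q) (rep (snd e) ms)) (rep (fst e) ns)"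
        by (rule R.lsum_mult_lsum) (use evr_closed[OF r1[OF e]] evr_closed[OF r2[OF e]] in auto)
      also have "\<dots> = lsum R (\<lambda>p. lsum R (\<lambda>q. evr w (j p q)) (rep (snd e) ms)) (rep (fst e) ns)"
      proof (intro lsum_cong refl)
        fix p q assume "p \<in> set (rep (fst e) ns)" "q \<in> set (rep (snd e) ms)"
        from r1[OF e this(1)] r2[OF e this(2)] w'(2,3) show "evr u' p \<otimes> evr v' q = evr w (j p q)"
          unfolding w'(1) by (auto simp: evr_def j_def rows_def evw_append R.m_ac)
      qed
      finally show "fst e u' \<otimes> snd e v' = \<dots>" .
    qed
    also have "\<dots> = lsum R (evr w) M" by (rule lM[symmetric]) (rule evr_closed[OF jr])
    finally show "\<psi> w = lsum R (evr w) M" .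
  qed
  \<comment> \<open>By \<open>pmult_right\<close> the product may be computed from \<open>M\<close>
    instead of the rows chosen by \<open>rep\<close>; each row in \<open>M\<close> is a
    concatenation that respects the cut between \<open>u\<close> and \<open>v\<close>.\<close>
  have "pmult \<phi> \<psi> (u @ v) = lsum R (\<lambda>q. fst q \<otimes> \<phi> (tww (u @ v) (snd q))) M"
    by (rule pmult_right[OF tt]) (use rM in \<open>simp add: ns_def ms_def\<close>)
  also have "\<dots> = lsum R (\<lambda>e. lsum R (\<lambda>p. lsum R (\<lambda>q. fst (j p q) \<otimes> \<phi> (tww (u @ v) (snd (j p q))))
      (rep (snd e) ms)) (rep (fst e) ns)) es"
    by (rule lM) (use rowsD[OF jr] tt in auto)
  also have "\<dots> = lsum R (\<lambda>e. lsum R (\<lambda>d. pmult (fst d) (fst e) u \<otimes> pmult (snd d) (snd e) v) ds) es"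
  proof (rule lsum_cong[OF refl])
    fix e assume e: "e \<in> set es"
    note r1 = r1[OF e] and r2 = r2[OF e]
    have "lsum R (\<lambda>p. lsum R (\<lambda>q. fst (j p q) \<otimes> \<phi> (tww (u @ v) (snd (j p q)))) (rep (snd e) ms)) (rep (fst e) ns) =
      lsum R (\<lambda>p. lsum R (\<lambda>q. lsum R (\<lambda>d. (fst p \<otimes> fst d (tww u (snd p))) \<otimes> (fst q \<otimes> snd d (tww v (snd q)))) ds)
        (rep (snd e) ms)) (rep (fst e) ns)"
    proof (intro lsum_cong refl)
      fix p q assume "p \<in> set (rep (fst e) ns)" "q \<in> set (rep (snd e) ms)"
      note pq = r1[OF this(1)] r2[OF this(2)]
      then have pq': "fst p \<in> carrier R" "fst q \<in> carrier R" "length (snd p) = length u" by (auto simp: rows_def ns_def)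
      have "fst (j p q) \<otimes> \<phi> (tww (u @ v) (snd (j p q))) =
        (fst p \<otimes> fst q) \<otimes> lsum R (\<lambda>d. fst d (tww u (snd p)) \<otimes> snd d (tww v (snd q))) ds"
        using pq'(3) by (simp add: j_def tww_append splitsD[OF ds(2)])
      also have "\<dots> = lsum R (\<lambda>d. (fst p \<otimes> fst q) \<otimes> (fst d (tww u (snd p)) \<otimes> snd d (tww v (snd q)))) ds"
        by (rule R.lsum_ldistr) (use pq' dsD in auto)
      also have "\<dots> = lsum R (\<lambda>d. (fst p \<otimes> fst d (tww u (snd p))) \<otimes> (fst q \<otimes> snd d (tww v (snd q)))) ds"
        by (rule lsum_cong[OF refl]) (use pq' dsD in \<open>simp add: R.m_ac\<close>)
      finally show "fst (j p q) \<otimes> \<phi> (tww (u @ v) (snd (j p q))) = \<dots>" .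
    qed
    also have "\<dots> = lsum R (\<lambda>p. lsum R (\<lambda>d. lsum R (\<lambda>q. (fst p \<otimes> fst d (tww u (snd p))) \<otimes> (fst q \<otimes> snd d (tww v (snd q))))
        (rep (snd e) ms)) ds) (rep (fst e) ns)"
      by (rule lsum_cong[OF refl], rule R.lsum_swap) (use rowsD[OF r1] rowsD[OF r2] dsD in auto)
    also have "\<dots> = lsum R (\<lambda>d. lsum R (\<lambda>p. lsum R (\<lambda>q. (fst p \<otimes> fst d (tww u (snd p))) \<otimes> (fst q \<otimes> snd d (tww v (snd q))))
        (rep (snd e) ms)) (rep (fst e) ns)) ds"
      by (rule R.lsum_swap) (use rowsD[OF r1] rowsD[OF r2] dsD in \<open>auto intro!: R.lsum_closed\<close>)
    also have "\<dots> = lsum R (\<lambda>d. pmult (fst d) (fst e) u \<otimes> pmult (snd d) (snd e) v) ds"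
      unfolding pmult_def ns_def[symmetric] ms_def[symmetric]
      by (intro lsum_cong refl R.lsum_mult_lsum[symmetric]) (use rowsD[OF r1] rowsD[OF r2] dsD in auto)
    finally show "lsum R (\<lambda>p. lsum R (\<lambda>q. fst (j p q) \<otimes> \<phi> (tww (u @ v) (snd (j p q)))) (rep (snd e) ms)) (rep (fst e) ns) = \<dots>" .
  qed
  also have "\<dots> = lsum R (\<lambda>d. lsum R (\<lambda>e. pmult (fst d) (fst e) u \<otimes> pmult (snd d) (snd e) v) es) ds"
    by (rule R.lsum_swap) (use dsD esD in auto)
  also have "\<dots> = lsum R (\<lambda>(y, z). y u \<otimes> z v) (prod_list_pairs PA PA ds es)"
    using R.lsum_prod_list_pairs[of ds es "\<lambda>y z. y u \<otimes> z v" PA PA] dsD esD by simp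
  finally show "pmult \<phi> \<psi> (u @ v) = lsum R (\<lambda>(y, z). y u \<otimes> z v) (prod_list_pairs PA PA ds es)" .
qed

end

lemma lsum_structure: "zero P = zero P' \<Longrightarrow> add P = add P' \<Longrightarrow> lsum P f xs = lsum P' f xs"
  by (induction xs) auto

text \<open>Tensors depend only on carrier, addition and scalar multiplication. A comultiplication
  can therefore be defined with tensors over an auxiliary module record, before the Hopf algebra
  record that contains it exists.\<close>

lemma tens_structure:
  assumes "carrier M = carrier M'" "add M = add M'" "smult M = smult M'"
    "carrier N = carrier N'" "add N = add N'" "smult N = smult N'"
  shows "tens R M N = tens R M' N'"
proof -
  have "bilinear_relations R M N = bilinear_relations R M' N'"
    by (simp add: bilinear_relations_def assms)
  then have n: "tensor_null R M N = tensor_null R M' N'"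
    by (simp add: tensor_null_def assms)
  then have "tensor_space R M N = tensor_space R M' N'"
    by (simp add: tensor_space_def assms)
  moreover have "pure_tensor R M N = pure_tensor R M' N'"
    by (intro ext) (simp add: pure_tensor_def assms n)
  ultimately show ?thesis by (intro ext) (simp add: tens_def)
qed

section \<open>The largest stable set of word functions\<close>

context words
begin

interpretation PA: k_algebra R PA by (rule PA_algebra)

abbreviation (input) "antip \<phi> ds \<equiv>
  lsum PA (\<lambda>(y, z). pS y \<otimes>\<^bsub>PA\<^esub> z) ds = \<phi> [] \<odot>\<^bsub>PA\<^esub> \<one>\<^bsub>PA\<^esub> \<and>
  lsum PA (\<lambda>(y, z). y \<otimes>\<^bsub>PA\<^esub> pS z) ds = \<phi> [] \<odot>\<^bsub>PA\<^esub> \<one>\<^bsub>PA\<^esub>"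

text \<open>No closure under sums, scalars or products is demanded, so a union of stable sets is
  stable at once; the algebra operations on the largest one are obtained from its maximality. One
  and the same list has to split \<open>\<phi>\<close> and satisfy both antipode identities.\<close>

definition hopf_stable :: "(('k, 'a) letter list \<Rightarrow> 'k) set \<Rightarrow> bool" where
  "hopf_stable Q \<longleftrightarrow> Q \<subseteq> tensorial \<and>
    (\<forall>\<phi>\<in>Q. pS \<phi> \<in> Q \<and> (\<exists>ds. set ds \<subseteq> Q \<times> Q \<and> splits \<phi> ds \<and> antip \<phi> ds))"

definition hopf_set :: "(('k, 'a) letter list \<Rightarrow> 'k) set" where
  "hopf_set = \<Union>{Q. hopf_stable Q}"

lemma hopf_stableD:
  assumes "hopf_stable Q" "\<phi> \<in> Q"
  obtains ds where "set ds \<subseteq> Q \<times> Q" "splits \<phi> ds" "antip \<phi> ds"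
  using assms by (auto simp: hopf_stable_def)

lemma hopf_stable_hopf_set: "hopf_stable hopf_set"
  unfolding hopf_stable_def
proof (intro conjI ballI)
  show "hopf_set \<subseteq> tensorial" by (auto simp: hopf_set_def hopf_stable_def)
  fix \<phi> assume "\<phi> \<in> hopf_set"
  then obtain Q where Q: "hopf_stable Q" "\<phi> \<in> Q" by (auto simp: hopf_set_def)
  then have "Q \<subseteq> hopf_set" by (auto simp: hopf_set_def)
  show "pS \<phi> \<in> hopf_set" using Q \<open>Q \<subseteq> hopf_set\<close> by (auto simp: hopf_stable_def)
  obtain ds where "set ds \<subseteq> Q \<times> Q" "splits \<phi> ds" "antip \<phi> ds" using Q by (rule hopf_stableD)
  then show "\<exists>ds. set ds \<subseteq> hopf_set \<times> hopf_set \<and> splits \<phi> ds \<and> antip \<phi> ds"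
    using \<open>Q \<subseteq> hopf_set\<close> by (intro exI[of _ ds]) auto
qed

lemma hopf_set_tensorial [simp, intro]: "\<phi> \<in> hopf_set \<Longrightarrow> \<phi> \<in> tensorial"
  and pS_hopf_set [simp, intro]: "\<phi> \<in> hopf_set \<Longrightarrow> pS \<phi> \<in> hopf_set"
  using hopf_stable_hopf_set by (auto simp: hopf_stable_def)

text \<open>The subalgebra generated by \<open>hopf_set\<close>. It turns out to be stable, so by
  maximality it is contained in \<open>hopf_set\<close>, which is thereby a subalgebra.\<close>

inductive_set hopf_closure :: "(('k, 'a) letter list \<Rightarrow> 'k) set" where
  base: "\<phi> \<in> hopf_set \<Longrightarrow> \<phi> \<in> hopf_closure"
| zero: "\<zero>\<^bsub>PA\<^esub> \<in> hopf_closure"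
| one: "\<one>\<^bsub>PA\<^esub> \<in> hopf_closure"
| add: "\<phi> \<in> hopf_closure \<Longrightarrow> \<psi> \<in> hopf_closure \<Longrightarrow> \<phi> \<oplus>\<^bsub>PA\<^esub> \<psi> \<in> hopf_closure"
| smult: "r \<in> carrier R \<Longrightarrow> \<phi> \<in> hopf_closure \<Longrightarrow> r \<odot>\<^bsub>PA\<^esub> \<phi> \<in> hopf_closure"
| mult: "\<phi> \<in> hopf_closure \<Longrightarrow> \<psi> \<in> hopf_closure \<Longrightarrow> \<phi> \<otimes>\<^bsub>PA\<^esub> \<psi> \<in> hopf_closure"

text \<open>Makes the counit, which is evaluation at the empty word, multiplicative.\<close>

lemma pmult_nil:
  assumes "\<phi> \<in> tensorial" "\<psi> \<in> tensorial"
  shows "pmult \<phi> \<psi> [] = \<phi> [] \<otimes> \<psi> []"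
proof -
  note r = representsD(1)[OF represents_rep[OF assms(2)], THEN rowsD]
  have "\<psi> [] = lsum R (\<lambda>q. fst q) (rep \<psi> [])"
    using representsD(2)[OF represents_rep[OF assms(2)], where w = "[]"] r
    by (auto simp: evr_def intro!: lsum_cong)
  then have "\<phi> [] \<otimes> \<psi> [] = lsum R (\<lambda>q. \<phi> [] \<otimes> fst q) (rep \<psi> [])"
    using assms r by (simp add: R.lsum_ldistr)
  then show ?thesis
    unfolding pmult_def using assms r by (auto simp: R.m_comm intro!: lsum_cong)
qed

lemma hopf_closure_tensorial: "\<phi> \<in> hopf_closure \<Longrightarrow> \<phi> \<in> tensorial"
  by (induction rule: hopf_closure.induct) auto

lemma pone_append: "pone (u @ v) = pone u \<otimes> pone v"
  by (simp add: pone_def replicate_add evw_append)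

lemma hopf_closure_pS: "\<phi> \<in> hopf_closure \<Longrightarrow> pS \<phi> \<in> hopf_closure"
proof (induction rule: hopf_closure.induct)
  case (base \<phi>)
  then show ?case by (auto intro: hopf_closure.base)
next
  case zero
  have "pS \<zero>\<^bsub>PA\<^esub> = \<zero>\<^bsub>PA\<^esub>" by (auto simp: pS_def)
  then show ?case using hopf_closure.zero by simp
next
  case one
  then show ?case using hopf_closure.one by (simp add: pS_one)
next
  case (add \<phi> \<psi>)
  have "pS (\<phi> \<oplus>\<^bsub>PA\<^esub> \<psi>) = pS \<phi> \<oplus>\<^bsub>PA\<^esub> pS \<psi>" by (auto simp: pS_def)
  then show ?case using hopf_closure.add[OF add.IH] by simp
next
  case (smult r \<phi>)
  have "pS (r \<odot>\<^bsub>PA\<^esub> \<phi>) = r \<odot>\<^bsub>PA\<^esub> pS \<phi>" by (auto simp: pS_def)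
  then show ?case using hopf_closure.smult[OF smult.hyps(1) smult.IH] by simp
next
  case (mult \<phi> \<psi>)
  have "pS (\<phi> \<otimes>\<^bsub>PA\<^esub> \<psi>) = pS \<psi> \<otimes>\<^bsub>PA\<^esub> pS \<phi>" using mult.hyps by (simp add: pS_mult hopf_closure_tensorial)
  then show ?case using hopf_closure.mult[OF mult.IH(2) mult.IH(1)] by simp
qed

text \<open>Lists are concatenated for a sum, scaled in the first factor for a multiple, and
  multiplied pairwise for a product; the antipode identities follow each of these
  operations.\<close>

lemma hopf_closure_splits: "\<phi> \<in> hopf_closure \<Longrightarrow> \<exists>ds. set ds \<subseteq> hopf_closure \<times> hopf_closure \<and> splits \<phi> ds \<and> antip \<phi> ds"
proof (induction rule: hopf_closure.induct)
  case (base \<phi>)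
  obtain ds where "set ds \<subseteq> hopf_set \<times> hopf_set" "splits \<phi> ds" "antip \<phi> ds" using hopf_stable_hopf_set base by (rule hopf_stableD)
  then show ?case by (intro exI[of _ ds]) (auto intro: hopf_closure.base)
next
  case zero
  show ?case by (rule exI[of _ "[]"]) (auto simp: splits_def)
next
  case one
  show ?case
    using hopf_closure.one by (intro exI[of _ "[(pone, pone)]"])
      (auto simp: splits_def pone_append pS_one pmult_one, auto simp: pone_def)
next
  case (add \<phi> \<psi>)
  obtain ds where ds: "set ds \<subseteq> hopf_closure \<times> hopf_closure" "splits \<phi> ds" "antip \<phi> ds" using add.IH by auto
  obtain es where es: "set es \<subseteq> hopf_closure \<times> hopf_closure" "splits \<psi> es" "antip \<psi> es" using add.IH by auto
  have D: "fst p \<in> tensorial" "snd p \<in> tensorial" if "p \<in> set ds \<union> set es" for p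
    using that ds(1) es(1) hopf_closure_tensorial by auto
  have t: "\<phi> [] \<in> carrier R" "\<psi> [] \<in> carrier R" using add.hyps hopf_closure_tensorial by auto
  have "splits (\<phi> \<oplus>\<^bsub>PA\<^esub> \<psi>) (ds @ es)"
    unfolding splits_def
  proof (intro allI)
    fix u v
    show "(\<phi> \<oplus>\<^bsub>PA\<^esub> \<psi>) (u @ v) = lsum R (\<lambda>(y, z). y u \<otimes> z v) (ds @ es)"
      using splitsD[OF ds(2)] splitsD[OF es(2)] D
      by (subst R.lsum_append) (auto simp: case_prod_unfold)
  qed
  moreover have "lsum PA (\<lambda>(y, z). pS y \<otimes>\<^bsub>PA\<^esub> z) (ds @ es) = (\<phi> \<oplus>\<^bsub>PA\<^esub> \<psi>) [] \<odot>\<^bsub>PA\<^esub> \<one>\<^bsub>PA\<^esub>"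
  proof -
    have "lsum PA (\<lambda>(y, z). pS y \<otimes>\<^bsub>PA\<^esub> z) (ds @ es) =
      lsum PA (\<lambda>(y, z). pS y \<otimes>\<^bsub>PA\<^esub> z) ds \<oplus>\<^bsub>PA\<^esub> lsum PA (\<lambda>(y, z). pS y \<otimes>\<^bsub>PA\<^esub> z) es"
      by (rule PA.M.lsum_append)
        (simp only: PA_simps case_prod_beta, intro pmult_tensorial pS_tensorial D; assumption)
    then show ?thesis using ds(3) es(3) t by (simp add: R.l_distr)
  qed
  moreover have "lsum PA (\<lambda>(y, z). y \<otimes>\<^bsub>PA\<^esub> pS z) (ds @ es) = (\<phi> \<oplus>\<^bsub>PA\<^esub> \<psi>) [] \<odot>\<^bsub>PA\<^esub> \<one>\<^bsub>PA\<^esub>"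
  proof -
    have "lsum PA (\<lambda>(y, z). y \<otimes>\<^bsub>PA\<^esub> pS z) (ds @ es) =
      lsum PA (\<lambda>(y, z). y \<otimes>\<^bsub>PA\<^esub> pS z) ds \<oplus>\<^bsub>PA\<^esub> lsum PA (\<lambda>(y, z). y \<otimes>\<^bsub>PA\<^esub> pS z) es"
      by (rule PA.M.lsum_append)
        (simp only: PA_simps case_prod_beta, intro pmult_tensorial pS_tensorial D; assumption)
    then show ?thesis using ds(3) es(3) t by (simp add: R.l_distr)
  qed
  ultimately show ?case using ds es by (intro exI[of _ "ds @ es"]) auto
next
  case (smult r \<phi>)
  obtain ds where ds: "set ds \<subseteq> hopf_closure \<times> hopf_closure" "splits \<phi> ds" "antip \<phi> ds" using smult.IH by auto
  have D: "fst p \<in> tensorial" "snd p \<in> tensorial" if "p \<in> set ds" for p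
    using that ds(1) hopf_closure_tensorial by auto
  note r = smult.hyps(1)
  have t: "\<phi> [] \<in> carrier R" using smult.hyps hopf_closure_tensorial by auto
  define es where "es = map (\<lambda>p. (r \<odot>\<^bsub>PA\<^esub> fst p, snd p)) ds"
  have "splits (r \<odot>\<^bsub>PA\<^esub> \<phi>) es"
    unfolding splits_def
  proof (intro allI)
    fix u v
    have "(r \<odot>\<^bsub>PA\<^esub> \<phi>) (u @ v) = lsum R (\<lambda>p. r \<otimes> (fst p u \<otimes> snd p v)) ds"
      using D r by (simp add: splitsD[OF ds(2)] R.lsum_ldistr)
    also have "\<dots> = lsum R (\<lambda>(y, z). y u \<otimes> z v) es"
      unfolding es_def lsum_map by (rule lsum_cong[OF refl]) (use D r in \<open>simp add: R.m_assoc\<close>)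
    finally show "(r \<odot>\<^bsub>PA\<^esub> \<phi>) (u @ v) = lsum R (\<lambda>(y, z). y u \<otimes> z v) es" .
  qed
  moreover have "lsum PA (\<lambda>(y, z). pS y \<otimes>\<^bsub>PA\<^esub> z) es = (r \<odot>\<^bsub>PA\<^esub> \<phi>) [] \<odot>\<^bsub>PA\<^esub> \<one>\<^bsub>PA\<^esub>"
  proof -
    have "lsum PA (\<lambda>(y, z). pS y \<otimes>\<^bsub>PA\<^esub> z) es = lsum PA (\<lambda>p. r \<odot>\<^bsub>PA\<^esub> (pS (fst p) \<otimes>\<^bsub>PA\<^esub> snd p)) ds"
      unfolding es_def lsum_map
    proof (rule lsum_cong[OF refl])
      fix p assume "p \<in> set ds"
      have "pS (r \<odot>\<^bsub>PA\<^esub> fst p) = r \<odot>\<^bsub>PA\<^esub> pS (fst p)" by (auto simp: pS_def)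
      then show "(case (r \<odot>\<^bsub>PA\<^esub> fst p, snd p) of (y, z) \<Rightarrow> pS y \<otimes>\<^bsub>PA\<^esub> z) = r \<odot>\<^bsub>PA\<^esub> (pS (fst p) \<otimes>\<^bsub>PA\<^esub> snd p)"
        using D[OF \<open>p \<in> set ds\<close>] r PA.smult_mult_left[of r "pS (fst p)" "snd p"] by auto
    qed
    also have "\<dots> = r \<odot>\<^bsub>PA\<^esub> lsum PA (\<lambda>p. pS (fst p) \<otimes>\<^bsub>PA\<^esub> snd p) ds"
      by (rule PA.lsum_smult[symmetric]) (use D r in auto)
    finally show ?thesis using ds(3) r t by (simp add: case_prod_unfold R.m_assoc)
  qed
  moreover have "lsum PA (\<lambda>(y, z). y \<otimes>\<^bsub>PA\<^esub> pS z) es = (r \<odot>\<^bsub>PA\<^esub> \<phi>) [] \<odot>\<^bsub>PA\<^esub> \<one>\<^bsub>PA\<^esub>"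
  proof -
    have "lsum PA (\<lambda>(y, z). y \<otimes>\<^bsub>PA\<^esub> pS z) es = lsum PA (\<lambda>p. r \<odot>\<^bsub>PA\<^esub> (fst p \<otimes>\<^bsub>PA\<^esub> pS (snd p))) ds"
      unfolding es_def lsum_map
    proof (rule lsum_cong[OF refl])
      fix p assume "p \<in> set ds"
      then show "(case (r \<odot>\<^bsub>PA\<^esub> fst p, snd p) of (y, z) \<Rightarrow> y \<otimes>\<^bsub>PA\<^esub> pS z) = r \<odot>\<^bsub>PA\<^esub> (fst p \<otimes>\<^bsub>PA\<^esub> pS (snd p))"
        using D[OF \<open>p \<in> set ds\<close>] r PA.smult_mult_left[of r "fst p" "pS (snd p)"] by auto
    qed
    also have "\<dots> = r \<odot>\<^bsub>PA\<^esub> lsum PA (\<lambda>p. fst p \<otimes>\<^bsub>PA\<^esub> pS (snd p)) ds"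
      by (rule PA.lsum_smult[symmetric]) (use D r in auto)
    finally show ?thesis using ds(3) r t by (simp add: case_prod_unfold R.m_assoc)
  qed
  moreover have "set es \<subseteq> hopf_closure \<times> hopf_closure" using ds(1) hopf_closure.smult[OF r] by (auto simp: es_def)
  ultimately show ?case by blast
next
  case (mult \<phi> \<psi>)
  obtain ds where ds: "set ds \<subseteq> hopf_closure \<times> hopf_closure" "splits \<phi> ds" "antip \<phi> ds" using mult.IH by auto
  obtain es where es: "set es \<subseteq> hopf_closure \<times> hopf_closure" "splits \<psi> es" "antip \<psi> es" using mult.IH by auto
  have tt: "\<phi> \<in> tensorial" "\<psi> \<in> tensorial" using mult.hyps hopf_closure_tensorial by auto
  have dst: "set ds \<subseteq> tensorial \<times> tensorial" "set es \<subseteq> tensorial \<times> tensorial"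
    using ds es hopf_closure_tensorial by auto
  have c: "splits (\<phi> \<otimes>\<^bsub>PA\<^esub> \<psi>) (prod_list_pairs PA PA ds es)"
    using splits_pmult[OF tt dst(1) ds(2) dst(2) es(2)] by simp
  \<comment> \<open>\<open>pS\<close> reverses products and the counit values multiply by
    \<open>pmult_nil\<close>, which is the situation of \<open>lsum_antipode_prod\<close>.\<close>
  have a: "antip (\<phi> \<otimes>\<^bsub>PA\<^esub> \<psi>) (prod_list_pairs PA PA ds es)"
    using PA.lsum_antipode_prod[of ds es pS "\<phi> []" "\<psi> []"] ds(3) es(3) dst tt
    by (simp add: pS_mult pmult_nil del: PA_simps(3-6))
  have "set (prod_list_pairs PA PA ds es) \<subseteq> hopf_closure \<times> hopf_closure"
    using ds(1) es(1) by (auto simp: prod_list_pairs_def simp del: PA_simps intro!: hopf_closure.mult)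
  then show ?case using c a by blast
qed

lemma hopf_closure_subset: "hopf_closure \<subseteq> hopf_set"
proof -
  have "hopf_stable hopf_closure" using hopf_closure_tensorial hopf_closure_pS hopf_closure_splits by (auto simp: hopf_stable_def)
  then show ?thesis by (auto simp: hopf_set_def)
qed

lemma hopf_set_ops [simp, intro]:
  "(\<lambda>w. \<zero>) \<in> hopf_set" "pone \<in> hopf_set"
  "\<phi> \<in> hopf_set \<Longrightarrow> \<psi> \<in> hopf_set \<Longrightarrow> (\<lambda>w. \<phi> w \<oplus> \<psi> w) \<in> hopf_set"
  "r \<in> carrier R \<Longrightarrow> \<phi> \<in> hopf_set \<Longrightarrow> (\<lambda>w. r \<otimes> \<phi> w) \<in> hopf_set"
  "\<phi> \<in> hopf_set \<Longrightarrow> \<psi> \<in> hopf_set \<Longrightarrow> pmult \<phi> \<psi> \<in> hopf_set"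
  using hopf_closure.zero hopf_closure.one hopf_closure.add[OF hopf_closure.base hopf_closure.base] hopf_closure.smult[OF _ hopf_closure.base]
    hopf_closure.mult[OF hopf_closure.base hopf_closure.base] hopf_closure_subset by auto

section \<open>The Hopf algebra structure on the largest stable set\<close>

definition hopf_decomp :: "(('k, 'a) letter list \<Rightarrow> 'k) \<Rightarrow>
    ((('k, 'a) letter list \<Rightarrow> 'k) \<times> (('k, 'a) letter list \<Rightarrow> 'k)) list" where
  "hopf_decomp \<phi> = (SOME ds. set ds \<subseteq> hopf_set \<times> hopf_set \<and> splits \<phi> ds \<and> antip \<phi> ds)"

lemma hopf_decomp:
  assumes "\<phi> \<in> hopf_set"
  shows "set (hopf_decomp \<phi>) \<subseteq> hopf_set \<times> hopf_set" "splits \<phi> (hopf_decomp \<phi>)"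
    "lsum PA (\<lambda>(y, z). pS y \<otimes>\<^bsub>PA\<^esub> z) (hopf_decomp \<phi>) = \<phi> [] \<odot>\<^bsub>PA\<^esub> \<one>\<^bsub>PA\<^esub>"
    "lsum PA (\<lambda>(y, z). y \<otimes>\<^bsub>PA\<^esub> pS z) (hopf_decomp \<phi>) = \<phi> [] \<odot>\<^bsub>PA\<^esub> \<one>\<^bsub>PA\<^esub>"
proof -
  have "\<exists>ds. set ds \<subseteq> hopf_set \<times> hopf_set \<and> splits \<phi> ds \<and> antip \<phi> ds"
    using hopf_stableD[OF hopf_stable_hopf_set assms] by metis
  from someI_ex[OF this] show "set (hopf_decomp \<phi>) \<subseteq> hopf_set \<times> hopf_set" "splits \<phi> (hopf_decomp \<phi>)"
    "lsum PA (\<lambda>(y, z). pS y \<otimes>\<^bsub>PA\<^esub> z) (hopf_decomp \<phi>) = \<phi> [] \<odot>\<^bsub>PA\<^esub> \<one>\<^bsub>PA\<^esub>"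
    "lsum PA (\<lambda>(y, z). y \<otimes>\<^bsub>PA\<^esub> pS z) (hopf_decomp \<phi>) = \<phi> [] \<odot>\<^bsub>PA\<^esub> \<one>\<^bsub>PA\<^esub>"
    unfolding hopf_decomp_def by blast+
qed

text \<open>\<open>comult\<close> is written with tensors over \<open>PA\<close> restricted to
  \<open>hopf_set\<close>, since the record cannot mention itself; \<open>comult_HA\<close> replaces
  this by tensors over \<open>HA\<close>.\<close>

definition HA :: "('k, ('k, 'a) letter list \<Rightarrow> 'k) hopf" where
  "HA = \<lparr>carrier = hopf_set, mult = pmult, one = pone, zero = (\<lambda>w. \<zero>), add = (\<lambda>\<phi> \<psi> w. \<phi> w \<oplus> \<psi> w),
    smult = (\<lambda>r \<phi> w. r \<otimes> \<phi> w),
    comult = (\<lambda>\<phi>. tens R (PA\<lparr>carrier := hopf_set\<rparr>) (PA\<lparr>carrier := hopf_set\<rparr>) (hopf_decomp \<phi>)),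
    counit = (\<lambda>\<phi>. \<phi> []), antipode = pS\<rparr>"

lemma HA_simps [simp]:
  "carrier HA = hopf_set" "mult HA = pmult" "one HA = pone" "zero HA = (\<lambda>w. \<zero>)"
  "add HA = (\<lambda>\<phi> \<psi> w. \<phi> w \<oplus> \<psi> w)" "smult HA = (\<lambda>r \<phi> w. r \<otimes> \<phi> w)"
  "counit HA = (\<lambda>\<phi>. \<phi> [])" "antipode HA = pS"
  by (auto simp: HA_def)

lemma comult_HA: "comult HA \<phi> = tens R HA HA (hopf_decomp \<phi>)"
proof -
  have "tens R (PA\<lparr>carrier := hopf_set\<rparr>) (PA\<lparr>carrier := hopf_set\<rparr>) = tens R HA HA"
    by (rule tens_structure) auto
  then show ?thesis by (simp add: HA_def)
qed

lemma HA_algebra: "k_algebra R HA"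
proof (intro k_algebra.intro k_algebra_axioms.intro)
  show "field R" by (rule R.field_axioms)
  have ab: "abelian_group HA"
  proof (rule abelian_groupI)
    fix \<phi> assume f: "\<phi> \<in> carrier HA"
    then have "(\<lambda>w. (\<ominus> \<one>) \<otimes> \<phi> w) \<in> carrier HA" "\<And>w. (\<ominus> \<one>) \<otimes> \<phi> w \<oplus> \<phi> w = \<zero>"
      by (simp_all only: HA_simps hopf_set_ops R.a_inv_closed R.one_closed)
        (simp add: R.l_minus R.l_neg)
    then show "\<exists>\<psi>\<in>carrier HA. \<psi> \<oplus>\<^bsub>HA\<^esub> \<phi> = \<zero>\<^bsub>HA\<^esub>"
      by (intro bexI[of _ "\<lambda>w. (\<ominus> \<one>) \<otimes> \<phi> w"]) (simp_all only: HA_simps)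
  qed (auto simp: R.a_ac)
  show "module R HA"
    by (rule moduleI[OF R.is_cring ab]) (auto simp: R.l_distr R.r_distr R.m_assoc)
  show "ring HA"
    by (rule ringI[OF ab]) (auto intro!: monoidI simp: pmult_add_left pmult_add_right pmult_assoc pmult_one)
qed (auto simp: pmult_smult_left pmult_smult_right)

definition evaluations :: "((('k, 'a) letter list \<Rightarrow> 'k) \<Rightarrow> 'k) set" where
  "evaluations = range (\<lambda>w \<phi>. \<phi> w)"

lemma evaluations_separating: "separating R HA evaluations"
  unfolding separating_def evaluations_def by (auto intro!: linear_mapsI)

text \<open>The convolution of the evaluations at \<open>u\<close> and \<open>v\<close> is
  evaluation at \<open>u @ v\<close>. So coassociativity is associativity of concatenation, the
  counit laws come from the empty word, and multiplicativity is \<open>splits_pmult\<close>. The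
  antipode identities were built into the choice of \<open>hopf_decomp\<close>.\<close>

lemma HA_hopf_data: "hopf_data R HA evaluations hopf_decomp"
proof (intro hopf_data.intro HA_algebra hopf_data_axioms.intro evaluations_separating)
  interpret HA: k_algebra R HA by (rule HA_algebra)
  have conv: "lsum R (\<lambda>(y, z). \<alpha> y \<otimes> \<beta> z) (hopf_decomp \<phi>) = \<phi> (u @ v)"
    if "\<phi> \<in> hopf_set" "\<alpha> = (\<lambda>\<phi>. \<phi> u)" "\<beta> = (\<lambda>\<phi>. \<phi> v)" for \<alpha> \<beta> \<phi> u v
    using splitsD[OF hopf_decomp(2)[OF that(1)], of u v] that(2,3) by (simp add: case_prod_unfold)
  have D: "fst p \<in> hopf_set" "snd p \<in> hopf_set" if "\<phi> \<in> hopf_set" "p \<in> set (hopf_decomp \<phi>)" for p \<phi>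
    using hopf_decomp(1)[OF that(1)] that(2) by auto
  have lw: "(\<lambda>\<phi>. \<phi> w) \<in> dual R HA" for w by (auto intro!: linear_mapsI)
  show "counit HA \<in> alg_hom R HA (scalar_algebra R)"
    by (auto simp: alg_hom_def pmult_nil pone_def intro!: ring_hom_memI linear_mapsI)
  show "antipode HA \<in> linear_maps R HA HA"
    by (rule linear_mapsI) (auto simp: pS_def)
  {
    fix \<alpha> \<beta> assume "\<alpha> \<in> evaluations" "\<beta> \<in> evaluations"
    then obtain u v where uv: "\<alpha> = (\<lambda>\<phi>. \<phi> u)" "\<beta> = (\<lambda>\<phi>. \<phi> v)" by (auto simp: evaluations_def)
    note cab = conv[OF _ uv]
    show "(\<lambda>\<phi>. lsum R (\<lambda>(y, z). \<alpha> y \<otimes> \<beta> z) (hopf_decomp \<phi>)) \<in> dual R HA"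
      by (rule linear_cong[OF HA.module_axioms lw[of "u @ v"]]) (simp add: cab)
    show "lsum R (\<lambda>(u, v). \<alpha> u \<otimes> \<beta> v) (hopf_decomp \<one>\<^bsub>HA\<^esub>) = \<alpha> \<one>\<^bsub>HA\<^esub> \<otimes> \<beta> \<one>\<^bsub>HA\<^esub>"
      using cab[of pone] by (simp add: uv pone_append)
    fix \<phi> \<psi> assume "\<phi> \<in> carrier HA" "\<psi> \<in> carrier HA"
    then have f: "\<phi> \<in> hopf_set" "\<psi> \<in> hopf_set" by simp_all
    have "set (hopf_decomp \<phi>) \<subseteq> tensorial \<times> tensorial" "set (hopf_decomp \<psi>) \<subseteq> tensorial \<times> tensorial"
      using D[OF f(1)] D[OF f(2)] by auto
    then have "splits (pmult \<phi> \<psi>) (prod_list_pairs PA PA (hopf_decomp \<phi>) (hopf_decomp \<psi>))"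
      by (intro splits_pmult hopf_set_tensorial f hopf_decomp(2))
    then have "pmult \<phi> \<psi> (u @ v) = lsum R (\<lambda>(y, z). y u \<otimes> z v) (prod_list_pairs PA PA (hopf_decomp \<phi>) (hopf_decomp \<psi>))"
      by (simp add: splits_def)
    moreover have "prod_list_pairs PA PA (hopf_decomp \<phi>) (hopf_decomp \<psi>) = prod_list_pairs HA HA (hopf_decomp \<phi>) (hopf_decomp \<psi>)"
      by (simp add: prod_list_pairs_def)
    ultimately show "lsum R (\<lambda>(u, v). \<alpha> u \<otimes> \<beta> v) (hopf_decomp (\<phi> \<otimes>\<^bsub>HA\<^esub> \<psi>)) =
      lsum R (\<lambda>(u, v). \<alpha> u \<otimes> \<beta> v) (prod_list_pairs HA HA (hopf_decomp \<phi>) (hopf_decomp \<psi>))"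
      using cab[of "pmult \<phi> \<psi>"] f by (simp add: uv)
  }
  fix \<phi> assume "\<phi> \<in> carrier HA"
  then have f: "\<phi> \<in> hopf_set" by simp
  show "lsum HA (\<lambda>(y, z). antipode HA y \<otimes>\<^bsub>HA\<^esub> z) (hopf_decomp \<phi>) = counit HA \<phi> \<odot>\<^bsub>HA\<^esub> \<one>\<^bsub>HA\<^esub>"
    using hopf_decomp(3)[OF f] by (simp add: lsum_structure[of HA PA])
  show "lsum HA (\<lambda>(y, z). y \<otimes>\<^bsub>HA\<^esub> antipode HA z) (hopf_decomp \<phi>) = counit HA \<phi> \<odot>\<^bsub>HA\<^esub> \<one>\<^bsub>HA\<^esub>"
    using hopf_decomp(4)[OF f] by (simp add: lsum_structure[of HA PA])
  show "set (hopf_decomp \<phi>) \<subseteq> carrier HA \<times> carrier HA" using hopf_decomp(1)[OF f] by simp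
  show "comult HA \<phi> = tens R HA HA (hopf_decomp \<phi>)" by (rule comult_HA)
  fix \<alpha> assume a: "\<alpha> \<in> evaluations"
  then obtain u where u: "\<alpha> = (\<lambda>\<phi>. \<phi> u)" by (auto simp: evaluations_def)
  show "lsum R (\<lambda>(y, z). counit HA y \<otimes> \<alpha> z) (hopf_decomp \<phi>) = \<alpha> \<phi>"
    using splitsD[OF hopf_decomp(2)[OF f], of "[]" u] by (simp add: u case_prod_unfold)
  have "lsum R (\<lambda>(y, z). counit HA z \<otimes> \<alpha> y) (hopf_decomp \<phi>) = lsum R (\<lambda>p. fst p u \<otimes> snd p []) (hopf_decomp \<phi>)"
    by (rule lsum_cong[OF refl]) (use D[OF f] in \<open>auto simp: u case_prod_unfold R.m_comm\<close>)
  then show "lsum R (\<lambda>(y, z). counit HA z \<otimes> \<alpha> y) (hopf_decomp \<phi>) = \<alpha> \<phi>"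
    using splitsD[OF hopf_decomp(2)[OF f], of u "[]"] by (simp add: u)
  fix \<beta> \<gamma> assume "\<beta> \<in> evaluations" "\<gamma> \<in> evaluations"
  then obtain v w where vw: "\<beta> = (\<lambda>\<phi>. \<phi> v)" "\<gamma> = (\<lambda>\<phi>. \<phi> w)" by (auto simp: evaluations_def)
  have "lsum R (\<lambda>(y, z). lsum R (\<lambda>(a, b). \<alpha> a \<otimes> \<beta> b) (hopf_decomp y) \<otimes> \<gamma> z) (hopf_decomp \<phi>) =
    lsum R (\<lambda>p. fst p (u @ v) \<otimes> snd p w) (hopf_decomp \<phi>)"
    by (rule lsum_cong[OF refl]) (use D[OF f] conv[OF _ u vw(1)] vw(2) in \<open>simp add: case_prod_beta\<close>)
  also have "\<dots> = lsum R (\<lambda>p. fst p u \<otimes> snd p (v @ w)) (hopf_decomp \<phi>)"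
    using splitsD[OF hopf_decomp(2)[OF f], of "u @ v" w] splitsD[OF hopf_decomp(2)[OF f], of u "v @ w"] by simp
  also have "\<dots> = lsum R (\<lambda>(y, z). \<alpha> y \<otimes> lsum R (\<lambda>(a, b). \<beta> a \<otimes> \<gamma> b) (hopf_decomp z)) (hopf_decomp \<phi>)"
    by (rule lsum_cong[OF refl]) (use D[OF f] conv[OF _ vw] u in \<open>simp add: case_prod_beta\<close>)
  finally show "lsum R (\<lambda>(y, z). lsum R (\<lambda>(a, b). \<alpha> a \<otimes> \<beta> b) (hopf_decomp y) \<otimes> \<gamma> z) (hopf_decomp \<phi>) =
    lsum R (\<lambda>(y, z). \<alpha> y \<otimes> lsum R (\<lambda>(a, b). \<beta> a \<otimes> \<gamma> b) (hopf_decomp z)) (hopf_decomp \<phi>)" .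
qed

lemma HA_hopf: "hopf_algebra R HA"
  by (rule hopf_data.is_hopf_algebra[OF HA_hopf_data])

text \<open>On words with a single letter of index 0, a tensorial function is given by an element of
  the first tensor power, that is of \<open>A\<close>; as functionals separate \<open>A\<close>, it
  is unique.\<close>

definition proj :: "(('k, 'a) letter list \<Rightarrow> 'k) \<Rightarrow> 'a" where
  "proj \<phi> = (THE a. a \<in> carrier A \<and> (\<forall>l\<in>dual R A. l a = \<phi> [(0, l)]))"

lemma proj_eqI:
  assumes "a \<in> carrier A" "\<And>l. l \<in> dual R A \<Longrightarrow> l a = \<phi> [(0, l)]"
  shows "proj \<phi> = a"
  unfolding proj_def
proof (rule the_equality)
  show "b = a" if "b \<in> carrier A \<and> (\<forall>l\<in>dual R A. l b = \<phi> [(0, l)])" for b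
    by (rule separatingD[OF module_axioms dual_separating[OF R.field_axioms module_axioms]])
      (use that assms in auto)
qed (use assms in auto)

lemma proj:
  assumes "\<phi> \<in> tensorial"
  shows "proj \<phi> \<in> carrier A" and "\<phi> [(0, l)] = ev l (proj \<phi>)"
proof -
  let ?L = "rep \<phi> [0]"
  note r = represents_rep[OF assms, of "[0]"]
  have row: "fst p \<in> carrier R" "hd (snd p) \<in> carrier A" if "p \<in> set ?L" for p
  proof -
    have "length (snd p) = 1" "set (snd p) \<subseteq> carrier A" "fst p \<in> carrier R"
      using representsD(1)[OF r that] by (auto simp: rows_def)
    then show "fst p \<in> carrier R" "hd (snd p) \<in> carrier A" by (cases "snd p"; auto)+
  qed
  \<comment> \<open>A row with coefficient c and single entry b stands for the multiple c b, so the
    rows at \<open>[0]\<close> add up to the wanted element.\<close>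
  define a where "a = lsum A (\<lambda>p. fst p \<odot>\<^bsub>A\<^esub> hd (snd p)) ?L"
  have a: "a \<in> carrier A" unfolding a_def using row by (auto intro!: M.lsum_closed)
  have eva: "ev l a = \<phi> [(0, l)]" for l
  proof -
    have "ev l a = lsum R (\<lambda>p. ev l (fst p \<odot>\<^bsub>A\<^esub> hd (snd p))) ?L"
      unfolding a_def using linear_lsum[OF module_axioms R.scalar_algebra_module ev_dual[of l], of ?L] row by simp
    also have "\<dots> = lsum R (evr [(0, l)]) ?L"
      by (rule lsum_cong[OF refl]) (use row linear_smult[OF ev_dual[of l]] in \<open>auto simp: evr_def\<close>)
    also have "\<dots> = \<phi> [(0, l)]" by (rule representsD(2)[OF r, symmetric]) simp
    finally show ?thesis .
  qed
  have "proj \<phi> = a" by (rule proj_eqI[OF a]) (use eva ev_eq a in metis)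
  then show "proj \<phi> \<in> carrier A" "\<phi> [(0, l)] = ev l (proj \<phi>)" using a eva by auto
qed

lemma pmult_letter:
  assumes "\<phi> \<in> tensorial" "\<psi> \<in> tensorial" "a \<in> carrier A" "b \<in> carrier A"
    and "\<And>l. \<phi> [(n, l)] = ev l a" "\<And>l. \<psi> [(n, l)] = ev l b"
  shows "pmult \<phi> \<psi> [(n, l)] = ev l (mu n a b)"
proof -
  have rp: "represents \<chi> [n] [(\<one>, [c])]" if "c \<in> carrier A" "\<And>l. \<chi> [(n, l)] = ev l c" for \<chi> c
    using that by (auto simp: represents_def rows_def evr_def)
  show ?thesis
    using pmult_rows[OF assms(1,2), where w = "[(n, l)]", OF _ _] rp[OF assms(3,5)] rp[OF assms(4,6)] assms(3,4)
    by (simp add: row_def evr_def)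
qed

lemma proj_alg_hom: "proj \<in> alg_hom R HA A"
proof -
  have c: "l (proj \<phi>) = \<phi> [(0, l)]" if "\<phi> \<in> hopf_set" "l \<in> dual R A" for \<phi> l
    using proj[of \<phi>] that ev_eq[of l "proj \<phi>"] by simp
  have c1: "proj \<phi> \<in> carrier A" if "\<phi> \<in> hopf_set" for \<phi> using proj(1) that by auto
  have "proj (\<lambda>w. \<phi> w \<oplus> \<psi> w) = proj \<phi> \<oplus>\<^bsub>A\<^esub> proj \<psi>" if "\<phi> \<in> hopf_set" "\<psi> \<in> hopf_set" for \<phi> \<psi>
    by (rule proj_eqI) (use that c1 in \<open>simp_all add: linear_add c\<close>)
  moreover have "proj (\<lambda>w. r \<otimes> \<phi> w) = r \<odot>\<^bsub>A\<^esub> proj \<phi>" if "r \<in> carrier R" "\<phi> \<in> hopf_set" for r \<phi>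
    by (rule proj_eqI) (use that c1 in \<open>simp_all add: linear_smult c\<close>)
  moreover have "proj (pmult \<phi> \<psi>) = proj \<phi> \<otimes>\<^bsub>A\<^esub> proj \<psi>" if "\<phi> \<in> hopf_set" "\<psi> \<in> hopf_set" for \<phi> \<psi>
  proof (rule proj_eqI)
    have t: "\<phi> \<in> tensorial" "\<psi> \<in> tensorial" using that by auto
    show "proj \<phi> \<otimes>\<^bsub>A\<^esub> proj \<psi> \<in> carrier A" using proj(1) t by simp
    show "l (proj \<phi> \<otimes>\<^bsub>A\<^esub> proj \<psi>) = pmult \<phi> \<psi> [(0, l)]" if "l \<in> dual R A" for l
      using pmult_letter[OF t proj(1)[OF t(1)] proj(1)[OF t(2)] proj(2)[OF t(1)] proj(2)[OF t(2)]] that proj(1) t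
      by (simp add: mu_def ev_eq)
  qed
  moreover have "proj pone = \<one>\<^bsub>A\<^esub>"
    by (rule proj_eqI) (simp_all add: pone_def ev_eq, metis R.r_one ev_closed ev_eq A.one_closed)
  ultimately show ?thesis
    by (auto simp: alg_hom_def proj(1) intro!: ring_hom_memI linear_mapsI)
qed

text \<open>Products of evaluations separate the tensor square, so any list over
  \<open>hopf_set\<close> that splits \<open>\<phi>\<close> represents its comultiplication, not
  only the one chosen by \<open>hopf_decomp\<close>.\<close>

lemma HA_tens_eqI:
  assumes "set ds \<subseteq> hopf_set \<times> hopf_set" "set es \<subseteq> hopf_set \<times> hopf_set" "splits \<phi> ds" "splits \<phi> es"
  shows "tens R HA HA ds = tens R HA HA es"
proof -
  interpret HA: hopf_data R HA evaluations hopf_decomp by (rule HA_hopf_data)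
  show ?thesis
    by (rule HA.T.tens_eqI[OF R.field_axioms evaluations_separating evaluations_separating])
      (use assms in \<open>auto simp: evaluations_def splits_def\<close>)
qed

text \<open>Each application of \<open>pS\<close> raises the index of a single letter by one. Values
  on one-letter words of any index are thus governed by \<open>proj\<close> and the antipode, which
  drives the uniqueness proof.\<close>

lemma pS_pow: "\<phi> [(n, l)] = (pS ^^ n) \<phi> [(0, l)]"
proof -
  \<comment> \<open>Generalized to an arbitrary starting index for the induction.\<close>
  have "(pS ^^ n) \<phi> [(m, l)] = \<phi> [(n + m, l)]" for m
    by (induction n arbitrary: m) (auto simp: pS_def)
  from this[of 0] show ?thesis by simp
qed

end


section \<open>The universal property\<close>

locale words_map = words R A + K: hopf_algebra R K
  for R :: "('k, 'r) ring_scheme" (structure) and A :: "('k, 'a, 'm) module_scheme" (structure)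
    and K :: "('k, 'c) hopf" +
  fixes f :: "'c \<Rightarrow> 'a"
  assumes f: "f \<in> alg_hom R K A"
begin

abbreviation (input) "SA \<equiv> scalar_algebra R"
abbreviation (input) "SK \<equiv> antipode K"

lemmas sm = R.scalar_algebra_module

lemma f_linear: "f \<in> linear_maps R K A" using f by (auto simp: alg_hom_def)

lemma f_closed: "x \<in> carrier K \<Longrightarrow> f x \<in> carrier A" by (rule linear_closed[OF f_linear])

lemma f_mult: "x \<in> carrier K \<Longrightarrow> y \<in> carrier K \<Longrightarrow> f (x \<otimes>\<^bsub>K\<^esub> y) = f x \<otimes>\<^bsub>A\<^esub> f y"
  and f_one: "f \<one>\<^bsub>K\<^esub> = \<one>\<^bsub>A\<^esub>"
  using f by (auto simp: alg_hom_def ring_hom_def)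

lemma pow_linear: "(SK ^^ n) \<in> linear_maps R K K"
proof (induction n)
  case (Suc n)
  then show ?case using linear_comp[OF K.antipode_linear Suc] by (simp add: comp_def)
qed (simp add: linear_id id_def)

lemma pow_closed: "x \<in> carrier K \<Longrightarrow> (SK ^^ n) x \<in> carrier K"
  by (rule linear_closed[OF pow_linear])

definition fS :: "nat \<Rightarrow> 'c \<Rightarrow> 'a" where "fS n x = f ((SK ^^ n) x)"

lemma fS_linear: "fS n \<in> linear_maps R K A"
  unfolding fS_def[abs_def] by (rule linear_comp[OF f_linear pow_linear])

lemma fS_closed: "x \<in> carrier K \<Longrightarrow> fS n x \<in> carrier A"
  by (rule linear_closed[OF fS_linear])

text \<open>Each application of the antipode reverses the product, so its powers multiply in the
  order that \<open>mu\<close> prescribes for the parity of \<open>n\<close>.\<close>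

lemma fS_mult:
  assumes "x \<in> carrier K" "y \<in> carrier K"
  shows "fS n (x \<otimes>\<^bsub>K\<^esub> y) = mu n (fS n x) (fS n y)"
proof -
  have "(SK ^^ n) (x \<otimes>\<^bsub>K\<^esub> y) =
    (if even n then (SK ^^ n) x \<otimes>\<^bsub>K\<^esub> (SK ^^ n) y else (SK ^^ n) y \<otimes>\<^bsub>K\<^esub> (SK ^^ n) x)"
    by (induction n) (use assms pow_closed in \<open>auto simp: K.antipode_mult\<close>)
  then show ?thesis using assms pow_closed by (simp add: fS_def mu_def f_mult)
qed

lemma fS_one: "fS n \<one>\<^bsub>K\<^esub> = \<one>\<^bsub>A\<^esub>"
proof -
  have "(SK ^^ n) \<one>\<^bsub>K\<^esub> = \<one>\<^bsub>K\<^esub>" by (induction n) (auto simp: K.antipode_one)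
  then show ?thesis by (simp add: fS_def f_one)
qed

lemma fS_antipode: "fS n (SK x) = fS (Suc n) x"
  unfolding fS_def by (simp only: funpow_Suc_right comp_apply)

definition ltr :: "('k, 'a) letter \<Rightarrow> 'c \<Rightarrow> 'k" where
  "ltr l x = ev (snd l) (fS (fst l) x)"

lemma ltr_linear: "ltr l \<in> dual R K"
  unfolding ltr_def[abs_def] by (rule linear_comp[OF ev_dual fS_linear])

lemma ltr_closed [simp]: "ltr l x \<in> carrier R" by (simp add: ltr_def)

primrec gw :: "('k, 'a) letter list \<Rightarrow> 'c \<Rightarrow> 'k" where
  "gw [] x = counit K x"
| "gw (l # w) x = sw R K SA (\<lambda>y z. ltr l y \<otimes> gw w z) x"

lemma gw_linear: "gw w \<in> dual R K"
proof (induction w)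
  case Nil
  then show ?case using K.counit_linear by (simp add: linear_maps_def)
next
  case (Cons l w)
  have "sw R K SA (\<lambda>y z. ltr l y \<otimes> gw w z) \<in> dual R K"
    by (rule K.sw_linear[OF sm R.bilinear_mult_dual[OF ltr_linear Cons]])
  then show ?case by (simp add: linear_maps_def)
qed

lemma gw_closed: "x \<in> carrier K \<Longrightarrow> gw w x \<in> carrier R"
  using linear_closed[OF gw_linear] by simp

lemma sw_scale_left:
  assumes "c \<in> carrier R" "x \<in> carrier K" "\<And>y z. y \<in> carrier K \<Longrightarrow> z \<in> carrier K \<Longrightarrow> b y z \<in> carrier R"
  shows "c \<otimes> sw R K SA b x = sw R K SA (\<lambda>y z. c \<otimes> b y z) x"
proof -
  have "(\<lambda>r. c \<otimes> r) \<in> linear_maps R SA SA"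
    by (rule linear_mapsI) (use assms(1) in \<open>auto simp: R.r_distr R.m_lcomm\<close>)
  from K.sw_apply[OF sm sm this assms(2), of b] assms(3) show ?thesis by simp
qed

lemma sw_scale_right:
  assumes "c \<in> carrier R" "x \<in> carrier K" "\<And>y z. y \<in> carrier K \<Longrightarrow> z \<in> carrier K \<Longrightarrow> b y z \<in> carrier R"
  shows "sw R K SA b x \<otimes> c = sw R K SA (\<lambda>y z. b y z \<otimes> c) x"
proof -
  have "(\<lambda>r. r \<otimes> c) \<in> linear_maps R SA SA"
    by (rule linear_mapsI) (use assms(1) in \<open>auto simp: R.l_distr R.m_assoc\<close>)
  from K.sw_apply[OF sm sm this assms(2), of b] assms(3) show ?thesis by simp
qed

text \<open>By coassociativity an iterated comultiplication may be cut at any place: deconcatenating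
  the word amounts to comultiplying the element.\<close>

lemma gw_append:
  "x \<in> carrier K \<Longrightarrow> gw (u @ v) x = sw R K SA (\<lambda>y z. gw u y \<otimes> gw v z) x"
proof (induction u arbitrary: x)
  case Nil
  then show ?case using K.sw_counit_left[OF sm gw_linear Nil, of v] by simp
next
  case (Cons l u)
  have "gw ((l # u) @ v) x = sw R K SA (\<lambda>y z. ltr l y \<otimes> sw R K SA (\<lambda>a b. gw u a \<otimes> gw v b) z) x"
    using Cons.IH by (auto intro!: K.sw_cong[OF Cons.prems])
  also have "\<dots> = sw R K SA (\<lambda>y z. sw R K SA (\<lambda>a b. ltr l y \<otimes> (gw u a \<otimes> gw v b)) z) x"
    by (rule K.sw_cong[OF Cons.prems], rule sw_scale_left) (auto simp: gw_closed)
  also have "\<dots> = sw R K SA (\<lambda>y z. sw R K SA (\<lambda>a b. ltr l a \<otimes> (gw u b \<otimes> gw v z)) y) x"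
  proof (rule K.sw_coassoc[OF sm _ Cons.prems, symmetric])
    have ll: "(\<lambda>x. c \<otimes> g x) \<in> dual R K" "(\<lambda>x. g x \<otimes> c) \<in> dual R K" if "g \<in> dual R K" "c \<in> carrier R" for g c
      using linear_smult_const[OF sm that] linear_closed[OF that(1)] that
      by (auto simp: R.m_comm intro: linear_cong[OF K.module_axioms])
    show "trilinear R K K K SA (\<lambda>a b z. ltr l a \<otimes> (gw u b \<otimes> gw v z))"
      unfolding trilinear_def by (intro conjI ballI ll ltr_linear gw_linear ltr_closed gw_closed R.m_closed; assumption)
  qed
  also have "\<dots> = sw R K SA (\<lambda>y z. gw (l # u) y \<otimes> gw v z) x"
  proof (rule K.sw_cong[OF Cons.prems])
    fix y z assume "y \<in> carrier K" "z \<in> carrier K"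
    then show "sw R K SA (\<lambda>a b. ltr l a \<otimes> (gw u b \<otimes> gw v z)) y = gw (l # u) y \<otimes> gw v z"
      by (subst gw.simps, subst sw_scale_right) (auto simp: gw_closed R.m_assoc intro!: K.sw_cong)
  qed
  finally show ?case .
qed

section \<open>The map into word functions induced by an algebra map\<close>

definition coext :: "'c \<Rightarrow> ('k, 'a) letter list \<Rightarrow> 'k" where
  "coext x w = gw w x"

lemma coext_letter: "x \<in> carrier K \<Longrightarrow> coext x [(n, l)] = ev l (fS n x)"
  using K.sw_counit_right[OF sm ltr_linear[of "(n, l)"], of x] ltr_closed
  by (simp add: coext_def, subst K.sw_cong[where b' = "\<lambda>y z. counit K z \<otimes> ltr (n, l) y"])
    (auto simp: R.m_comm K.counit_closed ltr_def)

text \<open>Rows for a longer index list arise by putting the image of the first Sweedler factor in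
  front of the rows of the second. The quantifier over \<open>x\<close> belongs to the induction
  because those second factors vary.\<close>

lemma coext_represents: "\<forall>x\<in>carrier K. \<exists>L. represents (coext x) ns L"
proof (induction ns)
  case Nil
  show ?case
  proof
    fix x assume "x \<in> carrier K"
    then have "represents (coext x) [] [(counit K x, [])]"
      by (auto simp: represents_def rows_def evr_def coext_def K.counit_closed)
    then show "\<exists>L. represents (coext x) [] L" by blast
  qed
next
  case (Cons n ns)
  then obtain Lf where Lf: "\<And>x. x \<in> carrier K \<Longrightarrow> represents (coext x) ns (Lf x)" by metis
  show ?case
  proof
    fix x assume x: "x \<in> carrier K"
    note D = K.decomp_closed'[OF x]
    define L where "L = concat (map (\<lambda>p. map (\<lambda>q. (fst q, fS n (fst p) # snd q)) (Lf (snd p))) (decomp R K x))"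
    have Lr: "q \<in> rows ns" if "p \<in> set (decomp R K x)" "q \<in> set (Lf (snd p))" for p q
      using representsD(1)[OF Lf[OF D(2)[OF that(1)]] that(2)] .
    have r: "(fst q, fS n (fst p) # snd q) \<in> rows (n # ns)"
      if "p \<in> set (decomp R K x)" "q \<in> set (Lf (snd p))" for p q
      using Lr[OF that] fS_closed[OF D(1)[OF that(1)]] by (auto simp: rows_def)
    have "represents (coext x) (n # ns) L"
      unfolding represents_def
    proof (intro conjI allI impI)
      show "set L \<subseteq> rows (n # ns)" using r by (auto simp: L_def)
      fix w :: "('k, 'a) letter list" assume "map fst w = n # ns"
      then obtain l w' where w: "w = l # w'" "fst l = n" "map fst w' = ns" by auto
      have "coext x w = lsum R (\<lambda>p. ltr l (fst p) \<otimes> gw w' (snd p)) (decomp R K x)"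
        by (simp add: coext_def w sw_def case_prod_unfold)
      also have "\<dots> = lsum R (\<lambda>p. lsum R (\<lambda>q. evr w (fst q, fS n (fst p) # snd q)) (Lf (snd p))) (decomp R K x)"
      proof (rule lsum_cong[OF refl])
        fix p assume p: "p \<in> set (decomp R K x)"
        have "gw w' (snd p) = lsum R (evr w') (Lf (snd p))"
          using representsD(2)[OF Lf[OF D(2)[OF p]] w(3)] by (simp add: coext_def)
        then have "ltr l (fst p) \<otimes> gw w' (snd p) = lsum R (\<lambda>q. ltr l (fst p) \<otimes> evr w' q) (Lf (snd p))"
          using evr_closed[OF Lr[OF p]] by (simp add: R.lsum_ldistr)
        also have "\<dots> = lsum R (\<lambda>q. evr w (fst q, fS n (fst p) # snd q)) (Lf (snd p))"
          by (rule lsum_cong[OF refl]) (use rowsD[OF Lr[OF p]] w in \<open>simp add: evr_def ltr_def R.m_lcomm\<close>)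
        finally show "ltr l (fst p) \<otimes> gw w' (snd p) = \<dots>" .
      qed
      also have "\<dots> = lsum R (evr w) L"
        unfolding L_def by (subst R.lsum_concat) (use evr_closed[OF r] in \<open>auto simp: lsum_map\<close>)
      finally show "coext x w = lsum R (evr w) L" .
    qed
    then show "\<exists>L. represents (coext x) (n # ns) L" by blast
  qed
qed

lemma coext_tensorial [simp, intro]: "x \<in> carrier K \<Longrightarrow> coext x \<in> tensorial"
  using coext_represents by (auto simp: tensorial_def)

abbreviation (input) "coext_pairs x \<equiv> map (\<lambda>p. (coext (fst p), coext (snd p))) (decomp R K x)"

lemma coext_splits: "x \<in> carrier K \<Longrightarrow> splits (coext x) (coext_pairs x)"
  by (simp add: splits_def coext_def gw_append lsum_map sw_def case_prod_unfold)

lemma coext_pairs_closed: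
  assumes x: "x \<in> carrier K"
  shows "set (coext_pairs x) \<subseteq> coext ` carrier K \<times> coext ` carrier K"
proof
  fix q assume "q \<in> set (coext_pairs x)"
  then obtain p where "p \<in> set (decomp R K x)" "q = (coext (fst p), coext (snd p))" by auto
  then show "q \<in> coext ` carrier K \<times> coext ` carrier K" using K.decomp_closed'[OF x] by simp
qed

lemma coext_pairs_tensorial: "x \<in> carrier K \<Longrightarrow> set (coext_pairs x) \<subseteq> tensorial \<times> tensorial"
  by (rule order_trans[OF coext_pairs_closed]) auto

text \<open>By \<open>sw_antipode\<close> the antipode reverses Sweedler factors. The first letter
  of the word thus reads the last factor, with one more antipode applied, which is a last letter
  with its index raised.\<close>

lemma coext_antipode: "x \<in> carrier K \<Longrightarrow> coext (SK x) = pS (coext x)"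
proof
  fix w assume "x \<in> carrier K"
  then show "coext (SK x) w = pS (coext x) w"
    unfolding coext_def pS_def
  proof (induction w arbitrary: x)
    case Nil
    then show ?case by (simp add: K.counit_antipode)
  next
    case (Cons l w)
    have b: "bilinear R K K SA (\<lambda>y z. ltr l y \<otimes> gw w z)"
      by (rule R.bilinear_mult_dual[OF ltr_linear gw_linear])
    have "gw (l # w) (SK x) = sw R K SA (\<lambda>y z. ltr l (SK z) \<otimes> gw w (SK y)) x"
      using K.sw_antipode[OF sm b Cons.prems] by simp
    also have "\<dots> = sw R K SA (\<lambda>y z. gw (sg w) y \<otimes> gw [(Suc (fst l), snd l)] z) x"
    proof (rule K.sw_cong[OF Cons.prems])
      fix y z assume yz: "y \<in> carrier K" "z \<in> carrier K"
      have "ltr l (SK z) = gw [(Suc (fst l), snd l)] z"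
        using coext_letter[OF yz(2), of "Suc (fst l)" "snd l"] by (simp add: ltr_def fS_antipode coext_def del: gw.simps)
      then show "ltr l (SK z) \<otimes> gw w (SK y) = gw (sg w) y \<otimes> gw [(Suc (fst l), snd l)] z"
        using Cons.IH[OF yz(1)] yz by (simp add: R.m_comm gw_closed del: gw.simps)
    qed
    also have "\<dots> = gw (sg (l # w)) x" using gw_append[OF Cons.prems] by simp
    finally show ?case .
  qed
qed

lemma coext_one: "coext \<one>\<^bsub>K\<^esub> = pone"
proof
  fix w
  show "coext \<one>\<^bsub>K\<^esub> w = pone w"
    unfolding coext_def
  proof (induction w)
    case Nil
    then show ?case by (simp add: K.counit_one pone_def)
  next
    case (Cons l w)
    have b: "bilinear R K K SA (\<lambda>y z. ltr l y \<otimes> gw w z)"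
      by (rule R.bilinear_mult_dual[OF ltr_linear gw_linear])
    then show ?case using K.sw_one[OF sm b] Cons by (simp add: pone_def ltr_def fS_one)
  qed
qed

text \<open>Induction on the word. Cutting off the first letter splits the left side by
  multiplicativity of the comultiplication of \<open>K\<close> and the right side by
  \<open>splits_pmult\<close>, so it remains to compare single letters, where \<open>fS_mult\<close>
  matches \<open>mu\<close>.\<close>

lemma coext_mult: "x \<in> carrier K \<Longrightarrow> y \<in> carrier K \<Longrightarrow> coext (x \<otimes>\<^bsub>K\<^esub> y) = pmult (coext x) (coext y)"
proof
  fix w assume "x \<in> carrier K" "y \<in> carrier K"
  then show "coext (x \<otimes>\<^bsub>K\<^esub> y) w = pmult (coext x) (coext y) w"
  proof (induction w arbitrary: x y)
    case Nil
    then show ?case by (simp add: pmult_nil) (simp add: coext_def K.counit_mult)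
  next
    case (Cons l w)
    note xy = Cons.prems
    have b: "bilinear R K K SA (\<lambda>y z. ltr l y \<otimes> gw w z)"
      by (rule R.bilinear_mult_dual[OF ltr_linear gw_linear])
    have "coext (x \<otimes>\<^bsub>K\<^esub> y) (l # w) = sw R K SA (\<lambda>x1 x2. sw R K SA (\<lambda>y1 y2.
        ltr l (x1 \<otimes>\<^bsub>K\<^esub> y1) \<otimes> gw w (x2 \<otimes>\<^bsub>K\<^esub> y2)) y) x"
      using K.sw_mult[OF sm b xy] by (simp add: coext_def)
    also have "\<dots> = sw R K SA (\<lambda>x1 x2. sw R K SA (\<lambda>y1 y2.
        pmult (coext x1) (coext y1) [l] \<otimes> pmult (coext x2) (coext y2) w) y) x"
    proof (intro K.sw_cong xy)
      fix x1 x2 y1 y2 assume c: "x1 \<in> carrier K" "x2 \<in> carrier K" "y1 \<in> carrier K" "y2 \<in> carrier K"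
      have "pmult (coext x1) (coext y1) [(fst l, snd l)] = ev (snd l) (mu (fst l) (fS (fst l) x1) (fS (fst l) y1))"
        by (rule pmult_letter) (use c coext_letter fS_closed in auto)
      then have "ltr l (x1 \<otimes>\<^bsub>K\<^esub> y1) = pmult (coext x1) (coext y1) [l]"
        using c by (simp add: ltr_def fS_mult)
      then show "ltr l (x1 \<otimes>\<^bsub>K\<^esub> y1) \<otimes> gw w (x2 \<otimes>\<^bsub>K\<^esub> y2) = pmult (coext x1) (coext y1) [l] \<otimes> pmult (coext x2) (coext y2) w"
        using Cons.IH[OF c(2,4)] coext_def[of "x2 \<otimes>\<^bsub>K\<^esub> y2" w] by simp
    qed
    also have "\<dots> = lsum R (\<lambda>(u, v). u [l] \<otimes> v w) (prod_list_pairs PA PA (coext_pairs x) (coext_pairs y))"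
    proof -
      have "lsum R (\<lambda>(u, v). u [l] \<otimes> v w) (prod_list_pairs PA PA (coext_pairs x) (coext_pairs y)) =
        lsum R (\<lambda>p. lsum R (\<lambda>q. (fst p \<otimes>\<^bsub>PA\<^esub> fst q) [l] \<otimes> (snd p \<otimes>\<^bsub>PA\<^esub> snd q) w) (coext_pairs y)) (coext_pairs x)"
      proof (rule R.lsum_prod_list_pairs)
        fix p q assume "p \<in> set (coext_pairs x)" "q \<in> set (coext_pairs y)"
        then have "p \<in> tensorial \<times> tensorial" "q \<in> tensorial \<times> tensorial"
          using subsetD[OF coext_pairs_tensorial[OF xy(1)]] subsetD[OF coext_pairs_tensorial[OF xy(2)]] by blast+
        then show "(fst p \<otimes>\<^bsub>PA\<^esub> fst q) [l] \<otimes> (snd p \<otimes>\<^bsub>PA\<^esub> snd q) w \<in> carrier R"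
          by (auto simp: mem_Times_iff)
      qed
      then show ?thesis by (simp add: lsum_map sw_def case_prod_unfold)
    qed
    also have "\<dots> = pmult (coext x) (coext y) ([l] @ w)"
      using splits_pmult[OF coext_tensorial[OF xy(1)] coext_tensorial[OF xy(2)] coext_pairs_tensorial[OF xy(1)] coext_splits[OF xy(1)]
          coext_pairs_tensorial[OF xy(2)] coext_splits[OF xy(2)]] unfolding splits_def by metis
    finally show ?case by simp
  qed
qed

lemma coext_linear: "coext \<in> linear_maps R K PA"
  by (rule linear_mapsI) (auto simp: coext_def linear_add[OF gw_linear] linear_smult[OF gw_linear])

text \<open>The image of \<open>K\<close> is itself stable, with lists taken from the
  comultiplication of \<open>K\<close> and antipode identities pushed forward from \<open>K\<close>;
  hence it lies in the largest stable set.\<close>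

lemma coext_hopf_set: "x \<in> carrier K \<Longrightarrow> coext x \<in> hopf_set"
proof -
  interpret PA: k_algebra R PA by (rule PA_algebra)
  have "hopf_stable (coext ` carrier K)"
    unfolding hopf_stable_def
  proof (intro conjI ballI)
    show "coext ` carrier K \<subseteq> tensorial" by auto
    fix \<phi> assume "\<phi> \<in> coext ` carrier K"
    then obtain x where x: "x \<in> carrier K" "\<phi> = coext x" by auto
    show "pS \<phi> \<in> coext ` carrier K" using x coext_antipode K.antipode_closed by (metis imageI)
    have e: "coext (counit K x \<odot>\<^bsub>K\<^esub> \<one>\<^bsub>K\<^esub>) = coext x [] \<odot>\<^bsub>PA\<^esub> \<one>\<^bsub>PA\<^esub>"
      using linear_smult[OF coext_linear K.counit_closed[OF x(1)] K.A.one_closed] by (simp add: coext_one) (simp add: coext_def)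
    have "lsum PA (\<lambda>(y, z). pS y \<otimes>\<^bsub>PA\<^esub> z) (coext_pairs x) = sw R K PA (\<lambda>y z. coext (SK y \<otimes>\<^bsub>K\<^esub> z)) x"
      unfolding sw_def lsum_map
      by (rule lsum_cong[OF refl]) (use K.decomp_closed'[OF x(1)] K.antipode_closed in \<open>auto simp: coext_mult coext_antipode\<close>)
    also have "\<dots> = coext (sw R K K (\<lambda>y z. SK y \<otimes>\<^bsub>K\<^esub> z) x)"
      by (rule K.sw_apply[OF K.module_axioms PA.module_axioms coext_linear x(1), symmetric]) (use K.antipode_closed in auto)
    finally have 1: "lsum PA (\<lambda>(y, z). pS y \<otimes>\<^bsub>PA\<^esub> z) (coext_pairs x) = coext x [] \<odot>\<^bsub>PA\<^esub> \<one>\<^bsub>PA\<^esub>"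
      using e x(1) by (simp only: K.sw_antipode_left)
    have "lsum PA (\<lambda>(y, z). y \<otimes>\<^bsub>PA\<^esub> pS z) (coext_pairs x) = sw R K PA (\<lambda>y z. coext (y \<otimes>\<^bsub>K\<^esub> SK z)) x"
      unfolding sw_def lsum_map
      by (rule lsum_cong[OF refl]) (use K.decomp_closed'[OF x(1)] K.antipode_closed in \<open>auto simp: coext_mult coext_antipode\<close>)
    also have "\<dots> = coext (sw R K K (\<lambda>y z. y \<otimes>\<^bsub>K\<^esub> SK z) x)"
      by (rule K.sw_apply[OF K.module_axioms PA.module_axioms coext_linear x(1), symmetric]) (use K.antipode_closed in auto)
    finally have 2: "lsum PA (\<lambda>(y, z). y \<otimes>\<^bsub>PA\<^esub> pS z) (coext_pairs x) = coext x [] \<odot>\<^bsub>PA\<^esub> \<one>\<^bsub>PA\<^esub>"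
      using e x(1) by (simp only: K.sw_antipode_right)
    show "\<exists>ds. set ds \<subseteq> coext ` carrier K \<times> coext ` carrier K \<and> splits \<phi> ds \<and>
        lsum PA (\<lambda>(y, z). pS y \<otimes>\<^bsub>PA\<^esub> z) ds = \<phi> [] \<odot>\<^bsub>PA\<^esub> \<one>\<^bsub>PA\<^esub> \<and>
        lsum PA (\<lambda>(y, z). y \<otimes>\<^bsub>PA\<^esub> pS z) ds = \<phi> [] \<odot>\<^bsub>PA\<^esub> \<one>\<^bsub>PA\<^esub>"
      using coext_pairs_closed[OF x(1)] coext_splits[OF x(1)] 1 2 unfolding x(2) by blast
  qed
  then show "coext x \<in> hopf_set" if "x \<in> carrier K"
    using that unfolding hopf_set_def by blast
qed

section \<open>Existence and uniqueness of the lift\<close>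

lemma coext_hom: "restrict coext (carrier K) \<in> hopf_hom R K HA"
proof -
  interpret HA: hopf_data R HA evaluations hopf_decomp by (rule HA_hopf_data)
  let ?g = "restrict coext (carrier K)"
  have lin: "?g \<in> linear_maps R K HA"
    by (rule linear_mapsI) (auto simp: coext_hopf_set linear_add[OF coext_linear] linear_smult[OF coext_linear])
  have "?g \<in> alg_hom R K HA"
    using lin by (auto simp: alg_hom_def coext_hopf_set coext_mult coext_one linear_add[OF coext_linear] intro!: ring_hom_memI)
  moreover have "comult HA (?g x) = tensor_map R K K HA HA ?g ?g (comult K x)" if x: "x \<in> carrier K" for x
  proof -
    have "tensor_map R K K HA HA ?g ?g (comult K x) = tens R HA HA (map (map_prod ?g ?g) (decomp R K x))"
      unfolding K.comult_decomp[OF x]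
      by (rule tensor_map_tens[OF K.module_axioms K.module_axioms HA.module_axioms HA.module_axioms lin lin K.decomp_closed[OF x]])
    also have "map (map_prod ?g ?g) (decomp R K x) = coext_pairs x"
      using K.decomp_closed'[OF x] by auto
    \<comment> \<open>The lists differ in general, but both split the same function and so represent
      the same tensor.\<close>
    also have "tens R HA HA (coext_pairs x) = comult HA (?g x)"
      unfolding comult_HA using x hopf_decomp[OF coext_hopf_set[OF x]] coext_splits[OF x] coext_pairs_closed[OF x] coext_hopf_set
      by (simp only: restrict_apply if_True) (rule HA_tens_eqI, auto)
    finally show ?thesis by (rule sym)
  qed
  ultimately show ?thesis
    by (auto simp: hopf_hom_def coext_antipode K.antipode_closed) (simp add: coext_def)
qed

lemma proj_coext: "x \<in> carrier K \<Longrightarrow> proj (coext x) = f x"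
  by (rule proj_eqI) (auto simp: coext_letter fS_def f_closed ev_eq)

text \<open>Compatibility with comultiplication reduces the value on a word to values on its
  letters, compatibility with the antipode reduces a letter to index 0, and there the projection to
  \<open>A\<close> decides.\<close>

lemma hom_unique:
  assumes h: "h \<in> hopf_hom R K HA" and p: "\<And>x. x \<in> carrier K \<Longrightarrow> proj (h x) = f x"
    and x: "x \<in> carrier K"
  shows "h x = coext x"
proof
  interpret HA: hopf_data R HA evaluations hopf_decomp by (rule HA_hopf_data)
  have lin: "h \<in> linear_maps R K HA" using h by (auto simp: hopf_hom_def alg_hom_def)
  have hc: "h x \<in> hopf_set" if "x \<in> carrier K" for x using linear_closed[OF lin that] by simp
  have co: "comult HA (h x) = tensor_map R K K HA HA h h (comult K x)"
    and cu: "h x [] = counit K x" and an: "pS (h x) = h (SK x)" if "x \<in> carrier K" for x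
    using h that by (auto simp: hopf_hom_def)
  \<comment> \<open>The compatibility is an equality of tensors; evaluation at \<open>u\<close> in
    the first and \<open>v\<close> in the second factor turns it into one of scalars, and the list
    on the left splits \<open>h x\<close>.\<close>
  have app: "h x (u @ v) = lsum R (\<lambda>p. h (fst p) u \<otimes> h (snd p) v) (decomp R K x)" if x: "x \<in> carrier K" for x u v
  proof -
    let ?ds = "map (map_prod h h) (decomp R K x)"
    have ds: "set ?ds \<subseteq> hopf_set \<times> hopf_set" using K.decomp_closed'[OF x] hc by auto
    have "tens R HA HA (hopf_decomp (h x)) = tens R HA HA ?ds"
      using co[OF x] unfolding comult_HA K.comult_decomp[OF x]
      by (simp add: tensor_map_tens[OF K.module_axioms K.module_axioms HA.module_axioms HA.module_axioms lin lin K.decomp_closed[OF x]])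
    moreover have "(\<lambda>\<phi>. \<phi> u) \<in> evaluations" "(\<lambda>\<phi>. \<phi> v) \<in> evaluations" by (auto simp: evaluations_def)
    ultimately have "lsum SA (\<lambda>(y, z). y u \<otimes> z v) (hopf_decomp (h x)) = lsum SA (\<lambda>(y, z). y u \<otimes> z v) ?ds"
      using HA.T.tens_eqD[OF sm HA.\<Phi>_bilinear, of "\<lambda>\<phi>. \<phi> u" "\<lambda>\<phi>. \<phi> v" "hopf_decomp (h x)" ?ds] hopf_decomp(1)[OF hc[OF x]] ds by simp
    then show ?thesis
      using splitsD[OF hopf_decomp(2)[OF hc[OF x]]] by (simp add: lsum_map case_prod_unfold)
  qed
  \<comment> \<open>Index 0 is settled by \<open>p\<close>; commuting with the antipode gives every
    other index.\<close>
  have letter: "h x [(n, l)] = ev l (fS n x)" if x: "x \<in> carrier K" for x n l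
  proof -
    have "(pS ^^ n) (h x) = h ((SK ^^ n) x)"
      by (induction n) (auto simp: an pow_closed x)
    then show ?thesis
      using pS_pow[of "h x" n l] proj(2)[OF hopf_set_tensorial[OF hc[OF pow_closed[OF x]]], of n l]
        p[OF pow_closed[OF x, of n]] by (simp add: fS_def)
  qed
  fix w
  show "h x w = coext x w"
    using x
  proof (induction w arbitrary: x)
    case Nil
    then show ?case by (simp add: cu coext_def)
  next
    case (Cons l w)
    have "h x ([l] @ w) = lsum R (\<lambda>p. h (fst p) [l] \<otimes> h (snd p) w) (decomp R K x)"
      by (rule app[OF Cons.prems])
    also have "\<dots> = lsum R (\<lambda>p. ltr l (fst p) \<otimes> gw w (snd p)) (decomp R K x)"
      by (rule lsum_cong[OF refl])
        (use K.decomp_closed'[OF Cons.prems] Cons.IH letter[of _ "fst l" "snd l"] in \<open>simp add: ltr_def coext_def\<close>)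
    finally show ?case by (simp add: coext_def sw_def case_prod_unfold)
  qed
qed

end

lemma (in words) HA_cofree: "cofree_hopf_algebra TYPE('c) R A HA proj"
  unfolding cofree_hopf_algebra_def
proof (intro conjI allI impI HA_hopf proj_alg_hom)
  fix K :: "('k, 'c) hopf" and f assume *: "hopf_algebra R K \<and> f \<in> alg_hom R K A"
  then interpret K: hopf_algebra R K by simp
  interpret words_map R A K f using * by unfold_locales simp
  show "\<exists>!g. g \<in> hopf_hom R K HA \<and> g \<in> extensional (carrier K) \<and> (\<forall>x\<in>carrier K. proj (g x) = f x)"
  proof (rule ex1I[of _ "restrict coext (carrier K)"])
    show "restrict coext (carrier K) \<in> hopf_hom R K HA \<and> restrict coext (carrier K) \<in> extensional (carrier K) \<and>
      (\<forall>x\<in>carrier K. proj (restrict coext (carrier K) x) = f x)"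
      using coext_hom proj_coext by auto
    fix h assume h: "h \<in> hopf_hom R K HA \<and> h \<in> extensional (carrier K) \<and> (\<forall>x\<in>carrier K. proj (h x) = f x)"
    show "h = restrict coext (carrier K)"
      by (rule extensionalityI[of _ "carrier K"]) (use h hom_unique in auto)
  qed
qed


section \<open>Independence of the carrier type\<close>

lemma alg_homD:
  assumes "f \<in> alg_hom R K L"
  shows "f \<in> linear_maps R K L" "f \<in> ring_hom K L" "x \<in> carrier K \<Longrightarrow> f x \<in> carrier L"
  using assms by (auto simp: alg_hom_def dest: linear_closed)

lemma alg_hom_comp:
  assumes "g \<in> alg_hom R K H" "h \<in> alg_hom R H L"
  shows "(\<lambda>x. h (g x)) \<in> alg_hom R K L"
  using linear_comp[OF alg_homD(1)[OF assms(2)] alg_homD(1)[OF assms(1)]]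
    ring_hom_trans[OF alg_homD(2)[OF assms(1)] alg_homD(2)[OF assms(2)]]
  by (simp add: alg_hom_def comp_def)

lemma alg_hom_cong:
  assumes "k_algebra R K" "f \<in> alg_hom R K L" "\<And>x. x \<in> carrier K \<Longrightarrow> g x = f x"
  shows "g \<in> alg_hom R K L"
proof -
  interpret K: k_algebra R K by fact
  have "g \<in> linear_maps R K L"
    by (rule linear_cong[OF K.module_axioms alg_homD(1)[OF assms(2)] assms(3)])
  moreover have "g \<in> ring_hom K L"
    using alg_homD(2)[OF assms(2)] assms(3) by (auto simp: ring_hom_def)
  ultimately show ?thesis by (simp add: alg_hom_def)
qed

lemma hopf_homD:
  assumes "f \<in> hopf_hom R K L"
  shows "f \<in> alg_hom R K L" "f \<in> linear_maps R K L"
    "x \<in> carrier K \<Longrightarrow> f x \<in> carrier L"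
    "x \<in> carrier K \<Longrightarrow> comult L (f x) = tensor_map R K K L L f f (comult K x)"
    "x \<in> carrier K \<Longrightarrow> counit L (f x) = counit K x"
    "x \<in> carrier K \<Longrightarrow> antipode L (f x) = f (antipode K x)"
  using assms by (auto simp: hopf_hom_def dest: alg_homD)

lemma hopf_hom_comp:
  assumes K: "hopf_algebra R K" and H: "hopf_algebra R H" and L: "hopf_algebra R L"
    and g: "g \<in> hopf_hom R K H" and h: "h \<in> hopf_hom R H L"
  shows "(\<lambda>x. h (g x)) \<in> hopf_hom R K L"
proof -
  interpret K: hopf_algebra R K by fact
  interpret H: hopf_algebra R H by fact
  interpret L: hopf_algebra R L by fact
  note gD = hopf_homD[OF g] and hD = hopf_homD[OF h]
  have "comult L (h (g x)) = tensor_map R K K L L (\<lambda>x. h (g x)) (\<lambda>x. h (g x)) (comult K x)" if x: "x \<in> carrier K" for x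
  proof -
    note dx = K.decomp_closed[OF x]
    have cl: "set (map (map_prod g g) (decomp R K x)) \<subseteq> carrier H \<times> carrier H"
      using K.decomp_closed'[OF x] gD(3) by auto
    note mK = K.module_axioms and mH = H.module_axioms and mL = L.module_axioms
    show ?thesis
      unfolding hD(4)[OF gD(3)[OF x]] gD(4)[OF x] K.comult_decomp[OF x]
        tensor_map_tens[OF mK mK mH mH gD(2) gD(2) dx] tensor_map_tens[OF mH mH mL mL hD(2) hD(2) cl]
        tensor_map_tens[OF mK mK mL mL linear_comp[OF hD(2) gD(2)] linear_comp[OF hD(2) gD(2)] dx]
      by (simp add: map_prod_def case_prod_unfold comp_def)
  qed
  then show ?thesis
    using alg_hom_comp[OF gD(1) hD(1)] gD hD by (simp add: hopf_hom_def K.antipode_closed)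
qed

text \<open>The tensor map only sees values on the carrier. Applied to restrictions, which the
  extensionality clause of the universal property calls for.\<close>

lemma hopf_hom_cong:
  assumes K: "hopf_algebra R K" and L: "hopf_algebra R L"
    and f: "f \<in> hopf_hom R K L" and eq: "\<And>x. x \<in> carrier K \<Longrightarrow> g x = f x"
  shows "g \<in> hopf_hom R K L"
proof -
  interpret K: hopf_algebra R K by fact
  interpret L: hopf_algebra R L by fact
  note fD = hopf_homD[OF f]
  have gl: "g \<in> alg_hom R K L" by (rule alg_hom_cong[OF K.k_algebra_axioms fD(1) eq])
  have "tensor_map R K K L L g g (comult K x) = tensor_map R K K L L f f (comult K x)" if x: "x \<in> carrier K" for x
  proof -
    note mK = K.module_axioms and mL = L.module_axioms
    have "map (map_prod g g) (decomp R K x) = map (map_prod f f) (decomp R K x)"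
      using K.decomp_closed'[OF x] eq by auto
    then show ?thesis
      unfolding K.comult_decomp[OF x] tensor_map_tens[OF mK mK mL mL fD(2) fD(2) K.decomp_closed[OF x]]
        tensor_map_tens[OF mK mK mL mL alg_homD(1)[OF gl] alg_homD(1)[OF gl] K.decomp_closed[OF x]] by (simp only:)
  qed
  then show ?thesis using gl fD eq by (simp add: hopf_hom_def K.antipode_closed)
qed

lemma hopf_hom_id:
  assumes "hopf_algebra R K"
  shows "(\<lambda>x. x) \<in> hopf_hom R K K"
proof -
  interpret K: hopf_algebra R K by fact
  have "tensor_map R K K K K (\<lambda>x. x) (\<lambda>x. x) (comult K x) = comult K x" if "x \<in> carrier K" for x
    using tensor_map_tens[OF K.module_axioms K.module_axioms K.module_axioms K.module_axioms
        linear_id linear_id K.decomp_closed[OF that]]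
    by (simp add: K.comult_decomp[OF that] map_prod_def)
  then show ?thesis by (auto simp: hopf_hom_def alg_hom_def linear_id intro: ring_hom_memI)
qed

text \<open>Frees the uniqueness clause from extensionality by restricting both maps to the carrier
  of \<open>K\<close>.\<close>

lemma cofree_hopf_algebra_unique:
  assumes "cofree_hopf_algebra TYPE('c) R A H p" "hopf_algebra R (K :: ('k, 'c) hopf)" "f \<in> alg_hom R K A"
    and "g \<in> hopf_hom R K H" "\<And>x. x \<in> carrier K \<Longrightarrow> p (g x) = f x"
    and "h \<in> hopf_hom R K H" "\<And>x. x \<in> carrier K \<Longrightarrow> p (h x) = f x"
    and x: "x \<in> carrier K"
  shows "g x = h x"
proof -
  have H: "hopf_algebra R H" using assms(1) by (simp add: cofree_hopf_algebra_def)
  have ex1: "\<exists>!g. g \<in> hopf_hom R K H \<and> g \<in> extensional (carrier K) \<and> (\<forall>x\<in>carrier K. p (g x) = f x)"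
    using assms(1-3) by (simp add: cofree_hopf_algebra_def)
  have r: "restrict g (carrier K) \<in> hopf_hom R K H" "restrict h (carrier K) \<in> hopf_hom R K H"
    by (rule hopf_hom_cong[OF assms(2) H assms(4)], simp) (rule hopf_hom_cong[OF assms(2) H assms(6)], simp)
  have q: "\<And>x. x \<in> carrier K \<Longrightarrow> p (restrict g (carrier K) x) = f x" "\<And>x. x \<in> carrier K \<Longrightarrow> p (restrict h (carrier K) x) = f x"
    using assms(5,7) by simp_all
  have "restrict g (carrier K) = restrict h (carrier K)"
    by (rule ex1E[OF ex1]) (use r q restrict_extensional in metis)
  from fun_cong[OF this, of x] show ?thesis using x by simp
qed

text \<open>Existence: follow the lift to \<open>H\<close> by \<open>u\<close>. Uniqueness: a lift
  \<open>h\<close> to \<open>H'\<close> followed by \<open>v\<close> is a lift to \<open>H\<close>,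
  hence equals \<open>g\<close>, and \<open>uv\<close> recovers \<open>h\<close> from it.\<close>

lemma cofree_hopf_algebra_transfer:
  fixes H :: "('k, 'h) hopf" and H' :: "('k, 'i) hopf"
  assumes H: "cofree_hopf_algebra TYPE('c) R A H p"
    and H': "hopf_algebra R H'" and p': "p' \<in> alg_hom R H' A"
    and u: "u \<in> hopf_hom R H H'" and v: "v \<in> hopf_hom R H' H"
    and uv: "\<And>x. x \<in> carrier H' \<Longrightarrow> u (v x) = x"
    and pu: "\<And>x. x \<in> carrier H \<Longrightarrow> p' (u x) = p x"
  shows "cofree_hopf_algebra TYPE('c) R A H' p'"
  unfolding cofree_hopf_algebra_def
proof (intro conjI allI impI H' p')
  fix K :: "('k, 'c) hopf" and f assume *: "hopf_algebra R K \<and> f \<in> alg_hom R K A"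
  have Hh: "hopf_algebra R H" using H by (simp add: cofree_hopf_algebra_def)
  have "\<exists>!g. g \<in> hopf_hom R K H \<and> g \<in> extensional (carrier K) \<and> (\<forall>x\<in>carrier K. p (g x) = f x)"
    using H * by (simp add: cofree_hopf_algebra_def)
  then obtain g where g: "g \<in> hopf_hom R K H" "\<forall>x\<in>carrier K. p (g x) = f x"
    and uniq: "\<And>h. h \<in> hopf_hom R K H \<Longrightarrow> h \<in> extensional (carrier K) \<Longrightarrow> \<forall>x\<in>carrier K. p (h x) = f x \<Longrightarrow> h = g"
    by (elim ex1E) blast
  have gc: "g x \<in> carrier H" if "x \<in> carrier K" for x using hopf_homD(3)[OF g(1)] that .
  show "\<exists>!g. g \<in> hopf_hom R K H' \<and> g \<in> extensional (carrier K) \<and> (\<forall>x\<in>carrier K. p' (g x) = f x)"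
  proof (rule ex1I[of _ "restrict (\<lambda>x. u (g x)) (carrier K)"], intro conjI ballI)
    show "restrict (\<lambda>x. u (g x)) (carrier K) \<in> hopf_hom R K H'"
      by (rule hopf_hom_cong[OF _ H' hopf_hom_comp[OF _ Hh H' g(1) u]]) (use * in auto)
    show "p' (restrict (\<lambda>x. u (g x)) (carrier K) x) = f x" if "x \<in> carrier K" for x
      using that g pu gc by simp
    fix h assume h: "h \<in> hopf_hom R K H' \<and> h \<in> extensional (carrier K) \<and> (\<forall>x\<in>carrier K. p' (h x) = f x)"
    have hc: "h x \<in> carrier H'" if "x \<in> carrier K" for x using hopf_homD(3)[OF conjunct1[OF h] that] .
    have "restrict (\<lambda>x. v (h x)) (carrier K) = g"
    proof (rule uniq)
      show "restrict (\<lambda>x. v (h x)) (carrier K) \<in> hopf_hom R K H"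
        by (rule hopf_hom_cong[OF _ Hh hopf_hom_comp[OF _ H' Hh _ v]]) (use * h in auto)
      \<comment> \<open>\<open>v\<close> is a map over \<open>A\<close> as well:
        \<open>p (v y)\<close> equals \<open>p' (u (v y))\<close> by \<open>pu\<close>, and this is
        \<open>p' y\<close> by \<open>uv\<close>.\<close>
      show "\<forall>x\<in>carrier K. p (restrict (\<lambda>x. v (h x)) (carrier K) x) = f x"
        using pu[OF hopf_homD(3)[OF v]] uv hc h by auto
    qed auto
    then have vh: "v (h x) = g x" if "x \<in> carrier K" for x using that by (metis restrict_apply')
    show "h = restrict (\<lambda>x. u (g x)) (carrier K)"
      by (rule extensionalityI[of _ "carrier K"]) (use h hc uv vh in \<open>auto simp: vh[symmetric]\<close>)
  qed simp
qed

section \<open>Transport of a Hopf algebra along an injection\<close>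

locale hopf_transport = H: hopf_algebra R H
  for R :: "('k, 'r) ring_scheme" (structure) and H :: "('k, 'a) hopf" (structure) +
  fixes j :: "'a \<Rightarrow> 'b"
  assumes inj: "inj_on j (carrier H)"
begin

definition i :: "'b \<Rightarrow> 'a" where "i = inv_into (carrier H) j"

lemma ij [simp]: "x \<in> carrier H \<Longrightarrow> i (j x) = x"
  unfolding i_def by (rule inv_into_f_f[OF inj])

definition td :: "'b \<Rightarrow> ('b \<times> 'b) list" where
  "td y = map (map_prod j j) (decomp R H (i y))"

definition M' :: "('k, 'b) module" where
  "M' = \<lparr>carrier = j ` carrier H, mult = (\<lambda>x y. j (i x \<otimes>\<^bsub>H\<^esub> i y)), one = j \<one>\<^bsub>H\<^esub>, zero = j \<zero>\<^bsub>H\<^esub>,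
    add = (\<lambda>x y. j (i x \<oplus>\<^bsub>H\<^esub> i y)), smult = (\<lambda>r x. j (r \<odot>\<^bsub>H\<^esub> i x))\<rparr>"

text \<open>The tensors in \<open>comult\<close> are taken over \<open>M'\<close>, which carries the
  same module structure, because the record cannot refer to itself; \<open>comult_H'\<close> removes
  the detour.\<close>

definition H' :: "('k, 'b) hopf" where
  "H' = \<lparr>carrier = carrier M', mult = mult M', one = one M', zero = zero M', add = add M', smult = smult M',
    comult = (\<lambda>y. tens R M' M' (td y)), counit = (\<lambda>y. counit H (i y)), antipode = (\<lambda>y. j (antipode H (i y)))\<rparr>"

lemma H'_simps:
  "carrier H' = j ` carrier H" "mult H' = (\<lambda>x y. j (i x \<otimes>\<^bsub>H\<^esub> i y))" "one H' = j \<one>\<^bsub>H\<^esub>" "zero H' = j \<zero>\<^bsub>H\<^esub>"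
  "add H' = (\<lambda>x y. j (i x \<oplus>\<^bsub>H\<^esub> i y))" "smult H' = (\<lambda>r x. j (r \<odot>\<^bsub>H\<^esub> i x))"
  "counit H' = (\<lambda>y. counit H (i y))" "antipode H' = (\<lambda>y. j (antipode H (i y)))"
  by (auto simp: H'_def M'_def)

lemma comult_H': "comult H' y = tens R H' H' (td y)"
proof -
  have "tens R M' M' = tens R H' H'" by (rule tens_structure) (auto simp: H'_def)
  then show ?thesis by (simp add: H'_def)
qed

lemma H'_algebra: "k_algebra R H'"
proof (intro k_algebra.intro k_algebra_axioms.intro)
  show "field R" by (rule H.R.field_axioms)
  have ab: "abelian_group H'"
  proof (rule abelian_groupI)
    fix y assume "y \<in> carrier H'"
    then obtain x where x: "x \<in> carrier H" "y = j x" by (auto simp: H'_simps)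
    then show "\<exists>z\<in>carrier H'. z \<oplus>\<^bsub>H'\<^esub> y = \<zero>\<^bsub>H'\<^esub>"
      by (intro bexI[of _ "j (\<ominus>\<^bsub>H\<^esub> x)"]) (auto simp: H'_simps H.M.l_neg)
  qed (auto simp: H'_simps H.M.a_ac)
  show "module R H'"
    by (rule moduleI[OF H.R.is_cring ab])
      (auto simp: H'_simps H.smult_l_distr H.smult_r_distr H.smult_assoc1)
  show "ring H'"
    by (rule ringI[OF ab])
      (auto intro!: monoidI simp: H'_simps H.A.l_distr H.A.r_distr H.A.m_assoc)
qed (auto simp: H'_simps H.smult_mult_left H.smult_mult_right)

lemma j_linear: "j \<in> linear_maps R H H'"
  by (rule linear_mapsI) (auto simp: H'_simps)

lemma i_linear: "i \<in> linear_maps R H' H"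
  by (rule linear_mapsI) (auto simp: H'_simps)

lemma lsum_td: "lsum P (\<lambda>(y, z). b y z) (td (j x)) = sw R H P (\<lambda>y z. b (j y) (j z)) x" if "x \<in> carrier H"
  using that by (simp add: td_def lsum_map sw_def case_prod_unfold)

lemma td_closed: "x \<in> carrier H \<Longrightarrow> set (td (j x)) \<subseteq> carrier H' \<times> carrier H'"
proof -
  assume x: "x \<in> carrier H"
  show ?thesis using H.decomp_closed'[OF x] x by (auto simp: td_def H'_simps)
qed

text \<open>The separating family is the whole dual. Composed with \<open>j\<close>, its members
  become functionals on \<open>H\<close>, so each required scalar identity is a Sweedler identity
  already known in \<open>H\<close>.\<close>

lemma H'_hopf: "hopf_algebra R H'"
proof (rule hopf_data.is_hopf_algebra, intro hopf_data.intro H'_algebra hopf_data_axioms.intro)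
  interpret H': k_algebra R H' by (rule H'_algebra)
  note s = H.R.scalar_algebra_module and m = H.module_axioms
  show "separating R H' (dual R H')" by (rule dual_separating[OF H.R.field_axioms H'.module_axioms])
  have dj: "(\<lambda>x. \<alpha> (j x)) \<in> dual R H" if "\<alpha> \<in> dual R H'" for \<alpha>
    by (rule linear_comp[OF that j_linear])
  have bj: "bilinear R H H (scalar_algebra R) (\<lambda>y z. \<alpha> (j y) \<otimes> \<beta> (j z))" if "\<alpha> \<in> dual R H'" "\<beta> \<in> dual R H'" for \<alpha> \<beta>
    by (rule H.R.bilinear_mult_dual[OF dj[OF that(1)] dj[OF that(2)]])
  have cj: "\<alpha> (j x) \<in> carrier R" if "\<alpha> \<in> dual R H'" "x \<in> carrier H" for \<alpha> x
    using linear_closed[OF dj[OF that(1)] that(2)] by simp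
  \<comment> \<open>Both targets have the same sums; \<open>scalar_algebra R\<close> is the form of
    the ring that the Sweedler lemmas accept as a module.\<close>
  have swR: "sw R H R b x = sw R H (scalar_algebra R) b x" for b x by (simp add: sw_def)
  show "counit H' \<in> alg_hom R H' (scalar_algebra R)"
    unfolding H'_simps(7)
  proof (rule alg_hom_comp[OF _ H.counit_hom])
    show "i \<in> alg_hom R H' H"
      using i_linear by (auto simp: alg_hom_def H'_simps intro!: ring_hom_memI)
  qed
  show "antipode H' \<in> linear_maps R H' H'"
    unfolding H'_simps(8) by (rule linear_comp[OF j_linear H.linear_antipode[OF i_linear]])
  {
    fix \<alpha> \<beta> assume ab: "\<alpha> \<in> dual R H'" "\<beta> \<in> dual R H'"
    show "(\<lambda>x. lsum R (\<lambda>(y, z). \<alpha> y \<otimes> \<beta> z) (td x)) \<in> dual R H'"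
      by (rule linear_cong[OF H'.module_axioms linear_comp[OF H.sw_linear[OF s bj[OF ab]] i_linear]])
        (auto simp: H'_simps lsum_td swR)
    show "lsum R (\<lambda>(u, v). \<alpha> u \<otimes> \<beta> v) (td \<one>\<^bsub>H'\<^esub>) = \<alpha> \<one>\<^bsub>H'\<^esub> \<otimes> \<beta> \<one>\<^bsub>H'\<^esub>"
      using H.sw_one[OF s bj[OF ab]] by (simp add: H'_simps lsum_td swR)
    fix x y assume "x \<in> carrier H'" "y \<in> carrier H'"
    then obtain x' y' where xy: "x' \<in> carrier H" "x = j x'" "y' \<in> carrier H" "y = j y'" by (auto simp: H'_simps)
    have "lsum R (\<lambda>(u, v). \<alpha> u \<otimes> \<beta> v) (prod_list_pairs H' H' (td x) (td y)) =
      lsum R (\<lambda>p. lsum R (\<lambda>q. \<alpha> (fst p \<otimes>\<^bsub>H'\<^esub> fst q) \<otimes> \<beta> (snd p \<otimes>\<^bsub>H'\<^esub> snd q)) (td y)) (td x)"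
    proof (rule H.R.lsum_prod_list_pairs)
      fix p q assume "p \<in> set (td x)" "q \<in> set (td y)"
      then have "p \<in> carrier H' \<times> carrier H'" "q \<in> carrier H' \<times> carrier H'"
        using td_closed[OF xy(1)] td_closed[OF xy(3)] xy by auto
      then show "\<alpha> (fst p \<otimes>\<^bsub>H'\<^esub> fst q) \<otimes> \<beta> (snd p \<otimes>\<^bsub>H'\<^esub> snd q) \<in> carrier R"
        using linear_closed[OF ab(1)] linear_closed[OF ab(2)] by (auto simp: mem_Times_iff)
    qed
    also have "\<dots> = lsum R (\<lambda>p. lsum R (\<lambda>q. \<alpha> (j (fst p) \<otimes>\<^bsub>H'\<^esub> j (fst q)) \<otimes> \<beta> (j (snd p) \<otimes>\<^bsub>H'\<^esub> j (snd q)))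
        (decomp R H y')) (decomp R H x')"
      using xy by (simp add: td_def lsum_map)
    also have "\<dots> = sw R H R (\<lambda>x1 x2. sw R H R (\<lambda>y1 y2. \<alpha> (j (x1 \<otimes>\<^bsub>H\<^esub> y1)) \<otimes> \<beta> (j (x2 \<otimes>\<^bsub>H\<^esub> y2))) y') x'"
      unfolding sw_def case_prod_unfold
      by (intro lsum_cong refl) (use H.decomp_closed'[OF xy(1)] H.decomp_closed'[OF xy(3)] in \<open>simp add: H'_simps\<close>)
    finally show "lsum R (\<lambda>(u, v). \<alpha> u \<otimes> \<beta> v) (td (x \<otimes>\<^bsub>H'\<^esub> y)) =
        lsum R (\<lambda>(u, v). \<alpha> u \<otimes> \<beta> v) (prod_list_pairs H' H' (td x) (td y))"
      using H.sw_mult[OF s bj[OF ab] xy(1,3)] xy by (simp add: H'_simps lsum_td swR)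
  }
  fix y assume "y \<in> carrier H'"
  then obtain x where x: "x \<in> carrier H" "y = j x" by (auto simp: H'_simps)
  show "set (td y) \<subseteq> carrier H' \<times> carrier H'" using td_closed[OF x(1)] x(2) by simp
  show "comult H' y = tens R H' H' (td y)" by (rule comult_H')
  have "lsum H' (\<lambda>(y, z). antipode H' y \<otimes>\<^bsub>H'\<^esub> z) (td y) = sw R H H' (\<lambda>y z. j (antipode H y \<otimes>\<^bsub>H\<^esub> z)) x"
    unfolding x(2) lsum_td[OF x(1)]
    by (rule H.sw_cong[OF x(1)]) (simp add: H'_simps H.antipode_closed)
  also have "\<dots> = j (sw R H H (\<lambda>y z. antipode H y \<otimes>\<^bsub>H\<^esub> z) x)"
    by (rule H.sw_apply[OF m H'.module_axioms j_linear x(1), symmetric]) (auto simp: H.antipode_closed)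
  finally show "lsum H' (\<lambda>(y, z). antipode H' y \<otimes>\<^bsub>H'\<^esub> z) (td y) = counit H' y \<odot>\<^bsub>H'\<^esub> \<one>\<^bsub>H'\<^esub>"
    using x H.counit_closed by (simp add: H.sw_antipode_left H'_simps)
  have "lsum H' (\<lambda>(y, z). y \<otimes>\<^bsub>H'\<^esub> antipode H' z) (td y) = sw R H H' (\<lambda>y z. j (y \<otimes>\<^bsub>H\<^esub> antipode H z)) x"
    unfolding x(2) lsum_td[OF x(1)]
    by (rule H.sw_cong[OF x(1)]) (simp add: H'_simps H.antipode_closed)
  also have "\<dots> = j (sw R H H (\<lambda>y z. y \<otimes>\<^bsub>H\<^esub> antipode H z) x)"
    by (rule H.sw_apply[OF m H'.module_axioms j_linear x(1), symmetric]) (auto simp: H.antipode_closed)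
  finally show "lsum H' (\<lambda>(y, z). y \<otimes>\<^bsub>H'\<^esub> antipode H' z) (td y) = counit H' y \<odot>\<^bsub>H'\<^esub> \<one>\<^bsub>H'\<^esub>"
    using x H.counit_closed by (simp add: H.sw_antipode_right H'_simps)
  fix \<alpha> assume a: "\<alpha> \<in> dual R H'"
  have "lsum R (\<lambda>(y, z). counit H' y \<otimes> \<alpha> z) (td y) = sw R H (scalar_algebra R) (\<lambda>y z. counit H y \<odot>\<^bsub>scalar_algebra R\<^esub> \<alpha> (j z)) x"
    unfolding x(2) lsum_td[OF x(1)] swR by (rule H.sw_cong[OF x(1)]) (simp add: H'_simps)
  then show "lsum R (\<lambda>(y, z). counit H' y \<otimes> \<alpha> z) (td y) = \<alpha> y"
    using H.sw_counit_left[OF s dj[OF a] x(1)] x(2) by simp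
  have "lsum R (\<lambda>(y, z). counit H' z \<otimes> \<alpha> y) (td y) = sw R H (scalar_algebra R) (\<lambda>y z. counit H z \<odot>\<^bsub>scalar_algebra R\<^esub> \<alpha> (j y)) x"
    unfolding x(2) lsum_td[OF x(1)] swR by (rule H.sw_cong[OF x(1)]) (simp add: H'_simps)
  then show "lsum R (\<lambda>(y, z). counit H' z \<otimes> \<alpha> y) (td y) = \<alpha> y"
    using H.sw_counit_right[OF s dj[OF a] x(1)] x(2) by simp
  fix \<beta> \<gamma> assume bc: "\<beta> \<in> dual R H'" "\<gamma> \<in> dual R H'"
  note ac = cj[OF a] and bcc = cj[OF bc(1)] and cc = cj[OF bc(2)]
  have ll: "(\<lambda>x. c \<otimes> g x) \<in> dual R H" "(\<lambda>x. g x \<otimes> c) \<in> dual R H" if "g \<in> dual R H" "c \<in> carrier R" for g c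
    using linear_smult_const[OF s that] linear_closed[OF that(1)] that
    by (auto simp: H.R.m_comm intro: linear_cong[OF H.module_axioms])
  have D: "fst p \<in> carrier H" "snd p \<in> carrier H" if "p \<in> set (decomp R H u)" "u \<in> carrier H" for p u
    using H.decomp_closed'[OF that(2,1)] by auto
  have "lsum R (\<lambda>(y, z). lsum R (\<lambda>(a, b). \<alpha> a \<otimes> \<beta> b) (td y) \<otimes> \<gamma> z) (td y) =
      sw R H R (\<lambda>y z. sw R H R (\<lambda>a b. \<alpha> (j a) \<otimes> (\<beta> (j b) \<otimes> \<gamma> (j z))) y) x"
    unfolding x(2) lsum_td[OF x(1)]
  proof (rule H.sw_cong[OF x(1)])
    fix y z assume yz: "y \<in> carrier H" "z \<in> carrier H"
    show "lsum R (\<lambda>(a, b). \<alpha> a \<otimes> \<beta> b) (td (j y)) \<otimes> \<gamma> (j z) = sw R H R (\<lambda>a b. \<alpha> (j a) \<otimes> (\<beta> (j b) \<otimes> \<gamma> (j z))) y"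
      unfolding lsum_td[OF yz(1)] unfolding sw_def case_prod_unfold using D[OF _ yz(1)] ac bcc cc[OF yz(2)]
      by (subst H.R.lsum_rdistr) (auto simp: H.R.m_assoc intro!: lsum_cong)
  qed
  also have "\<dots> = sw R H R (\<lambda>y z. sw R H R (\<lambda>a b. \<alpha> (j y) \<otimes> (\<beta> (j a) \<otimes> \<gamma> (j b))) z) x"
    unfolding swR
  proof (rule H.sw_coassoc[OF s _ x(1)])
    show "trilinear R H H H (scalar_algebra R) (\<lambda>a b c. \<alpha> (j a) \<otimes> (\<beta> (j b) \<otimes> \<gamma> (j c)))"
      unfolding trilinear_def
      by (intro conjI ballI ll dj a bc H.R.m_closed ac bcc cc; assumption)
  qed
  also have "\<dots> = lsum R (\<lambda>(y, z). \<alpha> y \<otimes> lsum R (\<lambda>(a, b). \<beta> a \<otimes> \<gamma> b) (td z)) (td y)"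
    unfolding x(2) lsum_td[OF x(1)]
  proof (rule H.sw_cong[OF x(1)])
    fix y z assume yz: "y \<in> carrier H" "z \<in> carrier H"
    show "sw R H R (\<lambda>a b. \<alpha> (j y) \<otimes> (\<beta> (j a) \<otimes> \<gamma> (j b))) z = \<alpha> (j y) \<otimes> lsum R (\<lambda>(a, b). \<beta> a \<otimes> \<gamma> b) (td (j z))"
      unfolding lsum_td[OF yz(2)] unfolding sw_def case_prod_unfold using D[OF _ yz(2)] bcc cc ac[OF yz(1)]
      by (subst H.R.lsum_ldistr) auto
  qed
  finally show "lsum R (\<lambda>(y, z). lsum R (\<lambda>(a, b). \<alpha> a \<otimes> \<beta> b) (td y) \<otimes> \<gamma> z) (td y) =
    lsum R (\<lambda>(y, z). \<alpha> y \<otimes> lsum R (\<lambda>(a, b). \<beta> a \<otimes> \<gamma> b) (td z)) (td y)" .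
qed

lemma j_hom: "j \<in> hopf_hom R H H'"
proof -
  interpret H': hopf_algebra R H' by (rule H'_hopf)
  have "j \<in> alg_hom R H H'"
    using j_linear by (auto simp: alg_hom_def H'_simps intro!: ring_hom_memI)
  moreover have "comult H' (j x) = tensor_map R H H H' H' j j (comult H x)" if "x \<in> carrier H" for x
    unfolding comult_H' H.comult_decomp[OF that]
      tensor_map_tens[OF H.module_axioms H.module_axioms H'.module_axioms H'.module_axioms j_linear j_linear H.decomp_closed[OF that]]
    using that by (simp add: td_def)
  ultimately show ?thesis by (simp add: hopf_hom_def H'_simps)
qed

lemma i_hom: "i \<in> hopf_hom R H' H"
proof -
  interpret H': hopf_algebra R H' by (rule H'_hopf)
  have "i \<in> alg_hom R H' H"
    using i_linear by (auto simp: alg_hom_def H'_simps intro!: ring_hom_memI)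
  moreover have "comult H (i (j x)) = tensor_map R H' H' H H i i (comult H' (j x))" if x: "x \<in> carrier H" for x
  proof -
    have "map (map_prod i i) (td (j x)) = decomp R H x"
      unfolding td_def using x H.decomp_closed'[OF x] by (auto intro!: map_idI)
    then show ?thesis
      unfolding comult_H' tensor_map_tens[OF H'.module_axioms H'.module_axioms H.module_axioms H.module_axioms i_linear i_linear td_closed[OF x]]
      using x by (simp add: H.comult_decomp)
  qed
  ultimately show ?thesis by (auto simp: hopf_hom_def H'_simps H.antipode_closed)
qed

end

section \<open>Coding word functions by sequences\<close>

context words
begin

text \<open>A list of rows as a table with values in \<open>'k \<times> 'a\<close>: column 0 tells
  whether row \<open>i\<close> exists, column 1 holds its coefficient, and the further columns hold
  its entries from \<open>A\<close>. The component that carries no information is filled with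
  \<open>undefined\<close> or \<open>\<one>\<close>.\<close>

definition entry :: "('k \<times> 'a list) list \<Rightarrow> nat \<Rightarrow> nat \<Rightarrow> 'k \<times> 'a" where
  "entry L i j = (if j = 0 then (if i < length L then \<one> else \<zero>, undefined)
    else if j = 1 then (fst (L ! i), undefined) else (\<one>, snd (L ! i) ! (j - 2)))"

lemma entry_inject:
  assumes "set L \<subseteq> rows ns" "set L' \<subseteq> rows ns" "\<And>i j. entry L i j = entry L' i j"
  shows "L = L'"
proof (rule nth_equalityI)
  \<comment> \<open>Column 0 reveals the number of rows, since one and zero differ in a
    field.\<close>
  have "i < length L \<longleftrightarrow> i < length L'" for i
    using assms(3)[of i 0] R.one_not_zero by (auto simp: entry_def split: if_splits)
  then show len: "length L = length L'" by (meson nat_neq_iff)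
  fix i assume i: "i < length L"
  then have "L ! i \<in> rows ns" "L' ! i \<in> rows ns" using assms(1,2) len by (auto dest: nth_mem)
  then have l: "length (snd (L ! i)) = length ns" "length (snd (L' ! i)) = length ns" by (auto simp: rows_def)
  have "snd (L ! i) = snd (L' ! i)"
  proof (rule nth_equalityI)
    \<comment> \<open>Columns 0 and 1 are taken, so entry \<open>t\<close> of the row sits in column
      \<open>t + 2\<close>.\<close>
    show "snd (L ! i) ! t = snd (L' ! i) ! t" for t
      using assms(3)[of i "t + 2"] by (simp add: entry_def)
  qed (use l in simp)
  moreover have "fst (L ! i) = fst (L' ! i)" using assms(3)[of i 1] by (simp add: entry_def)
  ultimately show "L ! i = L' ! i" by (simp add: prod_eq_iff)
qed

text \<open>The natural number codes an index list, a row and a column. Functionals are not coded: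
  the rows at an index list determine the function on all words with these indices, so the map is
  injective on \<open>tensorial\<close>.\<close>

definition encode :: "(('k, 'a) letter list \<Rightarrow> 'k) \<Rightarrow> ('k, 'a) cofree_carrier" where
  "encode \<phi> n = (case prod_decode n of (c, m) \<Rightarrow> case prod_decode m of (i, j) \<Rightarrow> entry (rep \<phi> (list_decode c)) i j)"

lemma encode_inj: "inj_on encode tensorial"
proof (rule inj_onI)
  fix \<phi> \<psi> assume t: "\<phi> \<in> tensorial" "\<psi> \<in> tensorial" and eq: "encode \<phi> = encode \<psi>"
  have r: "rep \<phi> ns = rep \<psi> ns" for ns
  proof (rule entry_inject)
    show "set (rep \<phi> ns) \<subseteq> rows ns" "set (rep \<psi> ns) \<subseteq> rows ns"
      using representsD(1)[OF represents_rep[OF t(1)]] representsD(1)[OF represents_rep[OF t(2)]] by auto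
    show "entry (rep \<phi> ns) i j = entry (rep \<psi> ns) i j" for i j
      using fun_cong[OF eq, of "prod_encode (list_encode ns, prod_encode (i, j))"] by (simp add: encode_def)
  qed
  show "\<phi> = \<psi>"
    by (rule ext) (simp add: representsD(2)[OF represents_rep[OF t(1)] refl] representsD(2)[OF represents_rep[OF t(2)] refl] r)
qed

sublocale tr: hopf_transport R HA encode
  by (intro hopf_transport.intro HA_hopf hopf_transport_axioms.intro)
    (auto intro: inj_on_subset[OF encode_inj])

lemma cofree_transport:
  "cofree_hopf_algebra TYPE('c) R A tr.H' (\<lambda>y. proj (tr.i y))"
  by (rule cofree_hopf_algebra_transfer[OF HA_cofree tr.H'_hopf _ tr.j_hom tr.i_hom])
    (auto simp: tr.H'_simps intro: alg_hom_comp[OF hopf_homD(1)[OF tr.i_hom] proj_alg_hom])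

end

text \<open>Both objects live on the type \<open>'h\<close> and are cofree for tests on that type,
  so each is a test object for the other. This gives maps over \<open>A\<close> in both directions,
  whose composite on \<open>H\<close> is the identity by uniqueness; along them the universal
  property for tests on \<open>'c\<close> passes from \<open>H1\<close> to \<open>H\<close>.\<close>

lemma cofree_hopf_algebra_isomorphic:
  fixes H1 H :: "('k, 'h) hopf"
  assumes small: "cofree_hopf_algebra TYPE('h) R A H1 p1"
    and test: "cofree_hopf_algebra TYPE('c) R A H1 p1"
    and other: "cofree_hopf_algebra TYPE('h) R A H p"
  shows "cofree_hopf_algebra TYPE('c) R A H p"
proof -
  note D1 = small[unfolded cofree_hopf_algebra_def] and D2 = other[unfolded cofree_hopf_algebra_def]
  have h1: "hopf_algebra R H1" "p1 \<in> alg_hom R H1 A" and h2: "hopf_algebra R H" "p \<in> alg_hom R H A"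
    using D1 D2 by auto
  obtain u where u: "u \<in> hopf_hom R H1 H" "\<forall>x\<in>carrier H1. p (u x) = p1 x"
    using D2 h1 by blast
  obtain v where v: "v \<in> hopf_hom R H H1" "\<forall>x\<in>carrier H. p1 (v x) = p x"
    using D1 h2 by blast
  show ?thesis
  proof (rule cofree_hopf_algebra_transfer[OF test h2 u(1) v(1)])
    show "u (v x) = x" if "x \<in> carrier H" for x
      by (rule cofree_hopf_algebra_unique[OF other h2 hopf_hom_comp[OF h2(1) h1(1) h2(1) v(1) u(1)] _ hopf_hom_id[OF h2(1)] _ that])
        (use u(2) v(2) hopf_homD(3)[OF v(1)] in auto)
  qed (use u(2) in auto)
qed

theorem theorem2p5:
  fixes k :: "'k ring" and A :: "('k, 'a) module"
  assumes "field k" and "k_algebra k A"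
  shows "(\<exists>(H :: ('k, ('k, 'a) cofree_carrier) hopf) p.
            cofree_hopf_algebra TYPE(('k, 'a) cofree_carrier) k A H p) \<and>
         (\<forall>(H :: ('k, ('k, 'a) cofree_carrier) hopf) p.
            cofree_hopf_algebra TYPE(('k, 'a) cofree_carrier) k A H p \<longrightarrow>
            cofree_hopf_algebra TYPE('c) k A H p)"
proof -
  have "words k A" using assms(2) by (rule words.intro)
  \<comment> \<open>The fact holds for every test type. It is used both for the carrier type of the
    constructed object and for \<open>'c\<close>.\<close>
  note cofree = words.cofree_transport[OF this]
  show ?thesis
    using cofree cofree_hopf_algebra_isomorphic[OF cofree cofree] by blast
qed

end
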